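(* Assume that $f$ is $\mu$-quasi strongly convex, $\mu\ge0$, and the functions $f_{ij}$ are convex and $L$-smooth for all $i\in\{1,\dots,n\}$, $j\in\{1,\dots,m\}$. Consider D-QLSVRG with delay $\tau\ge1$, $p\in(0,1)$ and $$0<\gamma\le\min\left\{\frac3{56L\left(1+\frac{2\omega}n\right)},\ \frac1{8L\sqrt{\tau\left(\tau+2\left(1+\frac{2\omega}n\right)\left(1+\frac2{1-p}\right)\right)}}\right\}.$$ Then D-QLSVRG satisfies the parametric assumption of the context with $A'=2L\left(1+\frac{2\omega}n\right)$, $B_1'=0$, $B_2'=2\left(1+\frac{2\omega}n\right)$, $D_1'=\frac{2\omega}{n^2}\sum_{i=1}^n\|\nabla f_i(x^* )\|^2$, $\sigma_{1,k}^2\equiv0$, $\sigma_{2,k}^2=\sigma_k^2=\frac1{nm}\sum_{i=1}^n\sum_{j=1}^m\|\nabla f_{ij}(w_i^k)-\nabla f_{ij}(x^* )\|^2$, $\rho_1=1$, $\rho_2=p$, $C_1=0$, $C_2=Lp$, $D_2=0$, $G=0$, $F_1=0$, $$F_2=\frac{12\gamma^2L\tau\left(1+\frac{2\omega}n\right)(2+p)}p,\qquad D_3=\frac{6\gamma\tau L\omega}{n^2}\sum_{i=1}^n\|\nabla f_i(x^* )\|^2.$$ Moreover, with $M_2=\frac{8(1+\frac{2\omega}n)}{3p}$ and $T^0=\|x^0-x^*\|^2+M_2\gamma^2\sigma_0^2$, for all $K\ge0$ $$\mathbf E[f(\bar x^K)-f(x^* )]\le\left(1-\min\left\{\frac{\gamma\mu}2,\frac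 p4\right\}\right)^K\frac{4(T^0+\gamma F_2\sigma_0^2)}\gamma+4\gamma(D_1'+D_3)$$ when $\mu>0$, and $$\mathbf E[f(\bar x^K)-f(x^* )]\le\frac{4(T^0+\gamma F_2\sigma_0^2)}{\gamma K}+4\gamma(D_1'+D_3)$$ when $\mu=0$ (right-hand side read as $+\infty$ for $K=0$).
   Context: $f(x)=\frac1n\sum_{i=1}^nf_i(x)$, $f_i(x)=\frac1m\sum_{j=1}^mf_{ij}(x)$ on $\mathbb R^d$. A function is $L$-smooth if it is differentiable with $L$-Lipschitz gradient. $f$ is $\mu$-quasi strongly convex if it has a unique minimizer $x^*$ and $f(x^* )\ge f(x)+\langle\nabla f(x),x^*-x\rangle+\frac\mu2\|x-x^*\|^2$ for all $x$. $Q$ is a randomized quantization operator with $\mathbf E[Q(x)]=x$, $\mathbf E\|Q(x)-x\|^2\le\omega\|x\|^2$ for all $x$, $\omega>0$. All random choices use fresh independent randomness. Delayed framework with integer delay $\tau\ge1$: $x^{k+1}=x^k-\frac1n\sum_iv_i^k$, where $v_i^k=\gamma g_i^{k-\tau}$ if $k\ge\tau$ and $v_i^k=0$ if $k<\tau$; $e_i^{k+1}=e_i^k+\gamma g_i^k-v_i^k$, $e_i^0=0$; $x^0$ deterministic. Here $g_i^k$ is the stochastic vector associated with the point $x^k$. D-QLSVRG: given deterministic $w_i^0\in\mathbb R^d$; for $k\ge0$ worker $i$ picks $l$ uniformly from $\{1,\dots,m\}$, sets $\hat g_i^k=\nabla f_{il}(x^k)-\nabla f_{il}(w_i^k)+\nabla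 f_i(w_i^k)$, $g_i^k=Q(\hat g_i^k)$, and $w_i^{k+1}=x^k$ with probability $p$, $w_i^{k+1}=w_i^k$ with probability $1-p$. Parametric assumption: let $g^k=\frac1n\sum_ig_i^k$, $e^k=\frac1n\sum_ie_i^k$, $\mathbf E_k$ the conditional expectation given $x^k$ and all randomness used to generate $g_i^t,w_i^{t+1}$ for $t<k$. For all $k,K\ge0$: $\mathbf E_k[g^k]=\nabla f(x^k)$; $\mathbf E_k\|g^k\|^2\le2A'(f(x^k)-f(x^* ))+B_1'\sigma_{1,k}^2+B_2'\sigma_{2,k}^2+D_1'$; $\mathbf E_k[\sigma_{1,k+1}^2]\le(1-\rho_1)\sigma_{1,k}^2+2C_1(f(x^k)-f(x^* ))+G\rho_1\sigma_{2,k}^2+D_2$; $\mathbf E_k[\sigma_{2,k+1}^2]\le(1-\rho_2)\sigma_{2,k}^2+2C_2(f(x^k)-f(x^* ))$; $3L\sum_{k=0}^Kw_k\mathbf E\|e^k\|^2\le\frac14\sum_{k=0}^Kw_k\mathbf E[f(x^k)-f(x^* )]+F_1\sigma_{1,0}^2+F_2\sigma_{2,0}^2+\gamma D_3W_K$, where (scalar weights) $w_k=(1-\eta)^{-(k+1)}$, $W_K=\sum_{k=0}^Kw_k$, $\eta=\min\{\frac{\gamma\mu}2,\frac{\rho_1}4,\frac{\rho_2}4\}$. Also $\bar x^K=\frac1{W_K}\sum_{k=0}^Kw_kx^k$. *)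

theory Defs
  imports "HOL-Probability.Probability"
begin

definition grad :: "('a::euclidean_space \<Rightarrow> real) \<Rightarrow> 'a \<Rightarrow> 'a" where
  "grad f x = (THE D. GDERIV f x :> D)"

definition L_smooth :: "real \<Rightarrow> ('a::euclidean_space \<Rightarrow> real) \<Rightarrow> bool" where
  "L_smooth L f \<longleftrightarrow> (\<forall>x. f differentiable (at x)) \<and> L-lipschitz_on UNIV (grad f)"

definition quasi_strongly_convex ::
    "real \<Rightarrow> ('a::euclidean_space \<Rightarrow> real) \<Rightarrow> 'a \<Rightarrow> bool" where
  "quasi_strongly_convex \<mu> f xs \<longleftrightarrow>
     {x. \<forall>y. f x \<le> f y} = {xs} \<and>
     (\<forall>x. f xs \<ge> f x + grad f x \<bullet> (xs - x) + \<mu> / 2 * (norm (x - xs))\<^sup>2)"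

definition avg :: "nat \<Rightarrow> (nat \<Rightarrow> 'a::real_vector) \<Rightarrow> 'a" where
  "avg n u = (1 / real n) *\<^sub>R (\<Sum>i=1..n. u i)"

definition local_loss :: "nat \<Rightarrow> (nat \<Rightarrow> nat \<Rightarrow> 'a \<Rightarrow> real) \<Rightarrow> nat \<Rightarrow> 'a \<Rightarrow> real" where
  "local_loss m fs i x = avg m (\<lambda>j. fs i j x)"

definition global_loss ::
    "nat \<Rightarrow> nat \<Rightarrow> (nat \<Rightarrow> nat \<Rightarrow> 'a \<Rightarrow> real) \<Rightarrow> 'a \<Rightarrow> real" where
  "global_loss n m fs x = avg n (\<lambda>i. local_loss m fs i x)"

text \<open>A randomized operator is a measurable function of its argument and of a random seed with
  law \<open>S\<close>. The integrability conditions are needed because the Bochner integral of a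
  non-integrable function is 0.\<close>

definition quantizer ::
    "'s measure \<Rightarrow> ('a::euclidean_space \<Rightarrow> 's \<Rightarrow> 'a) \<Rightarrow> real \<Rightarrow> bool" where
  "quantizer S Q \<omega> \<longleftrightarrow>
     prob_space S \<and>
     (\<lambda>(x, s). Q x s) \<in> borel_measurable (borel \<Otimes>\<^sub>M S) \<and>
     (\<forall>x. integrable S (Q x) \<and> (\<integral>s. Q x s \<partial>S) = x) \<and>
     (\<forall>x. integrable S (\<lambda>s. (norm (Q x s - x))\<^sup>2) \<and>
          (\<integral>s. (norm (Q x s - x))\<^sup>2 \<partial>S) \<le> \<omega> * (norm x)\<^sup>2)"

text \<open>At step \<open>k\<close> worker \<open>i\<close> draws a triple: an index, a seed for the quantizer, and a coin.
  The law of a triple is a product measure, so its components are independent, and triples for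
  different \<open>(k, i)\<close> are independent. Indices lie in \<open>{1..m}\<close> everywhere, not just almost everywhere:
  outside this range the loss functions are unconstrained, possibly not even measurable.\<close>

definition draw ::
    "(nat \<Rightarrow> nat \<Rightarrow> 'b \<Rightarrow> nat) \<Rightarrow> (nat \<Rightarrow> nat \<Rightarrow> 'b \<Rightarrow> 's) \<Rightarrow> (nat \<Rightarrow> nat \<Rightarrow> 'b \<Rightarrow> bool) \<Rightarrow>
     nat \<Rightarrow> nat \<Rightarrow> 'b \<Rightarrow> nat \<times> 's \<times> bool" where
  "draw idx seed coin k i \<xi> = (idx k i \<xi>, seed k i \<xi>, coin k i \<xi>)"

definition draw_space :: "'s measure \<Rightarrow> (nat \<times> 's \<times> bool) measure" where
  "draw_space S = count_space UNIV \<Otimes>\<^sub>M (S \<Otimes>\<^sub>M count_space UNIV)"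

definition fresh_randomness ::
    "'b measure \<Rightarrow> 's measure \<Rightarrow> nat \<Rightarrow> nat \<Rightarrow> real \<Rightarrow>
     (nat \<Rightarrow> nat \<Rightarrow> 'b \<Rightarrow> nat) \<Rightarrow> (nat \<Rightarrow> nat \<Rightarrow> 'b \<Rightarrow> 's) \<Rightarrow> (nat \<Rightarrow> nat \<Rightarrow> 'b \<Rightarrow> bool) \<Rightarrow> bool" where
  "fresh_randomness M S n m p idx seed coin \<longleftrightarrow>
     prob_space.indep_vars M (\<lambda>_. draw_space S) (\<lambda>(k, i). draw idx seed coin k i)
       (UNIV \<times> {1..n}) \<and>
     (\<forall>k. \<forall>i\<in>{1..n}. \<forall>\<xi>\<in>space M. idx k i \<xi> \<in> {1..m}) \<and>
     (\<forall>k. \<forall>i\<in>{1..n}. distr M (draw_space S) (draw idx seed coin k i) =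
        measure_pmf (pmf_of_set {1..m}) \<Otimes>\<^sub>M (S \<Otimes>\<^sub>M measure_pmf (bernoulli_pmf p)))"

text \<open>Conditioning on \<open>x k\<close> and on all draws made at steps \<open>t < k\<close>.\<close>

definition past ::
    "'b measure \<Rightarrow> 's measure \<Rightarrow> nat \<Rightarrow>
     (nat \<Rightarrow> nat \<Rightarrow> 'b \<Rightarrow> nat) \<Rightarrow> (nat \<Rightarrow> nat \<Rightarrow> 'b \<Rightarrow> 's) \<Rightarrow> (nat \<Rightarrow> nat \<Rightarrow> 'b \<Rightarrow> bool) \<Rightarrow>
     (nat \<Rightarrow> 'b \<Rightarrow> 'a::euclidean_space) \<Rightarrow> nat \<Rightarrow> 'b measure" where
  "past M S n idx seed coin x k = sigma (space M)
     (sets (vimage_algebra (space M) (x k) borel) \<union>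
      (\<Union>t\<in>{..<k}. \<Union>i\<in>{1..n}.
         sets (vimage_algebra (space M) (draw idx seed coin t i) (draw_space S))))"

definition delayed_framework ::
    "'b measure \<Rightarrow> nat \<Rightarrow> nat \<Rightarrow> real \<Rightarrow> 'a::euclidean_space \<Rightarrow> (nat \<Rightarrow> 'b \<Rightarrow> 'a) \<Rightarrow>
     (nat \<Rightarrow> nat \<Rightarrow> 'b \<Rightarrow> 'a) \<Rightarrow> (nat \<Rightarrow> nat \<Rightarrow> 'b \<Rightarrow> 'a) \<Rightarrow> (nat \<Rightarrow> nat \<Rightarrow> 'b \<Rightarrow> 'a) \<Rightarrow> bool" where
  "delayed_framework M n \<tau> \<gamma> x0 x g v e \<longleftrightarrow> (\<forall>\<xi>\<in>space M.
     x 0 \<xi> = x0 \<and>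
     (\<forall>k. x (Suc k) \<xi> = x k \<xi> - avg n (\<lambda>i. v k i \<xi>)) \<and>
     (\<forall>k. \<forall>i\<in>{1..n}. v k i \<xi> = (if \<tau> \<le> k then \<gamma> *\<^sub>R g (k - \<tau>) i \<xi> else 0)) \<and>
     (\<forall>i\<in>{1..n}. e 0 i \<xi> = 0) \<and>
     (\<forall>k. \<forall>i\<in>{1..n}. e (Suc k) i \<xi> = e k i \<xi> + \<gamma> *\<^sub>R g k i \<xi> - v k i \<xi>))"

definition qlsvrg_oracle ::
    "'b measure \<Rightarrow> nat \<Rightarrow> nat \<Rightarrow> (nat \<Rightarrow> nat \<Rightarrow> 'a::euclidean_space \<Rightarrow> real) \<Rightarrow> ('a \<Rightarrow> 's \<Rightarrow> 'a) \<Rightarrow>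
     (nat \<Rightarrow> nat \<Rightarrow> 'b \<Rightarrow> nat) \<Rightarrow> (nat \<Rightarrow> nat \<Rightarrow> 'b \<Rightarrow> 's) \<Rightarrow> (nat \<Rightarrow> nat \<Rightarrow> 'b \<Rightarrow> bool) \<Rightarrow>
     (nat \<Rightarrow> 'a) \<Rightarrow> (nat \<Rightarrow> 'b \<Rightarrow> 'a) \<Rightarrow> (nat \<Rightarrow> nat \<Rightarrow> 'b \<Rightarrow> 'a) \<Rightarrow> (nat \<Rightarrow> nat \<Rightarrow> 'b \<Rightarrow> 'a) \<Rightarrow> bool" where
  "qlsvrg_oracle M n m fs Q idx seed coin w0 x w g \<longleftrightarrow> (\<forall>\<xi>\<in>space M. \<forall>i\<in>{1..n}.
     w 0 i \<xi> = w0 i \<and>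
     (\<forall>k. g k i \<xi> = Q (grad (fs i (idx k i \<xi>)) (x k \<xi>) - grad (fs i (idx k i \<xi>)) (w k i \<xi>)
                        + grad (local_loss m fs i) (w k i \<xi>)) (seed k i \<xi>)) \<and>
     (\<forall>k. w (Suc k) i \<xi> = (if coin k i \<xi> then x k \<xi> else w k i \<xi>)))"

definition vec_cond_exp ::
    "'b measure \<Rightarrow> 'b measure \<Rightarrow> ('b \<Rightarrow> 'a::euclidean_space) \<Rightarrow> 'b \<Rightarrow> 'a" where
  "vec_cond_exp M F X \<xi> = (\<Sum>b\<in>Basis. real_cond_exp M F (\<lambda>\<zeta>. X \<zeta> \<bullet> b) \<xi> *\<^sub>R b)"

definition weight :: "real \<Rightarrow> nat \<Rightarrow> real" where
  "weight \<eta> k = inverse ((1 - \<eta>) ^ (k + 1))"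

definition weight_sum :: "real \<Rightarrow> nat \<Rightarrow> real" where
  "weight_sum \<eta> K = (\<Sum>k\<le>K. weight \<eta> k)"

definition weighted_avg :: "real \<Rightarrow> (nat \<Rightarrow> 'a::real_vector) \<Rightarrow> nat \<Rightarrow> 'a" where
  "weighted_avg \<eta> x K = (1 / weight_sum \<eta> K) *\<^sub>R (\<Sum>k\<le>K. weight \<eta> k *\<^sub>R x k)"

record parametric_constants =
  par_A :: real
  par_B1 :: real
  par_B2 :: real
  par_D1 :: real
  par_rho1 :: real
  par_rho2 :: real
  par_C1 :: real
  par_C2 :: real
  par_D2 :: real
  par_G :: real
  par_F1 :: real
  par_F2 :: real
  par_D3 :: real

definition par_eta :: "real \<Rightarrow> real \<Rightarrow> parametric_constants \<Rightarrow> real" where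
  "par_eta \<gamma> \<mu> c = min (\<gamma> * \<mu> / 2) (min (par_rho1 c / 4) (par_rho2 c / 4))"

text \<open>\<open>F k\<close> is the sigma-algebra behind the conditional expectation at step \<open>k\<close>; \<open>s1 k\<close> and
  \<open>s2 k\<close> are the quantities usually written as squares (sigma-one and sigma-two squared); \<open>g\<close>
  and \<open>e\<close> are already averaged over the workers. The first two conditions ensure that the
  (conditional) expectations below are genuine: the library operators return junk values outside
  this range. The last condition mentions the random variables \<open>s1 0\<close> and \<open>s2 0\<close> (which are
  constant in the intended use), hence the almost-everywhere quantifier.\<close>

definition parametric_assumption ::
    "'b measure \<Rightarrow> (nat \<Rightarrow> 'b measure) \<Rightarrow> ('a::euclidean_space \<Rightarrow> real) \<Rightarrow> 'a \<Rightarrow>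
     real \<Rightarrow> real \<Rightarrow> real \<Rightarrow> (nat \<Rightarrow> 'b \<Rightarrow> 'a) \<Rightarrow> (nat \<Rightarrow> 'b \<Rightarrow> 'a) \<Rightarrow> (nat \<Rightarrow> 'b \<Rightarrow> 'a) \<Rightarrow>
     (nat \<Rightarrow> 'b \<Rightarrow> real) \<Rightarrow> (nat \<Rightarrow> 'b \<Rightarrow> real) \<Rightarrow> parametric_constants \<Rightarrow> bool" where
  "parametric_assumption M F f xs L \<gamma> \<mu> x g e s1 s2 c \<longleftrightarrow>
     (\<forall>k. subalgebra M (F k)) \<and>
     (\<forall>k. integrable M (g k) \<and> integrable M (\<lambda>\<xi>. (norm (g k \<xi>))\<^sup>2) \<and>
          integrable M (\<lambda>\<xi>. f (x k \<xi>)) \<and> integrable M (\<lambda>\<xi>. (norm (e k \<xi>))\<^sup>2) \<and>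
          integrable M (s1 k) \<and> integrable M (s2 k)) \<and>
     (\<forall>k. AE \<xi> in M. vec_cond_exp M (F k) (g k) \<xi> = grad f (x k \<xi>)) \<and>
     (\<forall>k. AE \<xi> in M. real_cond_exp M (F k) (\<lambda>\<zeta>. (norm (g k \<zeta>))\<^sup>2) \<xi>
        \<le> 2 * par_A c * (f (x k \<xi>) - f xs) + par_B1 c * s1 k \<xi> + par_B2 c * s2 k \<xi> + par_D1 c) \<and>
     (\<forall>k. AE \<xi> in M. real_cond_exp M (F k) (s1 (Suc k)) \<xi>
        \<le> (1 - par_rho1 c) * s1 k \<xi> + 2 * par_C1 c * (f (x k \<xi>) - f xs)
           + par_G c * par_rho1 c * s2 k \<xi> + par_D2 c) \<and>
     (\<forall>k. AE \<xi> in M. real_cond_exp M (F k) (s2 (Suc k)) \<xi>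
        \<le> (1 - par_rho2 c) * s2 k \<xi> + 2 * par_C2 c * (f (x k \<xi>) - f xs)) \<and>
     (\<forall>K. AE \<xi> in M.
        3 * L * (\<Sum>k\<le>K. weight (par_eta \<gamma> \<mu> c) k * (\<integral>\<zeta>. (norm (e k \<zeta>))\<^sup>2 \<partial>M))
        \<le> 1 / 4 * (\<Sum>k\<le>K. weight (par_eta \<gamma> \<mu> c) k * (\<integral>\<zeta>. f (x k \<zeta>) - f xs \<partial>M))
           + par_F1 c * s1 0 \<xi> + par_F2 c * s2 0 \<xi>
           + \<gamma> * par_D3 c * weight_sum (par_eta \<gamma> \<mu> c) K)"

definition sigma_sq ::
    "nat \<Rightarrow> nat \<Rightarrow> (nat \<Rightarrow> nat \<Rightarrow> 'a::euclidean_space \<Rightarrow> real) \<Rightarrow> 'a \<Rightarrow> (nat \<Rightarrow> 'a) \<Rightarrow> real" where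
  "sigma_sq n m fs xs w =
     1 / (real n * real m) *
       (\<Sum>i=1..n. \<Sum>j=1..m. (norm (grad (fs i j) (w i) - grad (fs i j) xs))\<^sup>2)"

end

theory Submission
  imports Defs
begin

text \<open>
  Let \<open>e\<close> be the error averaged over the workers. It is \<open>\<gamma>\<close> times the sum of the at most \<open>\<tau>\<close>
  stochastic gradients that have been computed but not yet applied, so the virtual iterate
  \<open>x - e\<close> moves by exactly \<open>- \<gamma> g\<close> in every step: the delay disappears
  (\<open>virtual_step\<close>). Its squared distance to the minimizer obeys the recursion of undelayed stochastic
  gradient descent, except for a multiple of \<open>(norm e)\<^sup>2\<close>, which arises because the gradient is
  taken at \<open>x\<close> instead of \<open>x - e\<close> (\<open>descent_direction\<close>, \<open>virtual_dist_step\<close>). Adding a multiple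
  of \<open>sigma_sq\<close> gives a Lyapunov function that contracts by \<open>1 - \<eta>\<close>; with geometric weights the
  recursion telescopes (\<open>weighted_suboptimality\<close>), and convexity transfers the bound to the weighted
  average of the iterates.

  The second moment of the stochastic gradient splits into the squared true gradient, the variance of the
  SVRG estimator and the quantization error, the latter two averaged down by \<open>1 / n\<close> because the
  workers draw independently. Both are controlled by the gradient differences to the minimizer, which
  for convex smooth components are bounded by the function gap (\<open>total_noise_bounds\<close>).

  The delicate point is the bound on the accumulated error. A window of stochastic gradients is a sum of
  true gradients plus a sum of noises. The noises are mutually orthogonal, but the two sums are correlated,
  since later iterates depend on earlier noise, so the square of their sum is split by Young's inequality at
  the price of a factor greater than one for each. The quantization error contains the gradients at the
  minimizer, again only up to Young's inequality. The constant demanded for these gradients leaves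
  room for a total factor of two, so equal weights in both inequalities, which cost a factor of two each, are too much: \<open>5/3\<close> for the noise
  against \<open>5/2\<close> for the gradients, and \<open>6/5\<close> for the gradients at the minimizer against \<open>6\<close> for the
  differences, give exactly \<open>5/3 * 6/5 = 2\<close>, and all other terms fit under the bound on the step size
  (\<open>mean_error_le\<close>, \<open>weighted_delay_error\<close>).

  The probabilistic input is a single principle: a fresh draw is independent of the \<sigma>-algebra
  generated by any set of other draws, so that \<sigma>-algebra can be frozen while integrating over the
  draw (\<open>freeze_integral\<close>). Applied to all draws up to and including a step, except the one in
  question, it makes the noise of that draw orthogonal to earlier noises and to those of the other
  workers at once (\<open>noise_cross_aux\<close>). Inserting the indicator of a past event turns these identities
  into conditional expectations (\<open>cond_exp_historyI\<close>).
\<close>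

section \<open>Smooth convex functions\<close>

lemma GDERIV_unique:
  fixes f :: "'a::euclidean_space \<Rightarrow> real"
  assumes "GDERIV f x :> D" "GDERIV f x :> E"
  shows "D = E"
proof -
  have "(\<lambda>h. h \<bullet> D) = (\<lambda>h. h \<bullet> E)"
    using assms unfolding gderiv_def by (rule has_derivative_unique)
  then have "D \<bullet> b = E \<bullet> b" for b by (metis inner_commute)
  then show ?thesis by (simp add: euclidean_eq_iff[where 'a='a])
qed

lemma grad_eqI:
  fixes f :: "'a::euclidean_space \<Rightarrow> real"
  assumes "GDERIV f x :> D"
  shows "grad f x = D"
  unfolding grad_def using assms GDERIV_unique by (intro the_equality) blast+

lemma GDERIV_grad:
  fixes f :: "'a::euclidean_space \<Rightarrow> real"
  assumes "f differentiable (at x)"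
  shows "GDERIV f x :> grad f x"
proof -
  obtain f' where f': "(f has_derivative f') (at x)"
    using assms by (auto simp: differentiable_def)
  interpret f': bounded_linear f' using f' by (rule has_derivative_bounded_linear)
  define D where "D = (\<Sum>b\<in>Basis. f' b *\<^sub>R b)"
  have "f' h = h \<bullet> D" for h
  proof -
    have "f' h = f' (\<Sum>b\<in>Basis. (h \<bullet> b) *\<^sub>R b)" by (simp add: euclidean_representation)
    also have "\<dots> = (\<Sum>b\<in>Basis. (h \<bullet> b) * f' b)" by (simp add: f'.sum f'.scaleR)
    also have "\<dots> = h \<bullet> D" unfolding D_def inner_sum_right by (simp add: mult.commute)
    finally show ?thesis .
  qed
  then have "f' = (\<lambda>h. h \<bullet> D)" by auto
  then have "GDERIV f x :> D" using f' unfolding gderiv_def by simp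
  then show ?thesis using grad_eqI by metis
qed

lemma GDERIV_avg:
  fixes u :: "nat \<Rightarrow> 'a::euclidean_space \<Rightarrow> real"
  assumes "\<And>i. i \<in> {1..n} \<Longrightarrow> GDERIV (u i) x :> D i"
  shows "GDERIV (\<lambda>z. avg n (\<lambda>i. u i z)) x :> avg n D"
proof -
  have "((\<lambda>z. (1 / real n) *\<^sub>R (\<Sum>i=1..n. u i z)) has_derivative
         (\<lambda>h. (1 / real n) *\<^sub>R (\<Sum>i=1..n. h \<bullet> D i))) (at x)"
    using assms unfolding gderiv_def by (intro has_derivative_scaleR_right has_derivative_sum)
  then show ?thesis unfolding gderiv_def avg_def by (simp add: inner_sum_right)
qed

lemma L_smoothD:
  assumes "L_smooth L f"
  shows "GDERIV f x :> grad f x" "dist (grad f x) (grad f y) \<le> L * dist x y" "L \<ge> 0"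
  using assms unfolding L_smooth_def by (auto intro: GDERIV_grad lipschitz_onD lipschitz_on_nonneg)

lemma DERIV_along_line:
  fixes f :: "'a::euclidean_space \<Rightarrow> real"
  assumes "\<And>z. GDERIV f z :> g z"
  shows "((\<lambda>t. f (x + t *\<^sub>R d)) has_real_derivative (g (x + t *\<^sub>R d) \<bullet> d)) (at t within T)"
proof -
  have "((\<lambda>t. f (x + t *\<^sub>R d)) has_derivative (\<lambda>h. (h *\<^sub>R d) \<bullet> g (x + t *\<^sub>R d))) (at t within T)"
    by (rule has_derivative_compose[where f="\<lambda>t. x + t *\<^sub>R d" and f'="\<lambda>h. h *\<^sub>R d"
          and g'="\<lambda>h. h \<bullet> g (x + t *\<^sub>R d)", OF _ assms[unfolded gderiv_def]])
       (auto intro!: derivative_eq_intros)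
  then show ?thesis
    unfolding has_field_derivative_def
    by (rule has_derivative_eq_rhs) (auto simp: inner_commute mult.commute)
qed

lemma smooth_upper_bound:
  fixes f :: "'a::euclidean_space \<Rightarrow> real"
  assumes der: "\<And>z. GDERIV f z :> g z"
    and lip: "\<And>y z. dist (g y) (g z) \<le> L * dist y z"
  shows "f y \<le> f x + g x \<bullet> (y - x) + L / 2 * (norm (y - x))\<^sup>2"
proof -
  define d where "d = y - x"
  \<comment> \<open>Claimed upper bound subtracted along the segment; the Lipschitz condition makes this nonincreasing.\<close>
  define \<phi> where "\<phi> t = f (x + t *\<^sub>R d) - t * (g x \<bullet> d) - L / 2 * t\<^sup>2 * (norm d)\<^sup>2" for t
  have "\<phi> 1 \<le> \<phi> 0"
  proof (rule DERIV_nonpos_imp_nonincreasing[where f=\<phi> and a=0 and b=1])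
    fix t :: real assume t: "0 \<le> t" "t \<le> 1"
    have "(\<phi> has_real_derivative (g (x + t *\<^sub>R d) \<bullet> d - g x \<bullet> d - L * t * (norm d)\<^sup>2)) (at t)"
      unfolding \<phi>_def by (auto intro!: derivative_eq_intros DERIV_along_line[OF der])
    moreover have "g (x + t *\<^sub>R d) \<bullet> d - g x \<bullet> d \<le> L * t * (norm d)\<^sup>2"
    proof -
      have "g (x + t *\<^sub>R d) \<bullet> d - g x \<bullet> d = (g (x + t *\<^sub>R d) - g x) \<bullet> d"
        by (simp add: inner_diff_left)
      also have "\<dots> \<le> norm (g (x + t *\<^sub>R d) - g x) * norm d" by (rule norm_cauchy_schwarz)
      also have "\<dots> \<le> (L * (t * norm d)) * norm d"
        using lip[of "x + t *\<^sub>R d" x] t by (intro mult_right_mono) (auto simp: dist_norm)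
      finally show ?thesis by (simp add: power2_eq_square mult_ac)
    qed
    ultimately show "\<exists>y. (\<phi> has_real_derivative y) (at t) \<and> y \<le> 0" by force
  qed simp
  then show ?thesis by (simp add: \<phi>_def d_def)
qed

lemma convex_above_tangent:
  fixes f :: "'a::euclidean_space \<Rightarrow> real"
  assumes der: "\<And>z. GDERIV f z :> g z" and conv: "convex_on UNIV f"
  shows "f y \<ge> f x + g x \<bullet> (y - x)"
proof -
  define \<phi> where "\<phi> t = f (x + t *\<^sub>R (y - x))" for t :: real
  have "convex_on UNIV \<phi>"
  proof (rule convex_onI)
    fix t a b :: real assume "0 < t" "t < 1"
    have "x + ((1 - t) * a + t * b) *\<^sub>R (y - x)
        = (1 - t) *\<^sub>R (x + a *\<^sub>R (y - x)) + t *\<^sub>R (x + b *\<^sub>R (y - x))"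
      by (simp add: algebra_simps)
    then show "\<phi> ((1 - t) *\<^sub>R a + t *\<^sub>R b) \<le> (1 - t) * \<phi> a + t * \<phi> b"
      using convex_onD[OF conv, of t "x + a *\<^sub>R (y - x)" "x + b *\<^sub>R (y - x)"] \<open>0 < t\<close> \<open>t < 1\<close>
      by (simp add: \<phi>_def)
  qed simp
  moreover have "(\<phi> has_real_derivative (g x \<bullet> (y - x))) (at 0)"
    using DERIV_along_line[OF der, where t=0] unfolding \<phi>_def by fastforce
  ultimately have "\<phi> 1 - \<phi> 0 \<ge> (g x \<bullet> (y - x)) * (1 - 0)"
    by (intro convex_on_imp_above_tangent[where A=UNIV]) auto
  then show ?thesis by (simp add: \<phi>_def)
qed

text \<open>Subtracting the tangent at \<open>y\<close> leaves a convex function minimized at \<open>y\<close>; one gradient step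
  of length \<open>1 / L\<close> from \<open>x\<close> decreases it by the squared gradient over \<open>2 * L\<close>, and it cannot fall
  below its minimum.\<close>

lemma smooth_convex_grad_diff_bound:
  fixes f :: "'a::euclidean_space \<Rightarrow> real"
  assumes der: "\<And>z. GDERIV f z :> g z"
    and lip: "\<And>y z. dist (g y) (g z) \<le> L * dist y z"
    and conv: "convex_on UNIV f" and "L > 0"
  shows "(norm (g x - g y))\<^sup>2 \<le> 2 * L * (f x - f y - g y \<bullet> (x - y))"
proof -
  define G where "G = g x - g y"
  define z where "z = x - (1 / L) *\<^sub>R G"
  have "f y + g y \<bullet> (z - y) \<le> f z" by (rule convex_above_tangent[OF der conv])
  also have "\<dots> \<le> f x + g x \<bullet> (z - x) + L / 2 * (norm (z - x))\<^sup>2"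
    by (rule smooth_upper_bound[OF der lip])
  finally have "f y + g y \<bullet> (z - y) \<le> f x + g x \<bullet> (z - x) + L / 2 * (norm (z - x))\<^sup>2" .
  moreover have "g y \<bullet> (z - y) = g y \<bullet> (z - x) + g y \<bullet> (x - y)"
    by (simp add: inner_diff_right)
  moreover have "g x \<bullet> (z - x) - g y \<bullet> (z - x) = - (norm G)\<^sup>2 / L"
    by (simp add: z_def G_def power2_norm_eq_inner inner_diff_left inner_diff_right diff_divide_distrib)
  moreover have "L / 2 * (norm (z - x))\<^sup>2 = (norm G)\<^sup>2 / (2 * L)"
    using \<open>L > 0\<close> by (simp add: z_def power_divide power2_eq_square)
  ultimately have "(norm G)\<^sup>2 / L - (norm G)\<^sup>2 / (2 * L) \<le> f x - f y - g y \<bullet> (x - y)"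
    by linarith
  moreover have "(norm G)\<^sup>2 / L - (norm G)\<^sup>2 / (2 * L) = (norm G)\<^sup>2 / (2 * L)"
    using \<open>L > 0\<close> by (simp add: field_simps)
  ultimately show ?thesis using \<open>L > 0\<close> unfolding G_def by (simp add: field_simps)
qed

section \<open>Averages and squared norms\<close>

lemma avg_mono: "(\<And>i. i \<in> {1..n} \<Longrightarrow> u i \<le> (v i :: real)) \<Longrightarrow> avg n u \<le> avg n v"
  unfolding avg_def by (auto intro!: divide_right_mono sum_mono)

lemma avg_nonneg: "(\<And>i. i \<in> {1..n} \<Longrightarrow> (0::real) \<le> u i) \<Longrightarrow> 0 \<le> avg n u"
  unfolding avg_def by (auto intro!: divide_nonneg_nonneg sum_nonneg)

lemma avg_cong: "(\<And>i. i \<in> {1..n} \<Longrightarrow> u i = v i) \<Longrightarrow> avg n u = avg n v"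
  unfolding avg_def by simp

lemma avg_const: "n \<ge> 1 \<Longrightarrow> avg n (\<lambda>_. c) = c"
  unfolding avg_def by (simp add: sum_constant_scaleR)

lemma avg_add: "avg n (\<lambda>i. u i + v i) = avg n u + avg n v"
  unfolding avg_def by (simp add: sum.distrib scaleR_add_right)

lemma avg_diff: "avg n (\<lambda>i. u i - v i) = avg n u - avg n v"
  unfolding avg_def by (simp add: sum_subtractf scaleR_diff_right)

lemma avg_mult: "avg n (\<lambda>i. c * u i) = c * (avg n u :: real)"
  unfolding avg_def by (simp add: sum_distrib_left)

lemma avg_inner_right: "a \<bullet> avg n u = avg n (\<lambda>i. a \<bullet> u i)"
  unfolding avg_def by (simp add: inner_sum_right)

lemma avg_inner_left: "avg n u \<bullet> a = avg n (\<lambda>i. u i \<bullet> a)"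
  unfolding avg_def by (simp add: inner_sum_left)

lemma norm_sum_squared_le:
  fixes u :: "'i \<Rightarrow> 'a::real_inner"
  shows "(norm (\<Sum>i\<in>A. u i))\<^sup>2 \<le> real (card A) * (\<Sum>i\<in>A. (norm (u i))\<^sup>2)"
proof -
  have "(norm (\<Sum>i\<in>A. u i))\<^sup>2 \<le> (\<Sum>i\<in>A. norm (u i))\<^sup>2"
    by (intro power_mono norm_sum) auto
  also have "\<dots> \<le> real (card A) * (\<Sum>i\<in>A. (norm (u i))\<^sup>2)"
    using sum_squared_le_sum_of_squares[of "\<lambda>i. norm (u i)" A] by (simp add: mult.commute)
  finally show ?thesis .
qed

lemma sum_singleton_times: "(\<Sum>q\<in>{k} \<times> B. h q) = (\<Sum>i\<in>B. h (k, i))"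
proof -
  have "{k} \<times> B = Pair k ` B" by auto
  then show ?thesis by (simp add: sum.reindex inj_on_def)
qed

lemma norm_diff_scaleR_squared:
  fixes a b :: "'a::real_inner"
  shows "(norm (a - t *\<^sub>R b))\<^sup>2 = (norm a)\<^sup>2 - 2 * t * (a \<bullet> b) + t\<^sup>2 * (norm b)\<^sup>2"
  unfolding power2_norm_eq_inner
  by (simp add: inner_diff_left inner_diff_right inner_commute power2_eq_square algebra_simps)

lemma mean_square_deviation:
  fixes v :: "nat \<Rightarrow> 'a::real_inner"
  assumes "m \<ge> 1"
  shows "avg m (\<lambda>l. (norm (v l - avg m v))\<^sup>2) = avg m (\<lambda>l. (norm (v l))\<^sup>2) - (norm (avg m v))\<^sup>2"
proof -
  define u where "u = avg m v"
  have "(norm (v l - u))\<^sup>2 = (norm (v l))\<^sup>2 - 2 * (v l \<bullet> u) + (norm u)\<^sup>2" for l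
    by (simp add: power2_norm_eq_inner inner_diff_left inner_diff_right inner_commute)
  then have "avg m (\<lambda>l. (norm (v l - u))\<^sup>2)
      = avg m (\<lambda>l. (norm (v l))\<^sup>2) - 2 * (u \<bullet> u) + (norm u)\<^sup>2"
    using assms by (simp add: avg_add avg_diff avg_mult avg_const avg_inner_left[symmetric] u_def)
  then show ?thesis unfolding u_def by (simp add: power2_norm_eq_inner)
qed

lemma norm_avg_squared_le:
  fixes v :: "nat \<Rightarrow> 'a::real_inner"
  assumes "m \<ge> 1"
  shows "(norm (avg m v))\<^sup>2 \<le> avg m (\<lambda>l. (norm (v l))\<^sup>2)"
proof -
  have "0 \<le> avg m (\<lambda>l. (norm (v l - avg m v))\<^sup>2)" by (rule avg_nonneg) simp
  then show ?thesis using mean_square_deviation[OF assms, of v] by linarith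
qed

lemma young_norm_square:
  fixes a b :: "'a::real_inner"
  assumes "\<alpha> > 0"
  shows "(norm (a + b))\<^sup>2 \<le> (1 + \<alpha>) * (norm a)\<^sup>2 + (1 + 1 / \<alpha>) * (norm b)\<^sup>2"
proof -
  define s where "s = sqrt \<alpha>"
  have s: "s > 0" "s\<^sup>2 = \<alpha>" using assms by (auto simp: s_def)
  have "0 \<le> (norm (s *\<^sub>R a - (1 / s) *\<^sub>R b))\<^sup>2" by simp
  also have "\<dots> = s\<^sup>2 * (norm a)\<^sup>2 + (norm b)\<^sup>2 / s\<^sup>2 - 2 * (a \<bullet> b)"
    using s(1) by (simp add: power2_norm_eq_inner inner_diff_left inner_diff_right inner_commute)
      (simp add: power2_eq_square)
  finally have "2 * (a \<bullet> b) \<le> \<alpha> * (norm a)\<^sup>2 + (norm b)\<^sup>2 / \<alpha>" by (simp add: s)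
  then show ?thesis
    by (simp add: power2_norm_eq_inner inner_add_left inner_add_right inner_commute algebra_simps)
qed

lemma norm_diff_squared_le:
  fixes a b :: "'a::real_inner"
  shows "(norm (a - b))\<^sup>2 \<le> 2 * (norm a)\<^sup>2 + 2 * (norm b)\<^sup>2"
  using young_norm_square[of 1 a "- b"] by simp

section \<open>Expectations over a single draw\<close>

text \<open>The law that \<open>fresh_randomness\<close> prescribes for a draw.\<close>

definition draw_law :: "nat \<Rightarrow> 's measure \<Rightarrow> real \<Rightarrow> (nat \<times> 's \<times> bool) measure" where
  "draw_law m S p =
     measure_pmf (pmf_of_set {1..m}) \<Otimes>\<^sub>M (S \<Otimes>\<^sub>M measure_pmf (bernoulli_pmf p))"

lemma sets_draw_law [measurable_cong]: "sets (draw_law m S p) = sets (draw_space S)"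
  unfolding draw_law_def draw_space_def by (intro sets_pair_measure_cong) auto

lemma prob_space_draw_law: "prob_space S \<Longrightarrow> prob_space (draw_law m S p)"
  unfolding draw_law_def
  by (intro prob_space_pair measure_pmf.prob_space_axioms)

text \<open>Indices outside \<open>{1..m}\<close> form a null set, so integrability is demanded for the admissible indices only.\<close>

lemma
  fixes h :: "nat \<times> 's \<times> bool \<Rightarrow> real"
  assumes S: "prob_space S" and m: "m \<ge> 1" and p: "0 \<le> p" "p \<le> 1"
    and h: "h \<in> borel_measurable (draw_space S)"
    and int: "\<And>l b. l \<in> {1..m} \<Longrightarrow> integrable S (\<lambda>s. h (l, s, b))"
  shows integrable_draw_law: "integrable (draw_law m S p) h"
    and integral_draw_law: "(\<integral>y. h y \<partial>draw_law m S p) =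
      avg m (\<lambda>l. p * (\<integral>s. h (l, s, True) \<partial>S) + (1 - p) * (\<integral>s. h (l, s, False) \<partial>S))"
proof -
  let ?A = "measure_pmf (pmf_of_set {1..m})" and ?B = "measure_pmf (bernoulli_pmf p)"
  interpret S: prob_space S by fact
  interpret SB: pair_prob_space S ?B ..
  interpret A: pair_prob_space ?A "S \<Otimes>\<^sub>M ?B" ..
  have set_A: "set_pmf (pmf_of_set {1..m}) = {1..m}" using m by (intro set_pmf_of_set) auto
  have hA [measurable]: "h \<in> borel_measurable (?A \<Otimes>\<^sub>M (S \<Otimes>\<^sub>M ?B))"
    using h sets_draw_law[of m S p] measurable_cong_sets unfolding draw_law_def by blast
  have hl [measurable]: "(\<lambda>sb. h (l, sb)) \<in> borel_measurable (S \<Otimes>\<^sub>M ?B)" for l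
    by (rule measurable_Pair2[OF hA]) auto
  have B: "integrable ?B f" for f :: "bool \<Rightarrow> real"
    by (rule integrable_measure_pmf_finite) (rule finite_subset[OF subset_UNIV], simp)
  have Beq: "(\<integral>b. f b \<partial>?B) = p * f True + (1 - p) * f False" for f :: "bool \<Rightarrow> real"
    using p by simp
  have int_l: "integrable (S \<Otimes>\<^sub>M ?B) (\<lambda>sb. h (l, sb))" if l: "l \<in> {1..m}" for l
  proof (rule SB.Fubini_integrable[OF hl])
    show "integrable S (\<lambda>s. \<integral>b. norm (h (l, s, b)) \<partial>?B)"
      unfolding Beq using int[OF l] by (intro Bochner_Integration.integrable_add
        integrable_mult_right integrable_norm)
    show "AE s in S. integrable ?B (\<lambda>b. h (l, s, b))" using B by simp
  qed
  have val_l: "(\<integral>sb. h (l, sb) \<partial>(S \<Otimes>\<^sub>M ?B)) =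
      p * (\<integral>s. h (l, s, True) \<partial>S) + (1 - p) * (\<integral>s. h (l, s, False) \<partial>S)" if l: "l \<in> {1..m}" for l
    using SB.integral_fst'[OF int_l[OF l], symmetric] int[OF l] unfolding Beq by simp
  have int_A: "integrable (?A \<Otimes>\<^sub>M (S \<Otimes>\<^sub>M ?B)) h"
  proof (rule A.Fubini_integrable[OF hA])
    show "integrable ?A (\<lambda>l. \<integral>sb. norm (h (l, sb)) \<partial>(S \<Otimes>\<^sub>M ?B))"
      by (rule integrable_measure_pmf_finite) (simp only: set_A finite_atLeastAtMost)
    show "AE l in ?A. integrable (S \<Otimes>\<^sub>M ?B) (\<lambda>sb. h (l, sb))"
      using int_l by (simp only: AE_measure_pmf_iff set_A) blast
  qed
  then show "integrable (draw_law m S p) h" unfolding draw_law_def .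
  have "(\<integral>y. h y \<partial>draw_law m S p) = (\<integral>l. \<integral>sb. h (l, sb) \<partial>(S \<Otimes>\<^sub>M ?B) \<partial>?A)"
    unfolding draw_law_def by (rule A.integral_fst'[OF int_A, symmetric])
  also have "\<dots> = (\<Sum>l\<in>{1..m}. \<integral>sb. h (l, sb) \<partial>(S \<Otimes>\<^sub>M ?B)) / real (card {1..m})"
    using m by (intro integral_pmf_of_set) auto
  also have "\<dots> = avg m (\<lambda>l. p * (\<integral>s. h (l, s, True) \<partial>S) + (1 - p) * (\<integral>s. h (l, s, False) \<partial>S))"
    using val_l by (simp add: avg_def)
  finally show "(\<integral>y. h y \<partial>draw_law m S p) = \<dots>" .
qed

section \<open>Freezing the past\<close>

definition generated :: "'b measure \<Rightarrow> 'y measure \<Rightarrow> ('q \<Rightarrow> 'b \<Rightarrow> 'y) \<Rightarrow> 'q set \<Rightarrow> 'b measure" where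
  "generated M N Y J = sigma (space M) (\<Union>q\<in>J. sets (vimage_algebra (space M) (Y q) N))"

lemma generated_gens: "(\<Union>q\<in>J. sets (vimage_algebra (space M) (Y q) N)) \<subseteq> Pow (space M)"
  using sets.space_closed[of "vimage_algebra (space M) _ N"] by (fastforce simp: space_vimage_algebra)

lemma space_generated [simp]: "space (generated M N Y J) = space M"
  unfolding generated_def using generated_gens by (rule space_measure_of)

lemma sets_generated:
  "sets (generated M N Y J) =
     sigma_sets (space M) (\<Union>q\<in>J. sets (vimage_algebra (space M) (Y q) N))"
  unfolding generated_def using generated_gens by (rule sets_measure_of)

lemma generated_mono: "J \<subseteq> J' \<Longrightarrow> sets (generated M N Y J) \<subseteq> sets (generated M N Y J')"
  unfolding sets_generated by (intro sigma_sets_mono') auto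

lemma measurable_generated_mono:
  "f \<in> measurable (generated M N Y J) K \<Longrightarrow> J \<subseteq> J' \<Longrightarrow> f \<in> measurable (generated M N Y J') K"
  using generated_mono[of J J' M N Y] by (auto simp: measurable_def)

lemma measurable_generated:
  assumes "q \<in> J" "Y q \<in> space M \<rightarrow> space N"
  shows "Y q \<in> measurable (generated M N Y J) N"
proof (rule measurableI)
  fix A assume "A \<in> sets N"
  then have "Y q -` A \<inter> space M \<in> sets (vimage_algebra (space M) (Y q) N)"
    by (rule in_vimage_algebra)
  then show "Y q -` A \<inter> space (generated M N Y J) \<in> sets (generated M N Y J)"
    unfolding sets_generated using assms(1) by (auto intro!: sigma_sets.Basic)
qed (use assms in auto)

lemma subalgebra_generated:
  assumes "\<And>q. q \<in> J \<Longrightarrow> Y q \<in> measurable M N"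
  shows "subalgebra M (generated M N Y J)"
proof -
  have "(\<Union>q\<in>J. sets (vimage_algebra (space M) (Y q) N)) \<subseteq> sets M"
  proof (rule UN_least)
    fix q assume q: "q \<in> J"
    show "sets (vimage_algebra (space M) (Y q) N) \<subseteq> sets M"
      using measurable_space[OF assms[OF q]] measurable_sets[OF assms[OF q]]
      by (subst sets_vimage_algebra2) auto
  qed
  then show ?thesis
    unfolding subalgebra_def sets_generated by (simp add: sets.sigma_sets_subset)
qed

context prob_space
begin

text \<open>Grouping an independent family into two disjoint blocks. The result is stated with \<open>indep_set\<close> instead of
  \<open>indep_var\<close> because the latter requires both random variables to have values in the same type.\<close>

lemma indep_generated:
  assumes ind: "indep_vars (\<lambda>_. N) Y I" and J: "J \<subseteq> I" and q: "q \<in> I" "q \<notin> J"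
  shows "indep_set (sets (generated M N Y J)) {Y q -` A \<inter> space M | A. A \<in> sets N}"
proof -
  let ?E = "\<lambda>q. sets (vimage_algebra (space M) (Y q) N)"
  let ?I = "\<lambda>b. if b then J else {q}"
  have rv: "Y q \<in> measurable M N" if "q \<in> I" for q using ind that by (auto simp: indep_vars_def)
  have E: "?E q = {Y q -` A \<inter> space M | A. A \<in> sets N}" if "q \<in> I" for q
    using measurable_space[OF rv[OF that]] by (intro sets_vimage_algebra2) auto
  have "indep_sets (\<lambda>q. {Y q -` A \<inter> space M | A. A \<in> sets N}) I"
    using ind unfolding indep_vars_def2 by blast
  then have "indep_sets ?E I"
    by (subst indep_sets_cong[OF refl E]) auto
  then have "indep_sets ?E (\<Union>b. ?I b)" by (rule indep_sets_mono_index[rotated]) (use J q in \<open>auto split: if_splits\<close>)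
  then have 1: "indep_sets (\<lambda>b. sigma_sets (space M) (\<Union>q\<in>?I b. ?E q)) UNIV"
  proof (rule indep_sets_collect_sigma)
    show "disjoint_family ?I" using q by (auto simp: disjoint_family_on_def)
  qed (auto simp: Int_stable_def)
  have "indep_set (sigma_sets (space M) (\<Union>q\<in>J. ?E q)) (sigma_sets (space M) (?E q))"
    unfolding indep_set_def
    by (rule indep_sets_cong[THEN iffD1, OF refl _ 1]) (simp split: bool.split)
  moreover have "sigma_sets (space M) (?E q) = {Y q -` A \<inter> space M | A. A \<in> sets N}"
    using sets.sigma_sets_eq[of "vimage_algebra (space M) (Y q) N"] E[OF q(1)] by simp
  ultimately show ?thesis by (simp add: sets_generated)
qed

lemma distr_generated_draw:
  assumes ind: "indep_vars (\<lambda>_. N) Y I" and J: "J \<subseteq> I" and q: "q \<in> I" "q \<notin> J"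
  shows "distr M (generated M N Y J) (\<lambda>\<xi>. \<xi>) \<Otimes>\<^sub>M distr M N (Y q)
       = distr M (generated M N Y J \<Otimes>\<^sub>M N) (\<lambda>\<xi>. (\<xi>, Y q \<xi>))" (is "?S \<Otimes>\<^sub>M ?T = ?P")
proof -
  let ?F = "generated M N Y J"
  have rv: "Y q \<in> measurable M N" if "q \<in> I" for q using ind that by (auto simp: indep_vars_def)
  have sub: "subalgebra M ?F" using rv J by (intro subalgebra_generated) auto
  have X: "(\<lambda>\<xi>. \<xi>) \<in> measurable M ?F"
    using measurable_from_subalg[OF sub measurable_ident] unfolding id_def .
  have pair: "(\<lambda>\<xi>. (\<xi>, Y q \<xi>)) \<in> measurable M (?F \<Otimes>\<^sub>M N)"
    using X rv[OF q(1)] by (rule measurable_Pair)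
  interpret S: prob_space ?S by (rule prob_space_distr[OF X])
  interpret T: prob_space ?T by (rule prob_space_distr[OF rv[OF q(1)]])
  show ?thesis
  proof (rule pair_measure_eqI)
    fix A B assume A: "A \<in> sets ?S" and B: "B \<in> sets ?T"
    then have A': "A \<in> sets ?F" "A \<inter> space M = A" and B': "B \<in> sets N"
      using sets.sets_into_space[of A ?F] by auto
    have "prob (A \<inter> (Y q -` B \<inter> space M)) = prob A * prob (Y q -` B \<inter> space M)"
      using indep_setD[OF indep_generated[OF assms]] A' B' by blast
    then have "emeasure M (A \<inter> (Y q -` B \<inter> space M)) = emeasure M A * emeasure M (Y q -` B \<inter> space M)"
      by (simp add: emeasure_eq_measure ennreal_mult)
    moreover have "(\<lambda>\<xi>. (\<xi>, Y q \<xi>)) -` (A \<times> B) \<inter> space M = A \<inter> (Y q -` B \<inter> space M)" by auto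
    ultimately show "emeasure ?S A * emeasure ?T B = emeasure ?P (A \<times> B)"
      using A' B' by (simp add: emeasure_distr[OF X] emeasure_distr[OF pair] emeasure_distr[OF rv[OF q(1)]])
  qed (auto intro: S.sigma_finite_measure_axioms T.sigma_finite_measure_axioms
        cong: sets_pair_measure_cong)
qed

text \<open>Freezing: the identity, seen as a random variable into the space with the \<sigma>-algebra of the other
  draws, and the draw \<open>Y q\<close> have a product law, so Fubini applies. Working with the identity allows \<open>h\<close> to depend
  on any quantity measurable in the other draws, without a state space that collects these quantities.\<close>

lemma
  fixes h :: "'a \<times> 'y \<Rightarrow> real"
  assumes ind: "indep_vars (\<lambda>_. N) Y I" and J: "J \<subseteq> I" and q: "q \<in> I" "q \<notin> J"
    and D: "distr M N (Y q) = D"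
    and h: "h \<in> borel_measurable (generated M N Y J \<Otimes>\<^sub>M N)"
    and int: "\<And>\<xi>. \<xi> \<in> space M \<Longrightarrow> integrable D (\<lambda>y. h (\<xi>, y))"
    and B: "integrable M B" "\<And>\<xi>. \<xi> \<in> space M \<Longrightarrow> (\<integral>y. \<bar>h (\<xi>, y)\<bar> \<partial>D) \<le> B \<xi>"
  shows freeze_integrable: "integrable M (\<lambda>\<xi>. h (\<xi>, Y q \<xi>))"
    and freeze_integral: "(\<integral>\<xi>. h (\<xi>, Y q \<xi>) \<partial>M) = (\<integral>\<xi>. \<integral>y. h (\<xi>, y) \<partial>D \<partial>M)"
proof -
  let ?F = "generated M N Y J"
  let ?X = "\<lambda>\<xi>::'a. \<xi>"
  have rv: "Y q \<in> measurable M N" if "q \<in> I" for q using ind that by (auto simp: indep_vars_def)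
  have sub: "subalgebra M ?F" using rv J by (intro subalgebra_generated) auto
  have X: "?X \<in> measurable M ?F" using measurable_from_subalg[OF sub measurable_ident] unfolding id_def .
  have joint: "distr M ?F ?X \<Otimes>\<^sub>M D = distr M (?F \<Otimes>\<^sub>M N) (\<lambda>\<xi>. (\<xi>, Y q \<xi>))"
    using distr_generated_draw[OF ind J q] unfolding D .
  have pair: "(\<lambda>\<xi>. (\<xi>, Y q \<xi>)) \<in> measurable M (?F \<Otimes>\<^sub>M N)"
    using X rv[OF q(1)] by (rule measurable_Pair)
  interpret F: prob_space "distr M ?F ?X" by (rule prob_space_distr[OF X])
  interpret D: prob_space D unfolding D[symmetric] by (rule prob_space_distr[OF rv[OF q(1)]])
  interpret P: pair_prob_space "distr M ?F ?X" D ..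
  have setsD: "sets D = sets N" unfolding D[symmetric] by simp
  have h': "h \<in> borel_measurable (distr M ?F ?X \<Otimes>\<^sub>M D)"
    using h by (subst measurable_cong_sets[OF sets_pair_measure_cong[OF _ setsD] refl]) auto
  have "(\<lambda>\<xi>. \<integral>y. \<bar>h (\<xi>, y)\<bar> \<partial>D) \<in> borel_measurable (distr M ?F ?X)"
    by (rule D.borel_measurable_lebesgue_integral) (use h' in simp)
  then have meas: "(\<lambda>\<xi>. \<integral>y. \<bar>h (\<xi>, y)\<bar> \<partial>D) \<in> borel_measurable ?F" by simp
  have norm_int: "integrable M (\<lambda>\<xi>. \<integral>y. \<bar>h (\<xi>, y)\<bar> \<partial>D)"
    using B measurable_from_subalg[OF sub meas]
    by (intro Bochner_Integration.integrable_bound[OF B(1)])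
       (auto intro!: AE_I2 order_trans[OF _ abs_ge_self])
  have intP: "integrable (distr M ?F ?X \<Otimes>\<^sub>M D) h"
  proof (rule P.Fubini_integrable[OF h'])
    show "integrable (distr M ?F ?X) (\<lambda>\<xi>. \<integral>y. norm (h (\<xi>, y)) \<partial>D)"
      using norm_int meas by (subst integrable_distr_eq[OF X]) auto
    show "AE \<xi> in distr M ?F ?X. integrable D (\<lambda>y. h (\<xi>, y))"
      using int by (intro AE_I2) simp
  qed
  show "integrable M (\<lambda>\<xi>. h (\<xi>, Y q \<xi>))"
    using intP unfolding joint integrable_distr_eq[OF pair h] .
  have "(\<lambda>\<xi>. \<integral>y. h (\<xi>, y) \<partial>D) \<in> borel_measurable (distr M ?F ?X)"
    by (rule D.borel_measurable_lebesgue_integral) (use h' in simp)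
  then have meas2: "(\<lambda>\<xi>. \<integral>y. h (\<xi>, y) \<partial>D) \<in> borel_measurable ?F" by simp
  have "(\<integral>\<xi>. h (\<xi>, Y q \<xi>) \<partial>M) = integral\<^sup>L (distr M ?F ?X \<Otimes>\<^sub>M D) h"
    unfolding joint by (rule integral_distr[OF pair h, symmetric])
  also have "\<dots> = (\<integral>\<xi>. \<integral>y. h (\<xi>, y) \<partial>D \<partial>distr M ?F ?X)"
    by (rule P.integral_fst'[OF intP, symmetric])
  also have "\<dots> = (\<integral>\<xi>. \<integral>y. h (\<xi>, y) \<partial>D \<partial>M)"
    by (rule integral_distr[OF X meas2])
  finally show "(\<integral>\<xi>. h (\<xi>, Y q \<xi>) \<partial>M) = (\<integral>\<xi>. \<integral>y. h (\<xi>, y) \<partial>D \<partial>M)" .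
qed

end

section \<open>Square-integrable random vectors\<close>

definition square_integrable :: "'b measure \<Rightarrow> ('b \<Rightarrow> 'a::euclidean_space) \<Rightarrow> bool" where
  "square_integrable M X \<longleftrightarrow> X \<in> borel_measurable M \<and> integrable M (\<lambda>\<xi>. (norm (X \<xi>))\<^sup>2)"

lemma square_integrable_bound:
  assumes "square_integrable M X" "Y \<in> borel_measurable M" "\<And>\<xi>. \<xi> \<in> space M \<Longrightarrow> norm (Y \<xi>) \<le> norm (X \<xi>)"
  shows "square_integrable M Y"
  using assms unfolding square_integrable_def
  by (auto intro!: Bochner_Integration.integrable_bound[of M "\<lambda>\<xi>. (norm (X \<xi>))\<^sup>2"] power_mono)

lemma square_integrable_add:
  assumes "square_integrable M X" "square_integrable M Y"
  shows "square_integrable M (\<lambda>\<xi>. X \<xi> + Y \<xi>)"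
proof -
  have "integrable M (\<lambda>\<xi>. 2 * (norm (X \<xi>))\<^sup>2 + 2 * (norm (Y \<xi>))\<^sup>2)"
    using assms unfolding square_integrable_def by auto
  then have "integrable M (\<lambda>\<xi>. (norm (X \<xi> + Y \<xi>))\<^sup>2)"
    using assms young_norm_square[of 1 "X _" "Y _"] unfolding square_integrable_def
    by (elim Bochner_Integration.integrable_bound) auto
  then show ?thesis using assms unfolding square_integrable_def by auto
qed

lemma square_integrable_scaleR:
  "square_integrable M X \<Longrightarrow> square_integrable M (\<lambda>\<xi>. c *\<^sub>R X \<xi>)"
  unfolding square_integrable_def by (auto simp: power_mult_distrib)

lemma square_integrable_diff:
  "square_integrable M X \<Longrightarrow> square_integrable M Y \<Longrightarrow> square_integrable M (\<lambda>\<xi>. X \<xi> - Y \<xi>)"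
  using square_integrable_add[OF _ square_integrable_scaleR, of M X Y "-1"] by simp

lemma (in finite_measure) square_integrable_const: "square_integrable M (\<lambda>_. c)"
  unfolding square_integrable_def by simp

lemma (in finite_measure) square_integrable_sum:
  "(\<And>i. i \<in> A \<Longrightarrow> square_integrable M (X i)) \<Longrightarrow> square_integrable M (\<lambda>\<xi>. \<Sum>i\<in>A. X i \<xi>)"
  by (induction A rule: infinite_finite_induct)
     (auto intro: square_integrable_add square_integrable_const)

lemma (in finite_measure) square_integrable_avg:
  "(\<And>i. i \<in> {1..n} \<Longrightarrow> square_integrable M (X i)) \<Longrightarrow> square_integrable M (\<lambda>\<xi>. avg n (\<lambda>i. X i \<xi>))"
  unfolding avg_def by (intro square_integrable_scaleR square_integrable_sum)

lemma abs_inner_le: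
  fixes a b :: "'a::real_inner"
  shows "\<bar>a \<bullet> b\<bar> \<le> (norm a)\<^sup>2 + (norm b)\<^sup>2"
proof -
  have "\<bar>a \<bullet> b\<bar> \<le> norm a * norm b" by (rule Cauchy_Schwarz_ineq2)
  also have "\<dots> \<le> (norm a)\<^sup>2 + (norm b)\<^sup>2" 
    using sum_squares_bound[of "norm a" "norm b"] mult_nonneg_nonneg[of "norm a" "norm b"]
    unfolding mult.assoc using norm_ge_zero[of a] norm_ge_zero[of b] by linarith
  finally show ?thesis .
qed

lemma square_integrable_inner:
  assumes "square_integrable M X" "square_integrable M Y"
  shows "integrable M (\<lambda>\<xi>. X \<xi> \<bullet> Y \<xi>)"
proof -
  have "integrable M (\<lambda>\<xi>. (norm (X \<xi>))\<^sup>2 + (norm (Y \<xi>))\<^sup>2)"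
    using assms unfolding square_integrable_def by auto
  moreover have "\<bar>X \<xi> \<bullet> Y \<xi>\<bar> \<le> (norm (X \<xi>))\<^sup>2 + (norm (Y \<xi>))\<^sup>2" for \<xi>
    by (rule abs_inner_le)
  ultimately show ?thesis
    using assms unfolding square_integrable_def
    by (elim Bochner_Integration.integrable_bound) auto
qed

lemma (in finite_measure) square_integrable_imp_integrable:
  assumes "square_integrable M X"
  shows "integrable M X"
proof -
  have "integrable M (\<lambda>\<xi>. 1 + (norm (X \<xi>))\<^sup>2)"
    using assms unfolding square_integrable_def by auto
  moreover have "a \<le> 1 + a\<^sup>2" for a :: real
    using sum_squares_bound[of 1 a] zero_le_power2[of a] unfolding power_one by linarith
  ultimately show ?thesis
    using assms unfolding square_integrable_def
    by (elim Bochner_Integration.integrable_bound) auto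
qed

lemma norm_square_measurable:
  fixes h :: "'c \<Rightarrow> 'd::real_normed_vector"
  assumes [measurable]: "h \<in> borel_measurable K"
  shows "(\<lambda>\<xi>. (norm (h \<xi>))\<^sup>2) \<in> borel_measurable K"
  by measurable

lemma square_integrable_select:
  assumes "square_integrable M X" "square_integrable M Y" "Z \<in> borel_measurable M"
    and "\<And>\<xi>. \<xi> \<in> space M \<Longrightarrow> Z \<xi> = X \<xi> \<or> Z \<xi> = Y \<xi>"
  shows "square_integrable M Z"
proof -
  have "integrable M (\<lambda>\<xi>. (norm (X \<xi>))\<^sup>2 + (norm (Y \<xi>))\<^sup>2)"
    using assms unfolding square_integrable_def by auto
  moreover have "norm ((norm (Z \<xi>))\<^sup>2) \<le> norm ((norm (X \<xi>))\<^sup>2 + (norm (Y \<xi>))\<^sup>2)" if "\<xi> \<in> space M" for \<xi>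
    using assms(4)[OF that] by auto
  ultimately show ?thesis
    using assms(3) unfolding square_integrable_def
    by (auto intro!: Bochner_Integration.integrable_bound[of M "\<lambda>\<xi>. (norm (X \<xi>))\<^sup>2 + (norm (Y \<xi>))\<^sup>2"])
qed

lemma square_integrableD:
  "square_integrable M X \<Longrightarrow> integrable M (\<lambda>\<xi>. (norm (X \<xi>))\<^sup>2)"
  unfolding square_integrable_def by simp

lemma square_integrable_cong:
  assumes "square_integrable M X" "\<And>\<xi>. \<xi> \<in> space M \<Longrightarrow> Y \<xi> = X \<xi>"
  shows "square_integrable M Y"
  using assms unfolding square_integrable_def
  by (simp cong: measurable_cong Bochner_Integration.integrable_cong)

lemma (in finite_measure) square_integrable_indicator:
  assumes X: "square_integrable M X" and [measurable]: "A \<in> sets M"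
  shows "square_integrable M (\<lambda>\<xi>. indicat_real A \<xi> *\<^sub>R X \<xi>)"
proof (rule square_integrable_bound[OF X])
  have [measurable]: "X \<in> borel_measurable M" using X by (simp add: square_integrable_def)
  show "(\<lambda>\<xi>. indicat_real A \<xi> *\<^sub>R X \<xi>) \<in> borel_measurable M" by measurable
qed (simp add: indicator_def)

lemma (in finite_measure) square_integrable_lipschitz:
  assumes X: "square_integrable M X" and g: "\<And>y z. dist (g y) (g z) \<le> L * dist y z"
    and [measurable]: "g \<in> borel_measurable borel"
  shows "square_integrable M (\<lambda>\<xi>. g (X \<xi>))"
proof (rule square_integrable_cong)
  have [measurable]: "X \<in> borel_measurable M" using X by (simp add: square_integrable_def)
  have "square_integrable M (\<lambda>\<xi>. g (X \<xi>) - g 0)"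
  proof (rule square_integrable_bound[OF square_integrable_scaleR[OF X, of L]])
    show "norm (g (X \<xi>) - g 0) \<le> norm (L *\<^sub>R X \<xi>)" for \<xi>
      using order_trans[OF g[of "X \<xi>" 0] mult_right_mono[OF abs_ge_self]] by (simp add: dist_norm)
  qed measurable
  then show "square_integrable M (\<lambda>\<xi>. (g (X \<xi>) - g 0) + g 0)"
    by (rule square_integrable_add[OF _ square_integrable_const])
qed simp

section \<open>Geometrically weighted recursions\<close>

lemma weight_pos: "\<eta> < 1 \<Longrightarrow> weight \<eta> k > 0"
  unfolding weight_def by simp

lemma weight_Suc: "\<eta> < 1 \<Longrightarrow> (1 - \<eta>) * weight \<eta> (Suc k) = weight \<eta> k"
  unfolding weight_def by (simp add: mult.assoc[symmetric])

lemma weighted_telescope: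
  assumes "\<eta> < 1" and rec: "\<And>k. u (Suc k) \<le> (1 - \<eta>) * u k + d k"
  shows "weight \<eta> K * u (Suc K) \<le> u 0 + (\<Sum>k\<le>K. weight \<eta> k * d k)"
proof (induction K)
  case 0
  have "weight \<eta> 0 * u (Suc 0) \<le> weight \<eta> 0 * ((1 - \<eta>) * u 0 + d 0)"
    using rec[of 0] weight_pos[OF assms(1), of 0] by (intro mult_left_mono) auto
  then show ?case using assms(1) by (simp add: weight_def field_simps)
next
  case (Suc K)
  have "weight \<eta> (Suc K) * u (Suc (Suc K)) \<le> weight \<eta> (Suc K) * ((1 - \<eta>) * u (Suc K) + d (Suc K))"
    using rec[of "Suc K"] weight_pos[OF assms(1), of "Suc K"] by (intro mult_left_mono) auto
  also have "\<dots> = ((1 - \<eta>) * weight \<eta> (Suc K)) * u (Suc K) + weight \<eta> (Suc K) * d (Suc K)"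
    by (simp add: algebra_simps)
  also have "\<dots> \<le> u 0 + (\<Sum>k\<le>Suc K. weight \<eta> k * d k)"
    using Suc.IH by (simp add: weight_Suc[OF assms(1)])
  finally show ?case .
qed

text \<open>Writing \<open>1 - p\<close> as \<open>(1 - \<eta>) - (p - \<eta>)\<close> exposes a negative multiple of the sum itself after telescoping, and
  \<open>p - \<eta>\<close> is at least \<open>3 * p / 4\<close>.\<close>

lemma weighted_sum_contraction:
  fixes s r :: "nat \<Rightarrow> real"
  assumes rec: "\<And>k. s (Suc k) \<le> (1 - p) * s k + 2 * L * p * r k"
    and nonneg: "\<And>k. 0 \<le> s k" and p: "0 < p" "p < 1" and \<eta>: "\<eta> \<le> p / 4"
    and "L > 0" "\<And>k. 0 \<le> r k"
  shows "(\<Sum>k\<le>K. weight \<eta> k * s k) \<le> 4 / (3 * p) * s 0 + 8 * L / 3 * (\<Sum>k\<le>K. weight \<eta> k * r k)"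
proof -
  let ?S = "\<Sum>k\<le>K. weight \<eta> k * s k" and ?R = "\<Sum>k\<le>K. weight \<eta> k * r k"
  have \<eta>1: "\<eta> < 1" using p \<eta> by linarith
  have "?S \<ge> 0" using nonneg weight_pos[OF \<eta>1] by (intro sum_nonneg) (simp add: less_imp_le)
  have "weight \<eta> K * s (Suc K) \<le> s 0 + (\<Sum>k\<le>K. weight \<eta> k * (2 * L * p * r k - (p - \<eta>) * s k))"
    by (rule weighted_telescope[where u=s, OF \<eta>1]) (use rec in \<open>simp add: algebra_simps\<close>)
  also have "\<dots> = s 0 + 2 * L * p * ?R - (p - \<eta>) * ?S"
    by (simp add: sum_subtractf sum.distrib sum_distrib_left algebra_simps)
  finally have "(p - \<eta>) * ?S \<le> s 0 + 2 * L * p * ?R"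
    using nonneg[of "Suc K"] weight_pos[OF \<eta>1, of K] mult_nonneg_nonneg[of "weight \<eta> K" "s (Suc K)"]
    by linarith
  moreover have "3 * p / 4 * ?S \<le> (p - \<eta>) * ?S"
    using \<eta> \<open>?S \<ge> 0\<close> by (intro mult_right_mono) auto
  ultimately have "?S \<le> (s 0 + 2 * L * p * ?R) / (3 * p / 4)"
    using p by (simp add: field_simps)
  also have "\<dots> = 4 / (3 * p) * s 0 + 8 * L / 3 * ?R"
    using p by (simp add: field_simps)
  finally show ?thesis .
qed

text \<open>Every \<open>t\<close> lies in at most \<open>\<tau>\<close> windows, and within a window the weights grow by at most
  the inverse of \<open>(1 - \<eta>) ^ \<tau>\<close>, which is at least \<open>15 / 16\<close> by Bernoulli's inequality.\<close>

lemma weighted_sum_window: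
  fixes y :: "nat \<Rightarrow> real"
  assumes \<eta>: "0 \<le> \<eta>" "\<eta> < 1" "real \<tau> * \<eta> \<le> 1 / 16" and y: "\<And>t. 0 \<le> y t"
  shows "(\<Sum>k\<le>K. weight \<eta> k * (\<Sum>t\<in>{k - \<tau>..<k}. y t))
       \<le> 16 / 15 * real \<tau> * (\<Sum>t\<le>K. weight \<eta> t * y t)"
proof -
  have growth: "weight \<eta> k \<le> 16 / 15 * weight \<eta> t" if t: "t \<in> {k - \<tau>..<k}" for t k
  proof -
    define d where "d = k - t"
    have d: "k = t + d" "d \<le> \<tau>" using t by (auto simp: d_def)
    have "15 / 16 \<le> 1 + real d * (- \<eta>)"
      using mult_right_mono[of "real d" "real \<tau>" \<eta>] d \<eta> by simp
    also have "\<dots> \<le> (1 + (- \<eta>)) ^ d"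
      using \<eta> by (intro Bernoulli_inequality) auto
    finally have "15 / 16 \<le> (1 - \<eta>) ^ d" by simp
    then have "inverse ((1 - \<eta>) ^ d) \<le> 16 / 15"
      using le_imp_inverse_le[of "15/16" "(1 - \<eta>) ^ d"] by simp
    moreover have "weight \<eta> k = inverse ((1 - \<eta>) ^ d) * weight \<eta> t"
      by (simp add: weight_def d power_add)
    ultimately show ?thesis
      using weight_pos[OF \<eta>(2), of t] by (metis mult_right_mono less_imp_le)
  qed
  have "(\<Sum>k\<le>K. weight \<eta> k * (\<Sum>t\<in>{k - \<tau>..<k}. y t))
      \<le> (\<Sum>k\<le>K. \<Sum>t\<in>{k - \<tau>..<k}. 16 / 15 * (weight \<eta> t * y t))"
    unfolding sum_distrib_left mult.assoc[symmetric]
    using y by (intro sum_mono mult_right_mono growth) auto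
  also have "\<dots> = (\<Sum>k\<le>K. \<Sum>t | t \<le> K \<and> t \<in> {k - \<tau>..<k}. 16 / 15 * (weight \<eta> t * y t))"
    by (intro sum.cong refl) auto
  also have "\<dots> = (\<Sum>t\<le>K. \<Sum>k | k \<le> K \<and> t \<in> {k - \<tau>..<k}. 16 / 15 * (weight \<eta> t * y t))"
    using sum.swap_restrict[of "{..K}" "{..K}" "\<lambda>k t. 16 / 15 * (weight \<eta> t * y t)"
        "\<lambda>k t. t \<in> {k - \<tau>..<k}"] by simp
  also have "\<dots> \<le> (\<Sum>t\<le>K. real \<tau> * (16 / 15 * (weight \<eta> t * y t)))"
  proof (rule sum_mono)
    fix t
    have "card {k. k \<le> K \<and> t \<in> {k - \<tau>..<k}} \<le> card {t<..t + \<tau>}"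
      by (rule card_mono) auto
    moreover have "0 \<le> 16 / 15 * (weight \<eta> t * y t)"
      using y weight_pos[OF \<eta>(2), of t] by simp
    ultimately show "(\<Sum>k | k \<le> K \<and> t \<in> {k - \<tau>..<k}. 16 / 15 * (weight \<eta> t * y t))
        \<le> real \<tau> * (16 / 15 * (weight \<eta> t * y t))"
      using mult_right_mono[of "real (card {k. k \<le> K \<and> t \<in> {k - \<tau>..<k}})" "real \<tau>"
          "16 / 15 * (weight \<eta> t * y t)"] by simp
  qed
  also have "\<dots> = 16 / 15 * real \<tau> * (\<Sum>t\<le>K. weight \<eta> t * y t)"
    by (simp add: sum_distrib_left mult_ac)
  finally show ?thesis .
qed

text \<open>The sum of \<open>s\<close> is traded for that of \<open>r\<close> by \<open>weighted_sum_contraction\<close>. The resulting coefficient of the sum of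
  \<open>r\<close> is \<open>16 * L\<^sup>2 * \<gamma>\<^sup>2 * \<tau> * (\<tau> + 34 / 9 * c)\<close>, and the step-size bound makes it at most \<open>1 / 4\<close>. The term with
  \<open>D\<close> is constant in time, so it pays the window length \<open>\<tau>\<close> but not the factor \<open>16 / 15\<close>; this is what keeps
  its constant exact.\<close>

lemma weighted_delay_error:
  fixes r s er :: "nat \<Rightarrow> real"
  assumes err: "\<And>k. er k \<le> \<gamma>\<^sup>2 * ((\<Sum>t\<in>{k - \<tau>..<k}.
        5 * L * real \<tau> * r t + 10 * L * c * r t + 10 / 3 * c * s t) + real \<tau> * D)"
    and rec: "\<And>k. s (Suc k) \<le> (1 - p) * s k + 2 * L * p * r k"
    and r: "\<And>k. 0 \<le> r k" and s: "\<And>k. 0 \<le> s k"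
    and p: "0 < p" "p < 1" and \<eta>: "0 \<le> \<eta>" "\<eta> \<le> p / 4" "real \<tau> * \<eta> \<le> 1 / 16"
    and pos: "L > 0" "c \<ge> 1" "\<gamma> > 0" "D \<ge> 0"
    and \<gamma>: "64 * L\<^sup>2 * \<gamma>\<^sup>2 * real \<tau> * (real \<tau> + 6 * c) \<le> 1"
  shows "3 * L * (\<Sum>k\<le>K. weight \<eta> k * er k)
     \<le> 1 / 4 * (\<Sum>k\<le>K. weight \<eta> k * r k) + 12 * \<gamma>\<^sup>2 * L * real \<tau> * c * (2 + p) / p * s 0
        + \<gamma> * (3 * \<gamma> * real \<tau> * L * D) * weight_sum \<eta> K"
proof -
  define y where "y t = 5 * L * real \<tau> * r t + 10 * L * c * r t + 10 / 3 * c * s t" for t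
  let ?R = "\<Sum>k\<le>K. weight \<eta> k * r k" and ?S = "\<Sum>k\<le>K. weight \<eta> k * s k"
  have \<eta>1: "\<eta> < 1" using p \<eta> by linarith
  have y0: "0 \<le> y t" for t using r s pos by (simp add: y_def)
  have R0: "0 \<le> ?R" using r weight_pos[OF \<eta>1] by (intro sum_nonneg) (simp add: less_imp_le)
  have "(\<Sum>k\<le>K. weight \<eta> k * er k)
      \<le> (\<Sum>k\<le>K. weight \<eta> k * (\<gamma>\<^sup>2 * ((\<Sum>t\<in>{k - \<tau>..<k}. y t) + real \<tau> * D)))"
    using err weight_pos[OF \<eta>1] unfolding y_def by (intro sum_mono mult_left_mono) (auto simp: less_imp_le)
  also have "\<dots> = \<gamma>\<^sup>2 * ((\<Sum>k\<le>K. weight \<eta> k * (\<Sum>t\<in>{k - \<tau>..<k}. y t)) + real \<tau> * D * weight_sum \<eta> K)"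
    unfolding weight_sum_def
    by (simp only: sum_distrib_left[of _ "\<lambda>k. weight \<eta> k"] sum_distrib_left[of "\<gamma>\<^sup>2"]
        sum.distrib[symmetric]) (intro sum.cong refl, simp add: algebra_simps)
  also have "\<dots> \<le> \<gamma>\<^sup>2 * (16 / 15 * real \<tau> * (\<Sum>t\<le>K. weight \<eta> t * y t) + real \<tau> * D * weight_sum \<eta> K)"
    by (intro mult_left_mono add_right_mono weighted_sum_window \<eta> \<eta>1 y0) simp
  also have "(\<Sum>t\<le>K. weight \<eta> t * y t) = (5 * L * real \<tau> + 10 * L * c) * ?R + 10 / 3 * c * ?S"
    unfolding sum_distrib_left y_def sum.distrib[symmetric]
    by (intro sum.cong refl) (simp add: algebra_simps)
  also have "\<gamma>\<^sup>2 * (16 / 15 * real \<tau> * ((5 * L * real \<tau> + 10 * L * c) * ?R + 10 / 3 * c * ?S)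
        + real \<tau> * D * weight_sum \<eta> K)
     \<le> \<gamma>\<^sup>2 * (16 / 15 * real \<tau> * ((5 * L * real \<tau> + 10 * L * c) * ?R
        + 10 / 3 * c * (4 / (3 * p) * s 0 + 8 * L / 3 * ?R)) + real \<tau> * D * weight_sum \<eta> K)"
    using pos by (intro mult_left_mono add_right_mono add_left_mono
        weighted_sum_contraction[where s=s and r=r, OF rec s p \<eta>(2) _ r]) auto
  finally have "3 * L * (\<Sum>k\<le>K. weight \<eta> k * er k)
     \<le> 3 * L * (\<gamma>\<^sup>2 * (16 / 15 * real \<tau> * ((5 * L * real \<tau> + 10 * L * c) * ?R
        + 10 / 3 * c * (4 / (3 * p) * s 0 + 8 * L / 3 * ?R)) + real \<tau> * D * weight_sum \<eta> K))"
    using pos by (intro mult_left_mono) auto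
  also have "\<dots> = (16 * L\<^sup>2 * \<gamma>\<^sup>2 * real \<tau> * (real \<tau> + 34 / 9 * c)) * ?R
      + (128 / 9) * (\<gamma>\<^sup>2 * L * real \<tau> * c / p * s 0) + \<gamma> * (3 * \<gamma> * real \<tau> * L * D) * weight_sum \<eta> K"
    by (simp add: field_simps power2_eq_square)
  also have "\<dots> \<le> 1 / 4 * ?R + 12 * (2 + p) * (\<gamma>\<^sup>2 * L * real \<tau> * c / p * s 0)
      + \<gamma> * (3 * \<gamma> * real \<tau> * L * D) * weight_sum \<eta> K"
  proof (rule add_right_mono, intro add_mono mult_right_mono R0)
    have "16 * L\<^sup>2 * \<gamma>\<^sup>2 * real \<tau> * (real \<tau> + 34 / 9 * c)
        \<le> 16 * L\<^sup>2 * \<gamma>\<^sup>2 * real \<tau> * (real \<tau> + 6 * c)"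
      using pos by (intro mult_left_mono) auto
    then show "16 * L\<^sup>2 * \<gamma>\<^sup>2 * real \<tau> * (real \<tau> + 34 / 9 * c) \<le> 1 / 4" using \<gamma> by linarith
    show "128 / 9 \<le> 12 * (2 + p)" using p by simp
    show "0 \<le> \<gamma>\<^sup>2 * L * real \<tau> * c / p * s 0" using pos s p by simp
  qed
  finally show ?thesis by (simp add: algebra_simps)
qed

text \<open>The Lyapunov function is \<open>X + 8 * c / (3 * p) * \<gamma>\<^sup>2 * s\<close>. Its second coefficient is chosen such that the variance term
  \<open>2 * c * s\<close> uses up three quarters of the contraction of \<open>s\<close>, leaving the factor \<open>1 - p / 4\<close>. The terms in \<open>r\<close> then
  add up to \<open>28 / 3 * \<gamma>\<^sup>2 * L * c\<close>, at most half of the descent \<open>\<gamma>\<close>, and half of the remainder is spent on the delay error.\<close>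

lemma weighted_suboptimality:
  fixes r s er X :: "nat \<Rightarrow> real"
  assumes X_rec: "\<And>k. X (Suc k) \<le> (1 - \<gamma> * \<mu> / 2) * X k - \<gamma> * r k + 3 * \<gamma> * L * er k
        + \<gamma>\<^sup>2 * (4 * L * c * r k + 2 * c * s k + D1)"
    and rec: "\<And>k. s (Suc k) \<le> (1 - p) * s k + 2 * L * p * r k"
    and err: "3 * L * (\<Sum>k\<le>K. weight \<eta> k * er k)
        \<le> 1 / 4 * (\<Sum>k\<le>K. weight \<eta> k * r k) + F2 * s 0 + \<gamma> * D3 * weight_sum \<eta> K"
    and X: "\<And>k. 0 \<le> X k" and r: "\<And>k. 0 \<le> r k" and s: "\<And>k. 0 \<le> s k"
    and p: "0 < p" "p < 1" and \<eta>: "\<eta> \<le> \<gamma> * \<mu> / 2" "\<eta> \<le> p / 4"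
    and pos: "L > 0" "c \<ge> 1" "\<gamma> > 0"
    and \<gamma>: "\<gamma> * (56 * L * c) \<le> 3"
  shows "(\<Sum>k\<le>K. weight \<eta> k * r k)
     \<le> 4 * (X 0 + 8 * c / (3 * p) * \<gamma>\<^sup>2 * s 0 + \<gamma> * F2 * s 0) / \<gamma> + 4 * \<gamma> * (D1 + D3) * weight_sum \<eta> K"
proof -
  define B where "B = 8 * c / (3 * p)"
  define T where "T k = X k + B * \<gamma>\<^sup>2 * s k" for k
  let ?R = "\<Sum>k\<le>K. weight \<eta> k * r k" and ?E = "\<Sum>k\<le>K. weight \<eta> k * er k"
  have \<eta>1: "\<eta> < 1" using p \<eta> by linarith
  have B: "B \<ge> 0" "2 * c = B * (3 * p / 4)" using pos p by (auto simp: B_def)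
  have T0: "T k \<ge> 0" for k using X s B by (simp add: T_def)
  have T_rec: "T (Suc k) \<le> (1 - \<eta>) * T k + (3 * \<gamma> * L * er k + \<gamma>\<^sup>2 * D1 - \<gamma> / 2 * r k)" for k
  proof -
    have "B * \<gamma>\<^sup>2 * s (Suc k) \<le> B * \<gamma>\<^sup>2 * ((1 - p) * s k + 2 * L * p * r k)"
      using rec B by (intro mult_left_mono) auto
    also have "\<dots> = B * \<gamma>\<^sup>2 * (1 - p / 4) * s k - \<gamma>\<^sup>2 * 2 * c * s k + \<gamma>\<^sup>2 * L * c * (16 / 3) * r k"
      using p by (simp add: B_def field_simps)
    finally have "T (Suc k) \<le> (1 - \<gamma> * \<mu> / 2) * X k + (1 - p / 4) * (B * \<gamma>\<^sup>2 * s k)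
        + (3 * \<gamma> * L * er k + \<gamma>\<^sup>2 * D1) - \<gamma> * r k + \<gamma>\<^sup>2 * L * c * (28 / 3) * r k"
      using X_rec[of k] by (simp add: T_def algebra_simps)
    moreover have "(1 - \<gamma> * \<mu> / 2) * X k \<le> (1 - \<eta>) * X k" "(1 - p / 4) * (B * \<gamma>\<^sup>2 * s k) \<le> (1 - \<eta>) * (B * \<gamma>\<^sup>2 * s k)"
      using \<eta> X s B by (auto intro!: mult_right_mono)
    moreover have "\<gamma>\<^sup>2 * L * c * (28 / 3) * r k \<le> \<gamma> / 2 * r k"
    proof (rule mult_right_mono[OF _ r])
      \<comment> \<open>The coefficient \<open>28 / 3\<close> is \<open>4\<close> from the second moment and \<open>16 / 3\<close> from the drift of \<open>s\<close>.\<close>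
    have "\<gamma>\<^sup>2 * L * c * (28 / 3) = \<gamma> / 6 * (\<gamma> * (56 * L * c))"
        by (simp add: power2_eq_square)
      also have "\<dots> \<le> \<gamma> / 6 * 3" using \<gamma> pos by (intro mult_left_mono) auto
      finally show "\<gamma>\<^sup>2 * L * c * (28 / 3) \<le> \<gamma> / 2" by simp
    qed
    ultimately show ?thesis by (simp add: T_def algebra_simps)
  qed
  have "weight \<eta> K * T (Suc K) \<le> T 0 + (\<Sum>k\<le>K. weight \<eta> k * (3 * \<gamma> * L * er k + \<gamma>\<^sup>2 * D1 - \<gamma> / 2 * r k))"
    by (rule weighted_telescope[where u=T, OF \<eta>1 T_rec])
  also have "\<dots> = T 0 + \<gamma> * (3 * L * ?E) + \<gamma>\<^sup>2 * D1 * weight_sum \<eta> K - \<gamma> / 2 * ?R"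
    by (simp add: sum_subtractf sum.distrib sum_distrib_left sum_distrib_right
        weight_sum_def algebra_simps)
  finally have "\<gamma> / 2 * ?R \<le> T 0 + \<gamma> * (3 * L * ?E) + \<gamma>\<^sup>2 * D1 * weight_sum \<eta> K"
    using mult_nonneg_nonneg[OF less_imp_le[OF weight_pos[OF \<eta>1]] T0, of K "Suc K"] by linarith
  also have "\<dots> \<le> T 0 + \<gamma> * (1 / 4 * ?R + F2 * s 0 + \<gamma> * D3 * weight_sum \<eta> K) + \<gamma>\<^sup>2 * D1 * weight_sum \<eta> K"
    using err pos by (intro add_right_mono add_left_mono mult_left_mono) auto
  finally have "\<gamma> * ?R \<le> 4 * (T 0 + \<gamma> * F2 * s 0) + 4 * \<gamma>\<^sup>2 * (D1 + D3) * weight_sum \<eta> K"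
    by (simp add: algebra_simps power2_eq_square)
  then have "?R \<le> (4 * (T 0 + \<gamma> * F2 * s 0) + 4 * \<gamma>\<^sup>2 * (D1 + D3) * weight_sum \<eta> K) / \<gamma>"
    using pos by (simp add: field_simps)
  also have "\<dots> = 4 * (T 0 + \<gamma> * F2 * s 0) / \<gamma> + 4 * \<gamma> * (D1 + D3) * weight_sum \<eta> K"
    using pos by (simp add: add_divide_distrib power2_eq_square)
  finally show ?thesis unfolding T_def B_def .
qed

section \<open>Finite sums of smooth convex functions\<close>

lemma sigma_sq_eq_avg:
  "sigma_sq n m fs xs u = avg n (\<lambda>i. avg m (\<lambda>j. (norm (grad (fs i j) (u i) - grad (fs i j) xs))\<^sup>2))"
  unfolding sigma_sq_def avg_def by (simp add: sum_divide_distrib[symmetric])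

locale finite_sum_problem =
  fixes n m :: nat and L \<mu> :: real
    and fs :: "nat \<Rightarrow> nat \<Rightarrow> 'a::euclidean_space \<Rightarrow> real" and xs :: 'a
  assumes n: "n \<ge> 1" and m: "m \<ge> 1" and L: "L > 0" and \<mu>: "\<mu> \<ge> 0"
    and conv: "\<And>i j. i \<in> {1..n} \<Longrightarrow> j \<in> {1..m} \<Longrightarrow> convex_on UNIV (fs i j)"
    and smooth: "\<And>i j. i \<in> {1..n} \<Longrightarrow> j \<in> {1..m} \<Longrightarrow> L_smooth L (fs i j)"
    and qsc: "quasi_strongly_convex \<mu> (global_loss n m fs) xs"
begin

abbreviation "f \<equiv> global_loss n m fs"
abbreviation "f' i \<equiv> local_loss m fs i"

definition gap :: "'a \<Rightarrow> real" where "gap z = f z - f xs"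

definition heterogeneity :: real where
  "heterogeneity = avg n (\<lambda>i. (norm (grad (f' i) xs))\<^sup>2)"

lemma GDERIV_component: "i \<in> {1..n} \<Longrightarrow> j \<in> {1..m} \<Longrightarrow> GDERIV (fs i j) z :> grad (fs i j) z"
  using smooth by (rule L_smoothD(1))

lemma lipschitz_component:
  "i \<in> {1..n} \<Longrightarrow> j \<in> {1..m} \<Longrightarrow> dist (grad (fs i j) y) (grad (fs i j) z) \<le> L * dist y z"
  using smooth by (rule L_smoothD(2))

lemma GDERIV_local:
  assumes "i \<in> {1..n}"
  shows "GDERIV (f' i) z :> avg m (\<lambda>j. grad (fs i j) z)"
proof -
  have "f' i = (\<lambda>z. avg m (\<lambda>j. fs i j z))" by (simp add: local_loss_def fun_eq_iff)
  then show ?thesis using GDERIV_avg[OF GDERIV_component[OF assms]] by simp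
qed

lemma grad_local: "i \<in> {1..n} \<Longrightarrow> grad (f' i) z = avg m (\<lambda>j. grad (fs i j) z)"
  using GDERIV_local by (rule grad_eqI)

lemma GDERIV_global_avg: "GDERIV f z :> avg n (\<lambda>i. grad (f' i) z)"
proof -
  have "f = (\<lambda>z. avg n (\<lambda>i. f' i z))" by (simp add: global_loss_def fun_eq_iff)
  moreover have "GDERIV (f' i) z :> grad (f' i) z" if "i \<in> {1..n}" for i
    using GDERIV_local[OF that] grad_local[OF that] by simp
  ultimately show ?thesis using GDERIV_avg[of n "\<lambda>i. f' i" z] by simp
qed

lemma grad_global: "grad f z = avg n (\<lambda>i. grad (f' i) z)"
  using GDERIV_global_avg by (rule grad_eqI)

lemma GDERIV_global: "GDERIV f z :> grad f z"
  using GDERIV_global_avg grad_global by simp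

lemma lipschitz_avg:
  fixes h :: "nat \<Rightarrow> 'a \<Rightarrow> 'a"
  assumes "N \<ge> 1" "\<And>i. i \<in> {1..N} \<Longrightarrow> dist (h i y) (h i z) \<le> L * dist y z"
  shows "dist (avg N (\<lambda>i. h i y)) (avg N (\<lambda>i. h i z)) \<le> L * dist y z"
proof -
  have "dist (avg N (\<lambda>i. h i y)) (avg N (\<lambda>i. h i z)) = norm (avg N (\<lambda>i. h i y - h i z))"
    by (simp add: avg_diff dist_norm)
  also have "\<dots> \<le> avg N (\<lambda>i. norm (h i y - h i z))"
    unfolding avg_def by (auto intro!: divide_right_mono norm_sum)
  also have "\<dots> \<le> avg N (\<lambda>i. L * dist y z)"
    using assms(2) by (intro avg_mono) (simp add: dist_norm)
  finally show ?thesis by (simp add: avg_const[OF assms(1)])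
qed

lemma lipschitz_local:
  "i \<in> {1..n} \<Longrightarrow> dist (grad (f' i) y) (grad (f' i) z) \<le> L * dist y z"
  unfolding grad_local by (intro lipschitz_avg m lipschitz_component)

lemma lipschitz_global: "dist (grad f y) (grad f z) \<le> L * dist y z"
  unfolding grad_global by (intro lipschitz_avg n lipschitz_local)

lemma convex_global: "convex_on UNIV f"
proof (rule convex_onI)
  fix t :: real and y z :: 'a assume t: "0 < t" "t < 1"
  have "avg n (\<lambda>i. avg m (\<lambda>j. fs i j ((1 - t) *\<^sub>R y + t *\<^sub>R z)))
      \<le> avg n (\<lambda>i. avg m (\<lambda>j. (1 - t) * fs i j y + t * fs i j z))"
    using t by (intro avg_mono convex_onD[OF conv]) auto
  also have "\<dots> = (1 - t) * f y + t * f z"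
    by (simp add: global_loss_def local_loss_def avg_add avg_mult)
  finally show "f ((1 - t) *\<^sub>R y + t *\<^sub>R z) \<le> (1 - t) * f y + t * f z"
    by (simp add: global_loss_def local_loss_def)
qed simp

lemma gap_nonneg: "0 \<le> gap z"
proof -
  have "xs \<in> {x. \<forall>y. f x \<le> f y}" using qsc unfolding quasi_strongly_convex_def by simp
  then show ?thesis by (simp add: gap_def)
qed

lemma grad_minimizer: "grad f xs = 0"
proof -
  have "f (xs - (1 / L) *\<^sub>R grad f xs) \<le> f xs - (norm (grad f xs))\<^sup>2 / (2 * L)"
    using smooth_upper_bound[OF GDERIV_global lipschitz_global, of "xs - (1 / L) *\<^sub>R grad f xs" xs] L
    by (simp add: power_divide power2_norm_eq_inner[symmetric] power2_eq_square field_simps)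
  then have "(norm (grad f xs))\<^sup>2 / (2 * L) \<le> 0"
    using gap_nonneg[of "xs - (1 / L) *\<^sub>R grad f xs"] by (simp add: gap_def)
  then show ?thesis using L by (simp add: divide_le_0_iff)
qed

lemma gap_quadratic_bound: "gap z \<le> L / 2 * (norm (z - xs))\<^sup>2"
  using smooth_upper_bound[OF GDERIV_global lipschitz_global, of z xs]
  by (simp add: gap_def grad_minimizer)

text \<open>The lower bound of strong convexity and the upper bound of smoothness are compared at a point other than
  the minimizer; one exists because a Euclidean space has positive dimension.\<close>

lemma \<mu>_le_L: "\<mu> \<le> L"
proof -
  obtain b :: 'a where b: "b \<in> Basis" using nonempty_Basis by blast
  let ?z = "xs + b"
  have "f xs \<ge> f ?z + grad f ?z \<bullet> (xs - ?z) + \<mu> / 2 * (norm (?z - xs))\<^sup>2"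
    using qsc unfolding quasi_strongly_convex_def by blast
  moreover have "f xs \<le> f ?z + grad f ?z \<bullet> (xs - ?z) + L / 2 * (norm (xs - ?z))\<^sup>2"
    by (rule smooth_upper_bound[OF GDERIV_global lipschitz_global])
  ultimately show ?thesis using b by (simp add: norm_Basis)
qed

lemma qsc_gap: "grad f z \<bullet> (z - xs) \<ge> gap z + \<mu> / 2 * (norm (z - xs))\<^sup>2"
proof -
  have "f xs \<ge> f z + grad f z \<bullet> (xs - z) + \<mu> / 2 * (norm (z - xs))\<^sup>2"
    using qsc unfolding quasi_strongly_convex_def by blast
  then show ?thesis by (simp add: gap_def inner_diff_right)
qed

lemma component_grad_diff:
  "avg n (\<lambda>i. avg m (\<lambda>j. (norm (grad (fs i j) z - grad (fs i j) xs))\<^sup>2)) \<le> 2 * L * gap z"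
proof -
  have "avg n (\<lambda>i. avg m (\<lambda>j. (norm (grad (fs i j) z - grad (fs i j) xs))\<^sup>2))
      \<le> avg n (\<lambda>i. avg m (\<lambda>j. 2 * L * (fs i j z - fs i j xs - grad (fs i j) xs \<bullet> (z - xs))))"
    using L by (intro avg_mono smooth_convex_grad_diff_bound GDERIV_component lipschitz_component conv)
  also have "\<dots> = 2 * L * (f z - f xs - avg n (\<lambda>i. avg m (\<lambda>j. grad (fs i j) xs)) \<bullet> (z - xs))"
    by (simp add: avg_mult avg_diff avg_inner_left global_loss_def local_loss_def)
  also have "avg n (\<lambda>i. avg m (\<lambda>j. grad (fs i j) xs)) = grad f xs"
    unfolding grad_global by (intro avg_cong) (simp add: grad_local)
  finally show ?thesis by (simp add: grad_minimizer gap_def)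
qed

lemma sigma_sq_constant_le: "sigma_sq n m fs xs (\<lambda>_. z) \<le> 2 * L * gap z"
  unfolding sigma_sq_eq_avg by (rule component_grad_diff)

lemma sigma_sq_nonneg: "0 \<le> sigma_sq n m fs xs u"
  unfolding sigma_sq_eq_avg by (intro avg_nonneg) simp

lemma local_grad_diff:
  assumes "i \<in> {1..n}"
  shows "(norm (grad (f' i) z - grad (f' i) xs))\<^sup>2
     \<le> avg m (\<lambda>j. (norm (grad (fs i j) z - grad (fs i j) xs))\<^sup>2)"
  unfolding grad_local[OF assms] avg_diff[symmetric] by (rule norm_avg_squared_le[OF m])

lemma norm_grad_global:
  shows "(norm (grad f z))\<^sup>2 \<le> avg n (\<lambda>i. (norm (grad (f' i) z - grad (f' i) xs))\<^sup>2)"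
    and "(norm (grad f z))\<^sup>2 \<le> 2 * L * gap z"
proof -
  have "grad f z = avg n (\<lambda>i. grad (f' i) z - grad (f' i) xs)"
    using grad_minimizer by (simp add: avg_diff grad_global)
  then show 1: "(norm (grad f z))\<^sup>2 \<le> avg n (\<lambda>i. (norm (grad (f' i) z - grad (f' i) xs))\<^sup>2)"
    using norm_avg_squared_le[OF n] by simp
  also have "\<dots> \<le> avg n (\<lambda>i. avg m (\<lambda>j. (norm (grad (fs i j) z - grad (fs i j) xs))\<^sup>2))"
    by (intro avg_mono local_grad_diff)
  also have "\<dots> \<le> 2 * L * gap z" by (rule component_grad_diff)
  finally show "(norm (grad f z))\<^sup>2 \<le> 2 * L * gap z" .
qed

section \<open>Variance of the SVRG estimator\<close>

definition svrg :: "nat \<Rightarrow> nat \<Rightarrow> 'a \<Rightarrow> 'a \<Rightarrow> 'a" where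
  "svrg i l z u = grad (fs i l) z - grad (fs i l) u + grad (f' i) u"

lemma avg_svrg: "i \<in> {1..n} \<Longrightarrow> avg m (\<lambda>l. svrg i l z u) = grad (f' i) z"
  unfolding svrg_def by (simp add: avg_add avg_diff avg_const[OF m] grad_local)

text \<open>The deviation of the estimator is a difference of two centred variables, one at \<open>z\<close> and one at \<open>u\<close>. Keeping
  the negative square that centring produces at \<open>z\<close> is essential: in \<open>total_noise_bounds\<close> it offsets the squared
  gradient differences of the \<open>f' i\<close>.\<close>

lemma svrg_variance:
  assumes i: "i \<in> {1..n}"
  shows "avg m (\<lambda>l. (norm (svrg i l z u - grad (f' i) z))\<^sup>2)
     \<le> 2 * avg m (\<lambda>l. (norm (grad (fs i l) z - grad (fs i l) xs))\<^sup>2)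
       - 2 * (norm (grad (f' i) z - grad (f' i) xs))\<^sup>2
       + 2 * avg m (\<lambda>l. (norm (grad (fs i l) u - grad (fs i l) xs))\<^sup>2)"
proof -
  define a where "a v l = grad (fs i l) v - grad (fs i l) xs" for v l
  have avg_a: "avg m (a v) = grad (f' i) v - grad (f' i) xs" for v
    unfolding a_def by (simp add: avg_diff grad_local[OF i])
  have "avg m (\<lambda>l. (norm (svrg i l z u - grad (f' i) z))\<^sup>2)
      = avg m (\<lambda>l. (norm ((a z l - avg m (a z)) - (a u l - avg m (a u))))\<^sup>2)"
    unfolding avg_a by (simp add: svrg_def a_def algebra_simps)
  also have "\<dots> \<le> avg m (\<lambda>l. 2 * (norm (a z l - avg m (a z)))\<^sup>2 + 2 * (norm (a u l - avg m (a u)))\<^sup>2)"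
    by (intro avg_mono norm_diff_squared_le)
  also have "\<dots> = 2 * avg m (\<lambda>l. (norm (a z l))\<^sup>2) - 2 * (norm (avg m (a z)))\<^sup>2
      + 2 * avg m (\<lambda>l. (norm (a u l))\<^sup>2) - 2 * (norm (avg m (a u)))\<^sup>2"
    by (simp add: avg_add avg_mult mean_square_deviation[OF m])
  also have "\<dots> \<le> 2 * avg m (\<lambda>l. (norm (a z l))\<^sup>2) - 2 * (norm (avg m (a z)))\<^sup>2
      + 2 * avg m (\<lambda>l. (norm (a u l))\<^sup>2)" by simp
  finally show ?thesis unfolding avg_a by (simp add: a_def)
qed

text \<open>Variance of the estimator plus \<open>\<omega>\<close> times its second moment, the latter split into variance and squared mean.\<close>

definition noise_bound :: "real \<Rightarrow> nat \<Rightarrow> 'a \<Rightarrow> 'a \<Rightarrow> real" where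
  "noise_bound \<omega> i z u = (1 + \<omega>) * avg m (\<lambda>l. (norm (svrg i l z u - grad (f' i) z))\<^sup>2)
     + \<omega> * (norm (grad (f' i) z))\<^sup>2"

lemma noise_bound_avg:
  assumes "\<omega> \<ge> 0" "\<beta> > 0"
  defines "A \<equiv> \<lambda>z. avg n (\<lambda>i. avg m (\<lambda>j. (norm (grad (fs i j) z - grad (fs i j) xs))\<^sup>2))"
  defines "D \<equiv> \<lambda>z. avg n (\<lambda>i. (norm (grad (f' i) z - grad (f' i) xs))\<^sup>2)"
  shows "avg n (\<lambda>i. noise_bound \<omega> i z (u i))
     \<le> (1 + \<omega>) * (2 * A z - 2 * D z + 2 * sigma_sq n m fs xs u)
       + \<omega> * ((1 + \<beta>) * heterogeneity + (1 + 1 / \<beta>) * D z)"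
proof -
  have "avg n (\<lambda>i. noise_bound \<omega> i z (u i)) \<le> avg n (\<lambda>i.
      (1 + \<omega>) * (2 * avg m (\<lambda>l. (norm (grad (fs i l) z - grad (fs i l) xs))\<^sup>2)
       - 2 * (norm (grad (f' i) z - grad (f' i) xs))\<^sup>2
       + 2 * avg m (\<lambda>l. (norm (grad (fs i l) (u i) - grad (fs i l) xs))\<^sup>2))
      + \<omega> * ((1 + \<beta>) * (norm (grad (f' i) xs))\<^sup>2
       + (1 + 1 / \<beta>) * (norm (grad (f' i) z - grad (f' i) xs))\<^sup>2))"
  proof (rule avg_mono)
    fix i assume i: "i \<in> {1..n}"
    have "(norm (grad (f' i) z))\<^sup>2 \<le> (1 + \<beta>) * (norm (grad (f' i) xs))\<^sup>2
       + (1 + 1 / \<beta>) * (norm (grad (f' i) z - grad (f' i) xs))\<^sup>2"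
      using young_norm_square[OF assms(2), of "grad (f' i) xs" "grad (f' i) z - grad (f' i) xs"]
      by simp
    then show "noise_bound \<omega> i z (u i) \<le> (1 + \<omega>) * (2 * avg m (\<lambda>l. (norm (grad (fs i l) z - grad (fs i l) xs))\<^sup>2)
       - 2 * (norm (grad (f' i) z - grad (f' i) xs))\<^sup>2
       + 2 * avg m (\<lambda>l. (norm (grad (fs i l) (u i) - grad (fs i l) xs))\<^sup>2))
      + \<omega> * ((1 + \<beta>) * (norm (grad (f' i) xs))\<^sup>2
       + (1 + 1 / \<beta>) * (norm (grad (f' i) z - grad (f' i) xs))\<^sup>2)"
      unfolding noise_bound_def using assms(1)
      by (intro add_mono mult_left_mono svrg_variance[OF i]) auto
  qed
  also have "\<dots> = (1 + \<omega>) * (2 * A z - 2 * D z + 2 * sigma_sq n m fs xs u)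
       + \<omega> * ((1 + \<beta>) * heterogeneity + (1 + 1 / \<beta>) * D z)"
    by (simp only: avg_add avg_diff avg_mult A_def D_def heterogeneity_def sigma_sq_eq_avg)
  finally show ?thesis .
qed

text \<open>Both bounds come from \<open>noise_bound_avg\<close>. The first uses equal weights, since the constant required there is the
  one with factor \<open>2\<close> on the gradients at the minimizer. The second, needed for the accumulated error, uses
  \<open>\<beta> = 1 / 5\<close> and thus trades a larger multiple of the gap for the factor \<open>6 / 5\<close>.\<close>

lemma total_noise_bounds:
  assumes \<omega>: "\<omega> \<ge> 0"
  defines "c \<equiv> 1 + 2 * \<omega> / real n"
  shows "1 / real n * avg n (\<lambda>i. noise_bound \<omega> i z (u i)) + (norm (grad f z))\<^sup>2
      \<le> 4 * L * c * gap z + 2 * c * sigma_sq n m fs xs u + 2 * \<omega> / real n * heterogeneity"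
    and "1 / real n * avg n (\<lambda>i. noise_bound \<omega> i z (u i))
      \<le> 6 * L * c * gap z + 2 * c * sigma_sq n m fs xs u + 6 / 5 * \<omega> / real n * heterogeneity"
proof -
  define A where "A = avg n (\<lambda>i. avg m (\<lambda>j. (norm (grad (fs i j) z - grad (fs i j) xs))\<^sup>2))"
  define D where "D = avg n (\<lambda>i. (norm (grad (f' i) z - grad (f' i) xs))\<^sup>2)"
  define s where "s = sigma_sq n m fs xs u"
  define q where "q = 1 / real n"
  define N where "N = avg n (\<lambda>i. noise_bound \<omega> i z (u i))"
  define k where "k = \<omega> * q"
  have q: "0 \<le> q" "q \<le> 1" using n by (auto simp: q_def)
  have k: "0 \<le> k" using q \<omega> by (simp add: k_def)
  have D: "D \<le> A" unfolding A_def D_def by (intro avg_mono local_grad_diff)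
  have A: "A \<le> 2 * L * gap z" unfolding A_def by (rule component_grad_diff)
  have D0: "0 \<le> D" unfolding D_def by (intro avg_nonneg) simp
  have s: "0 \<le> s" unfolding s_def by (rule sigma_sq_nonneg)
  have G: "(norm (grad f z))\<^sup>2 \<le> D" unfolding D_def by (rule norm_grad_global)
  have c: "c = 1 + 2 * k" by (simp add: c_def k_def q_def)
  have qN: "q * N \<le> (2 * A - 2 * D + 2 * s)
      + k * (2 * A - 2 * D + 2 * s + (1 + \<beta>) * heterogeneity + (1 + 1 / \<beta>) * D)" if "\<beta> > 0" for \<beta>
  proof -
    have "q * N \<le> q * ((1 + \<omega>) * (2 * A - 2 * D + 2 * s)
       + \<omega> * ((1 + \<beta>) * heterogeneity + (1 + 1 / \<beta>) * D))"
      unfolding N_def A_def D_def s_def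
      using q by (intro mult_left_mono noise_bound_avg[OF \<omega> that]) auto
    also have "\<dots> = q * (2 * A - 2 * D + 2 * s)
      + k * (2 * A - 2 * D + 2 * s + (1 + \<beta>) * heterogeneity + (1 + 1 / \<beta>) * D)"
      unfolding k_def by (simp add: algebra_simps)
    also have "q * (2 * A - 2 * D + 2 * s) \<le> 1 * (2 * A - 2 * D + 2 * s)"
      using q D s by (intro mult_right_mono) auto
    finally show ?thesis by simp
  qed
  have "q * N + (norm (grad f z))\<^sup>2 \<le> (2 * A + 2 * s) + k * (2 * A + 2 * s + 2 * heterogeneity)"
    using qN[of 1] G D0 by (simp add: algebra_simps)
  also have "\<dots> \<le> (2 * A + 2 * s) + k * (4 * A + 4 * s + 2 * heterogeneity)"
    using k D D0 s by (intro add_left_mono mult_left_mono) auto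
  also have "\<dots> = c * (2 * A + 2 * s) + 2 * k * heterogeneity"
    unfolding c by (simp add: algebra_simps)
  also have "c * (2 * A + 2 * s) \<le> c * (4 * L * gap z + 2 * s)"
    using A k c by (intro mult_left_mono) auto
  finally show "1 / real n * avg n (\<lambda>i. noise_bound \<omega> i z (u i)) + (norm (grad f z))\<^sup>2
      \<le> 4 * L * c * gap z + 2 * c * sigma_sq n m fs xs u + 2 * \<omega> / real n * heterogeneity"
    unfolding N_def q_def s_def k_def by (simp add: algebra_simps)
  have "q * N \<le> (2 * A - 2 * D + 2 * s) + k * (2 * A + 4 * D + 2 * s + 6 / 5 * heterogeneity)"
    using qN[of "1/5"] by (simp add: algebra_simps)
  also have "\<dots> \<le> (3 * A + 2 * s) + k * (6 * A + 4 * s + 6 / 5 * heterogeneity)"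
    using k D D0 s by (intro add_mono mult_left_mono) auto
  also have "\<dots> = c * (3 * A + 2 * s) + k * (6 / 5 * heterogeneity)"
    unfolding c by (simp add: algebra_simps)
  also have "c * (3 * A + 2 * s) \<le> c * (6 * L * gap z + 2 * s)"
    using A k c by (intro mult_left_mono) auto
  finally show "1 / real n * avg n (\<lambda>i. noise_bound \<omega> i z (u i))
      \<le> 6 * L * c * gap z + 2 * c * sigma_sq n m fs xs u + 6 / 5 * \<omega> / real n * heterogeneity"
    unfolding N_def q_def s_def k_def by (simp add: algebra_simps)
qed

end

section \<open>The delayed iteration\<close>

locale delayed_qlsvrg = finite_sum_problem n m L \<mu> fs xs + prob_space M
  for n m :: nat and L \<mu> :: real
    and fs :: "nat \<Rightarrow> nat \<Rightarrow> 'a::euclidean_space \<Rightarrow> real" and xs :: 'a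
    and M :: "'b measure" +
  fixes S :: "'s measure" and Q :: "'a \<Rightarrow> 's \<Rightarrow> 'a"
    and idx :: "nat \<Rightarrow> nat \<Rightarrow> 'b \<Rightarrow> nat"
    and seed :: "nat \<Rightarrow> nat \<Rightarrow> 'b \<Rightarrow> 's"
    and coin :: "nat \<Rightarrow> nat \<Rightarrow> 'b \<Rightarrow> bool"
    and x :: "nat \<Rightarrow> 'b \<Rightarrow> 'a"
    and w g v e :: "nat \<Rightarrow> nat \<Rightarrow> 'b \<Rightarrow> 'a"
    and x0 :: 'a and w0 :: "nat \<Rightarrow> 'a"
    and \<tau> :: nat and \<gamma> p \<omega> :: real
  assumes \<tau>: "\<tau> \<ge> 1" and \<omega>: "\<omega> > 0" and p: "0 < p" "p < 1"
    and quantizer: "quantizer S Q \<omega>"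
    and fresh: "fresh_randomness M S n m p idx seed coin"
    and framework: "delayed_framework M n \<tau> \<gamma> x0 x g v e"
    and worker_step: "qlsvrg_oracle M n m fs Q idx seed coin w0 x w g"
begin

lemma prob_S: "prob_space S"
  using quantizer by (simp add: quantizer_def)

lemma Q_measurable: "(\<lambda>(z, s). Q z s) \<in> borel_measurable (borel \<Otimes>\<^sub>M S)"
  using quantizer by (simp add: quantizer_def)

lemma Q_unbiased: "integrable S (Q z)" "(\<integral>s. Q z s \<partial>S) = z"
  using quantizer by (simp_all add: quantizer_def)

lemma Q_variance:
  "integrable S (\<lambda>s. (norm (Q z s - z))\<^sup>2)" "(\<integral>s. (norm (Q z s - z))\<^sup>2 \<partial>S) \<le> \<omega> * (norm z)\<^sup>2"
  using quantizer by (simp_all add: quantizer_def)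

lemma Q_second_moment:
  shows "integrable S (\<lambda>s. (norm (Q z s - y))\<^sup>2)"
    and "(\<integral>s. (norm (Q z s - y))\<^sup>2 \<partial>S) \<le> \<omega> * (norm z)\<^sup>2 + (norm (z - y))\<^sup>2"
proof -
  interpret S: prob_space S by (rule prob_S)
  have eq: "(norm (Q z s - y))\<^sup>2
      = (norm (Q z s - z))\<^sup>2 + (2 * (Q z s \<bullet> (z - y)) - 2 * (z \<bullet> (z - y)) + (norm (z - y))\<^sup>2)" for s
    by (simp add: power2_norm_eq_inner inner_diff_left inner_diff_right inner_commute)
  have int: "integrable S (\<lambda>s. Q z s \<bullet> (z - y))"
    using Q_unbiased(1) by simp
  show "integrable S (\<lambda>s. (norm (Q z s - y))\<^sup>2)"
    unfolding eq using Q_variance(1)[of z] int by simp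
  have "(\<integral>s. (norm (Q z s - y))\<^sup>2 \<partial>S)
      = (\<integral>s. (norm (Q z s - z))\<^sup>2 \<partial>S) + (2 * (\<integral>s. Q z s \<bullet> (z - y) \<partial>S) - 2 * (z \<bullet> (z - y)) + (norm (z - y))\<^sup>2)"
    unfolding eq using Q_variance(1)[of z] int by (simp add: S.prob_space)
  also have "(\<integral>s. Q z s \<bullet> (z - y) \<partial>S) = z \<bullet> (z - y)"
    using integral_inner_left[OF Q_unbiased(1)[of z], of "z - y"] Q_unbiased(2)[of z] by simp
  finally show "(\<integral>s. (norm (Q z s - y))\<^sup>2 \<partial>S) \<le> \<omega> * (norm z)\<^sup>2 + (norm (z - y))\<^sup>2"
    using Q_variance(2)[of z] by simp
qed

section \<open>Noise of a single draw\<close>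

text \<open>The error of the stochastic gradient of worker \<open>i\<close> at the state \<open>z\<close>, \<open>u\<close>, as a function of the draw. It is cut off
  outside \<open>{1..m}\<close>, where the component functions need not be measurable.\<close>

definition draw_noise :: "nat \<Rightarrow> 'a \<Rightarrow> 'a \<Rightarrow> nat \<times> 's \<times> bool \<Rightarrow> 'a" where
  "draw_noise i z u y =
     (if fst y \<in> {1..m} then Q (svrg i (fst y) z u) (fst (snd y)) - grad (f' i) z else 0)"

lemma borel_measurable_lipschitz:
  fixes h :: "'a \<Rightarrow> 'a"
  assumes "\<And>y z. dist (h y) (h z) \<le> L * dist y z"
  shows "h \<in> borel_measurable borel"
proof -
  have "L-lipschitz_on UNIV h" using assms L by (auto intro: lipschitz_onI)
  then show ?thesis by (intro borel_measurable_continuous_onI lipschitz_on_continuous_on)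
qed

lemma grad_measurable [measurable]:
  "i \<in> {1..n} \<Longrightarrow> j \<in> {1..m} \<Longrightarrow> grad (fs i j) \<in> borel_measurable borel"
  "i \<in> {1..n} \<Longrightarrow> grad (f' i) \<in> borel_measurable borel"
  "grad f \<in> borel_measurable borel"
  by (intro borel_measurable_lipschitz lipschitz_component lipschitz_local lipschitz_global; assumption)+

lemma draw_noise_measurable:
  assumes i [measurable]: "i \<in> {1..n}"
    and [measurable]: "X \<in> borel_measurable K" "W \<in> borel_measurable K"
  shows "(\<lambda>\<zeta>. draw_noise i (X (fst \<zeta>)) (W (fst \<zeta>)) (snd \<zeta>)) \<in> borel_measurable (K \<Otimes>\<^sub>M draw_space S)"
proof -
  have 1 [measurable]: "(\<lambda>\<zeta>. fst (snd \<zeta>)) \<in> measurable (K \<Otimes>\<^sub>M draw_space S) (count_space UNIV)"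
    "(\<lambda>\<zeta>. fst (snd (snd \<zeta>))) \<in> measurable (K \<Otimes>\<^sub>M draw_space S) S"
    unfolding draw_space_def by measurable
  have "(\<lambda>\<zeta>. if l \<in> {1..m} then Q (svrg i l (X (fst \<zeta>)) (W (fst \<zeta>))) (fst (snd (snd \<zeta>))) - grad (f' i) (X (fst \<zeta>)) else 0)
      \<in> borel_measurable (K \<Otimes>\<^sub>M draw_space S)" for l
  proof (cases "l \<in> {1..m}")
    case l [measurable]: True
    have "(\<lambda>\<zeta>. svrg i l (X (fst \<zeta>)) (W (fst \<zeta>))) \<in> borel_measurable (K \<Otimes>\<^sub>M draw_space S)"
      unfolding svrg_def by measurable
    then have "(\<lambda>\<zeta>. (svrg i l (X (fst \<zeta>)) (W (fst \<zeta>)), fst (snd (snd \<zeta>))))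
        \<in> measurable (K \<Otimes>\<^sub>M draw_space S) (borel \<Otimes>\<^sub>M S)"
      by measurable
    from measurable_compose[OF this Q_measurable]
    have [measurable]: "(\<lambda>\<zeta>. Q (svrg i l (X (fst \<zeta>)) (W (fst \<zeta>))) (fst (snd (snd \<zeta>))))
        \<in> borel_measurable (K \<Otimes>\<^sub>M draw_space S)" by simp
    show ?thesis using l by simp
  next
    case False
    then show ?thesis by (simp only: if_False borel_measurable_const)
  qed
  from measurable_compose_countable[OF this 1(1)] show ?thesis
    unfolding draw_noise_def .
qed

lemma draw_noise_section_measurable:
  assumes "i \<in> {1..n}"
  shows "draw_noise i z u \<in> borel_measurable (draw_space S)"
  using measurable_Pair2[OF draw_noise_measurable[OF assms, of "\<lambda>_. z" "count_space (UNIV::unit set)" "\<lambda>_. u"], of "()"]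
  by simp

abbreviation "law \<equiv> draw_law m S p"

lemma draw_noise_mean:
  assumes i: "i \<in> {1..n}"
  shows "integrable law (\<lambda>y. a \<bullet> draw_noise i z u y)" "(\<integral>y. a \<bullet> draw_noise i z u y \<partial>law) = 0"
proof -
  interpret S: prob_space S by (rule prob_S)
  have p': "0 \<le> p" "p \<le> 1" using p by auto
  have meas: "(\<lambda>y. a \<bullet> draw_noise i z u y) \<in> borel_measurable (draw_space S)"
    using draw_noise_section_measurable[OF i] by simp
  have int: "integrable S (\<lambda>s. a \<bullet> draw_noise i z u (l, s, b))" if "l \<in> {1..m}" for l b
    unfolding draw_noise_def using that Q_unbiased(1) by simp
  show "integrable law (\<lambda>y. a \<bullet> draw_noise i z u y)"
    by (rule integrable_draw_law[OF prob_S m p' meas int])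
  have val: "(\<integral>s. a \<bullet> draw_noise i z u (l, s, b) \<partial>S) = a \<bullet> (svrg i l z u - grad (f' i) z)"
    if "l \<in> {1..m}" for l b
    using that integral_inner_right[of a S "\<lambda>s. Q (svrg i l z u) s - grad (f' i) z"] Q_unbiased[of "svrg i l z u"]
    by (simp add: draw_noise_def S.prob_space)
  have "(\<integral>y. a \<bullet> draw_noise i z u y \<partial>law)
      = avg m (\<lambda>l. p * (\<integral>s. a \<bullet> draw_noise i z u (l, s, True) \<partial>S)
          + (1 - p) * (\<integral>s. a \<bullet> draw_noise i z u (l, s, False) \<partial>S))"
    by (rule integral_draw_law[OF prob_S m p' meas int])
  also have "\<dots> = avg m (\<lambda>l. a \<bullet> (svrg i l z u - grad (f' i) z))"
    by (intro avg_cong) (simp add: val left_diff_distrib)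
  also have "\<dots> = 0"
    unfolding avg_inner_right[symmetric] avg_diff avg_svrg[OF i] avg_const[OF m] by simp
  finally show "(\<integral>y. a \<bullet> draw_noise i z u y \<partial>law) = 0" .
qed

definition noise_energy :: "nat \<Rightarrow> 'a \<Rightarrow> 'a \<Rightarrow> real" where
  "noise_energy i z u = (\<integral>y. (norm (draw_noise i z u y))\<^sup>2 \<partial>law)"

lemma draw_noise_square:
  assumes i: "i \<in> {1..n}"
  shows "integrable law (\<lambda>y. (norm (draw_noise i z u y))\<^sup>2)"
    and "noise_energy i z u \<le> noise_bound \<omega> i z u"
proof -
  have p': "0 \<le> p" "p \<le> 1" using p by auto
  have meas: "(\<lambda>y. (norm (draw_noise i z u y))\<^sup>2) \<in> borel_measurable (draw_space S)"
    using draw_noise_section_measurable[OF i] by simp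
  have int: "integrable S (\<lambda>s. (norm (draw_noise i z u (l, s, b)))\<^sup>2)" if "l \<in> {1..m}" for l b
    unfolding draw_noise_def using that Q_second_moment(1) by simp
  show "integrable law (\<lambda>y. (norm (draw_noise i z u y))\<^sup>2)"
    by (rule integrable_draw_law[OF prob_S m p' meas int])
  let ?b = "\<lambda>l. \<omega> * (norm (svrg i l z u))\<^sup>2 + (norm (svrg i l z u - grad (f' i) z))\<^sup>2"
  have val: "(\<integral>s. (norm (draw_noise i z u (l, s, b)))\<^sup>2 \<partial>S) \<le> ?b l" if "l \<in> {1..m}" for l b
    unfolding draw_noise_def using that Q_second_moment(2) by simp
  have "noise_energy i z u = avg m (\<lambda>l. p * (\<integral>s. (norm (draw_noise i z u (l, s, True)))\<^sup>2 \<partial>S)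
      + (1 - p) * (\<integral>s. (norm (draw_noise i z u (l, s, False)))\<^sup>2 \<partial>S))"
    unfolding noise_energy_def by (rule integral_draw_law[OF prob_S m p' meas int])
  also have "\<dots> \<le> avg m ?b"
  proof (rule avg_mono)
    fix l assume l: "l \<in> {1..m}"
    have "p * (\<integral>s. (norm (draw_noise i z u (l, s, True)))\<^sup>2 \<partial>S)
        + (1 - p) * (\<integral>s. (norm (draw_noise i z u (l, s, False)))\<^sup>2 \<partial>S) \<le> p * ?b l + (1 - p) * ?b l"
      using p' by (intro add_mono mult_left_mono val l) auto
    then show "p * (\<integral>s. (norm (draw_noise i z u (l, s, True)))\<^sup>2 \<partial>S)
        + (1 - p) * (\<integral>s. (norm (draw_noise i z u (l, s, False)))\<^sup>2 \<partial>S) \<le> ?b l"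
      by (simp add: algebra_simps)
  qed
  also have "\<dots> = noise_bound \<omega> i z u"
  proof -
    have "avg m (\<lambda>l. (norm (svrg i l z u))\<^sup>2)
        = avg m (\<lambda>l. (norm (svrg i l z u - grad (f' i) z))\<^sup>2) + (norm (grad (f' i) z))\<^sup>2"
      using mean_square_deviation[OF m, of "\<lambda>l. svrg i l z u"] unfolding avg_svrg[OF i] by simp
    then show ?thesis unfolding noise_bound_def by (simp only: avg_add avg_mult) (simp add: algebra_simps)
  qed
  finally show "noise_energy i z u \<le> noise_bound \<omega> i z u" .
qed

lemma noise_energy_nonneg: "0 \<le> noise_energy i z u"
  unfolding noise_energy_def by (rule Bochner_Integration.integral_nonneg) simp

section \<open>Measurability of the iterates\<close>

abbreviation workers :: "(nat \<times> nat) set" where "workers \<equiv> UNIV \<times> {1..n}"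

abbreviation dr :: "nat \<times> nat \<Rightarrow> 'b \<Rightarrow> nat \<times> 's \<times> bool" where
  "dr \<equiv> (\<lambda>(k, i). draw idx seed coin k i)"

text \<open>The \<sigma>-algebra of an arbitrary set of draws. Sets other than \<open>earlier k\<close> are needed to compare workers within
  one step.\<close>

abbreviation known :: "(nat \<times> nat) set \<Rightarrow> 'b measure" where
  "known J \<equiv> generated M (draw_space S) dr J"

abbreviation earlier :: "nat \<Rightarrow> (nat \<times> nat) set" where
  "earlier k \<equiv> {..<k} \<times> {1..n}"

lemma indep_draws: "indep_vars (\<lambda>_. draw_space S) dr workers"
  using fresh by (simp add: fresh_randomness_def)

lemma draw_measurable: "q \<in> workers \<Longrightarrow> dr q \<in> measurable M (draw_space S)"
  using indep_draws unfolding indep_vars_def by blast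

lemma law_draw: "q \<in> workers \<Longrightarrow> distr M (draw_space S) (dr q) = law"
  using fresh by (auto simp: fresh_randomness_def draw_law_def)

lemma idx_range: "i \<in> {1..n} \<Longrightarrow> \<xi> \<in> space M \<Longrightarrow> idx k i \<xi> \<in> {1..m}"
  using fresh unfolding fresh_randomness_def by blast

lemma subalgebra_known: "J \<subseteq> workers \<Longrightarrow> subalgebra M (known J)"
  by (intro subalgebra_generated draw_measurable) auto

lemma draw_known: "q \<in> J \<Longrightarrow> q \<in> workers \<Longrightarrow> dr q \<in> measurable (known J) (draw_space S)"
  using measurable_space[OF draw_measurable] by (intro measurable_generated) auto

lemma known_cong:
  fixes h :: "'b \<Rightarrow> 'c::topological_space"
  assumes "h' \<in> borel_measurable (known J)" "\<And>\<xi>. \<xi> \<in> space M \<Longrightarrow> h \<xi> = h' \<xi>"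
  shows "h \<in> borel_measurable (known J)"
proof -
  have "h \<in> borel_measurable (known J) \<longleftrightarrow> h' \<in> borel_measurable (known J)"
    using assms(2) by (intro measurable_cong) simp
  then show ?thesis using assms(1) by simp
qed

definition noise :: "nat \<times> nat \<Rightarrow> 'b \<Rightarrow> 'a" where
  "noise = (\<lambda>(k, i) \<xi>. g k i \<xi> - grad (f' i) (x k \<xi>))"

lemma noise_eq:
  assumes "i \<in> {1..n}" "\<xi> \<in> space M"
  shows "noise (k, i) \<xi> = draw_noise i (x k \<xi>) (w k i \<xi>) (dr (k, i) \<xi>)"
proof -
  have "g k i \<xi> = Q (svrg i (idx k i \<xi>) (x k \<xi>) (w k i \<xi>)) (seed k i \<xi>)"
    using worker_step assms by (simp add: qlsvrg_oracle_def svrg_def)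
  then show ?thesis using idx_range[OF assms] by (simp add: noise_def draw_noise_def draw_def)
qed

lemma x_0: "\<xi> \<in> space M \<Longrightarrow> x 0 \<xi> = x0"
  using framework by (simp add: delayed_framework_def)

lemma x_Suc:
  assumes "\<xi> \<in> space M"
  shows "x (Suc k) \<xi> = x k \<xi> - avg n (\<lambda>i. if \<tau> \<le> k then \<gamma> *\<^sub>R g (k - \<tau>) i \<xi> else 0)"
proof -
  have "avg n (\<lambda>i. v k i \<xi>) = avg n (\<lambda>i. if \<tau> \<le> k then \<gamma> *\<^sub>R g (k - \<tau>) i \<xi> else 0)"
    using framework assms by (intro avg_cong) (simp add: delayed_framework_def)
  then show ?thesis using framework assms by (simp add: delayed_framework_def)
qed

lemma w_0: "\<xi> \<in> space M \<Longrightarrow> i \<in> {1..n} \<Longrightarrow> w 0 i \<xi> = w0 i"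
  using worker_step by (simp add: qlsvrg_oracle_def)

lemma w_Suc:
  "\<xi> \<in> space M \<Longrightarrow> i \<in> {1..n} \<Longrightarrow> w (Suc k) i \<xi> = (if coin k i \<xi> then x k \<xi> else w k i \<xi>)"
  using worker_step by (simp add: qlsvrg_oracle_def)

lemma noise_known_aux:
  assumes i: "i \<in> {1..n}" and J: "(k, i) \<in> J"
    and x: "x k \<in> borel_measurable (known J)" and w: "w k i \<in> borel_measurable (known J)"
  shows "noise (k, i) \<in> borel_measurable (known J)"
proof -
  have "dr (k, i) \<in> measurable (known J) (draw_space S)"
    by (rule draw_known[OF J]) (use i in simp)
  then have "(\<lambda>\<xi>. (\<xi>, dr (k, i) \<xi>)) \<in> measurable (known J) (known J \<Otimes>\<^sub>M draw_space S)"
    by (intro measurable_Pair measurable_ident_sets refl)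
  from measurable_compose[OF this draw_noise_measurable[OF i x w]]
  have "(\<lambda>\<xi>. draw_noise i (x k \<xi>) (w k i \<xi>) (dr (k, i) \<xi>)) \<in> borel_measurable (known J)"
    unfolding fst_conv snd_conv .
  then show ?thesis by (rule known_cong) (rule noise_eq[OF i])
qed

lemma g_eq_noise: "g k i = (\<lambda>\<xi>. noise (k, i) \<xi> + grad (f' i) (x k \<xi>))"
  by (simp add: noise_def)

lemma g_known_aux:
  assumes i: "i \<in> {1..n}" and J: "(k, i) \<in> J"
    and x: "x k \<in> borel_measurable (known J)" and w: "w k i \<in> borel_measurable (known J)"
  shows "g k i \<in> borel_measurable (known J)"
proof (subst g_eq_noise, rule borel_measurable_add)
  show "noise (k, i) \<in> borel_measurable (known J)" using assms by (rule noise_known_aux)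
  show "(\<lambda>\<xi>. grad (f' i) (x k \<xi>)) \<in> borel_measurable (known J)"
    using x grad_measurable(2)[OF i] by (rule measurable_compose)
qed

lemma measurable_avg:
  fixes h :: "nat \<Rightarrow> 'c \<Rightarrow> 'd::euclidean_space"
  assumes "\<And>i. i \<in> {1..N} \<Longrightarrow> h i \<in> borel_measurable K"
  shows "(\<lambda>\<xi>. avg N (\<lambda>i. h i \<xi>)) \<in> borel_measurable K"
  unfolding avg_def
  by (rule borel_measurable_scaleR[OF borel_measurable_const borel_measurable_sum[OF assms]])

text \<open>Iterates and gradients depend on each other, so their measurability is shown in one induction. It comes before
  integrability, which needs the freezing lemma and hence measurability.\<close>

lemma state_known_aux:
  "\<forall>t\<le>k. x t \<in> borel_measurable (known (earlier t)) \<and>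
     (\<forall>i\<in>{1..n}. w t i \<in> borel_measurable (known (earlier t)))"
proof (induction k)
  case 0
  have "x 0 \<in> borel_measurable (known (earlier 0))"
    by (rule known_cong[OF borel_measurable_const x_0])
  moreover have "w 0 i \<in> borel_measurable (known (earlier 0))" if "i \<in> {1..n}" for i
    by (rule known_cong[OF borel_measurable_const w_0[OF _ that]])
  ultimately show ?case by simp
next
  case (Suc k)
  let ?K = "known (earlier (Suc k))"
  have xt: "x t \<in> borel_measurable ?K" if "t \<le> k" for t
    by (rule measurable_generated_mono[of _ _ _ _ "earlier t"]) (use Suc.IH that in auto)
  have wt: "w t i \<in> borel_measurable ?K" if "t \<le> k" "i \<in> {1..n}" for t i
    by (rule measurable_generated_mono[of _ _ _ _ "earlier t"]) (use Suc.IH that in auto)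
  have gt: "g t i \<in> borel_measurable ?K" if "t \<le> k" "i \<in> {1..n}" for t i
    by (rule g_known_aux[OF that(2) _ xt[OF that(1)] wt[OF that]]) (use that in simp)
  have "(\<lambda>\<xi>. avg n (\<lambda>i. if \<tau> \<le> k then \<gamma> *\<^sub>R g (k - \<tau>) i \<xi> else 0)) \<in> borel_measurable ?K"
  proof (rule measurable_avg)
    fix i assume i: "i \<in> {1..n}"
    have "(\<lambda>\<xi>. \<gamma> *\<^sub>R g (k - \<tau>) i \<xi>) \<in> borel_measurable ?K"
      by (intro borel_measurable_scaleR borel_measurable_const gt i) simp
    then show "(\<lambda>\<xi>. if \<tau> \<le> k then \<gamma> *\<^sub>R g (k - \<tau>) i \<xi> else 0) \<in> borel_measurable ?K"
      by (cases "\<tau> \<le> k") (simp_all only: if_True if_False borel_measurable_const)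
  qed
  with xt[OF order_refl]
  have "(\<lambda>\<xi>. x k \<xi> - avg n (\<lambda>i. if \<tau> \<le> k then \<gamma> *\<^sub>R g (k - \<tau>) i \<xi> else 0)) \<in> borel_measurable ?K"
    by (rule borel_measurable_diff)
  then have "x (Suc k) \<in> borel_measurable ?K"
    by (rule known_cong) (rule x_Suc)
  moreover have "w (Suc k) i \<in> borel_measurable ?K" if i: "i \<in> {1..n}" for i
  proof -
    have "dr (k, i) \<in> measurable ?K (draw_space S)"
      by (rule draw_known) (use i in auto)
    moreover have "(\<lambda>y. snd (snd y)) \<in> measurable (draw_space S) (count_space UNIV)"
      unfolding draw_space_def by measurable
    ultimately have "(\<lambda>\<xi>. snd (snd (dr (k, i) \<xi>))) \<in> measurable ?K (count_space UNIV)"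
      by (rule measurable_compose)
    then have "{\<xi> \<in> space ?K. coin k i \<xi>} \<in> sets ?K" by (simp add: draw_def pred_def)
    then have "(\<lambda>\<xi>. if coin k i \<xi> then x k \<xi> else w k i \<xi>) \<in> borel_measurable ?K"
      by (rule measurable_If[OF xt[OF order_refl] wt[OF order_refl i]])
    then show ?thesis by (rule known_cong) (rule w_Suc[OF _ i])
  qed
  ultimately show ?case using Suc.IH by (auto simp: le_Suc_eq)
qed

lemma x_known: "earlier k \<subseteq> J \<Longrightarrow> x k \<in> borel_measurable (known J)"
  by (rule measurable_generated_mono[of _ _ _ _ "earlier k"])
     (use state_known_aux[of k] in auto)

lemma w_known: "i \<in> {1..n} \<Longrightarrow> earlier k \<subseteq> J \<Longrightarrow> w k i \<in> borel_measurable (known J)"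
  by (rule measurable_generated_mono[of _ _ _ _ "earlier k"])
     (use state_known_aux[of k] in auto)

lemma noise_known:
  "i \<in> {1..n} \<Longrightarrow> insert (k, i) (earlier k) \<subseteq> J \<Longrightarrow> noise (k, i) \<in> borel_measurable (known J)"
  by (rule noise_known_aux[OF _ _ x_known w_known]) auto

lemma g_known:
  "i \<in> {1..n} \<Longrightarrow> insert (k, i) (earlier k) \<subseteq> J \<Longrightarrow> g k i \<in> borel_measurable (known J)"
  by (rule g_known_aux[OF _ _ x_known w_known]) auto

lemma known_measurable:
  "h \<in> borel_measurable (known J) \<Longrightarrow> J \<subseteq> workers \<Longrightarrow> h \<in> borel_measurable M"
  by (rule measurable_from_subalg[OF subalgebra_known])

section \<open>Square integrability and orthogonality of the noise\<close>

lemma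
  assumes J: "J \<subseteq> workers" and q: "q \<in> workers" "q \<notin> J"
    and h: "(\<lambda>\<zeta>. h (fst \<zeta>) (snd \<zeta>)) \<in> borel_measurable (known J \<Otimes>\<^sub>M draw_space S)"
    and int: "\<And>\<xi>. \<xi> \<in> space M \<Longrightarrow> integrable law (h \<xi>)"
    and B: "integrable M B" "\<And>\<xi>. \<xi> \<in> space M \<Longrightarrow> (\<integral>y. \<bar>h \<xi> y\<bar> \<partial>law) \<le> B \<xi>"
  shows fresh_draw_integrable: "integrable M (\<lambda>\<xi>. h \<xi> (dr q \<xi>) :: real)"
    and fresh_draw_integral: "(\<integral>\<xi>. h \<xi> (dr q \<xi>) \<partial>M) = (\<integral>\<xi>. \<integral>y. h \<xi> y \<partial>law \<partial>M)"
  using freeze_integrable[OF indep_draws J q law_draw[OF q(1)] h _ B(1)]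
    freeze_integral[OF indep_draws J q law_draw[OF q(1)] h _ B(1)] int B(2)
  unfolding fst_conv snd_conv by blast+

lemma known_draw_noise:
  assumes i: "i \<in> {1..n}" and k: "earlier k \<subseteq> J"
  shows "(\<lambda>\<zeta>. draw_noise i (x k (fst \<zeta>)) (w k i (fst \<zeta>)) (snd \<zeta>)) \<in> borel_measurable (known J \<Otimes>\<^sub>M draw_space S)"
  by (rule draw_noise_measurable[OF i x_known[OF k] w_known[OF i k]])

lemma square_integrable_grad:
  assumes "square_integrable M X"
  shows "i \<in> {1..n} \<Longrightarrow> j \<in> {1..m} \<Longrightarrow> square_integrable M (\<lambda>\<xi>. grad (fs i j) (X \<xi>))"
    and "i \<in> {1..n} \<Longrightarrow> square_integrable M (\<lambda>\<xi>. grad (f' i) (X \<xi>))"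
    and "square_integrable M (\<lambda>\<xi>. grad f (X \<xi>))"
proof -
  show "square_integrable M (\<lambda>\<xi>. grad (fs i j) (X \<xi>))" if "i \<in> {1..n}" "j \<in> {1..m}"
    by (rule square_integrable_lipschitz[OF assms lipschitz_component[OF that] grad_measurable(1)[OF that]])
  show "square_integrable M (\<lambda>\<xi>. grad (f' i) (X \<xi>))" if "i \<in> {1..n}"
    by (rule square_integrable_lipschitz[OF assms lipschitz_local[OF that] grad_measurable(2)[OF that]])
  show "square_integrable M (\<lambda>\<xi>. grad f (X \<xi>))"
    by (rule square_integrable_lipschitz[OF assms lipschitz_global grad_measurable(3)])
qed

lemma integrable_avg:
  fixes h :: "nat \<Rightarrow> 'b \<Rightarrow> real"
  assumes "\<And>i. i \<in> {1..N} \<Longrightarrow> integrable M (h i)"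
  shows "integrable M (\<lambda>\<xi>. avg N (\<lambda>i. h i \<xi>))" "(\<integral>\<xi>. avg N (\<lambda>i. h i \<xi>) \<partial>M) = avg N (\<lambda>i. \<integral>\<xi>. h i \<xi> \<partial>M)"
proof -
  show "integrable M (\<lambda>\<xi>. avg N (\<lambda>i. h i \<xi>))"
    unfolding avg_def by (intro integrable_scaleR_right Bochner_Integration.integrable_sum assms)
  show "(\<integral>\<xi>. avg N (\<lambda>i. h i \<xi>) \<partial>M) = avg N (\<lambda>i. \<integral>\<xi>. h i \<xi> \<partial>M)"
    unfolding avg_def integral_scaleR_right by (simp only: Bochner_Integration.integral_sum[OF assms])
qed

lemma integrable_noise_bound:
  assumes X: "square_integrable M X" and W: "square_integrable M W" and i: "i \<in> {1..n}"
  shows "integrable M (\<lambda>\<xi>. noise_bound \<omega> i (X \<xi>) (W \<xi>))"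
  unfolding noise_bound_def svrg_def
  by (intro Bochner_Integration.integrable_add integrable_mult_right integrable_avg square_integrableD
      square_integrable_diff square_integrable_add square_integrable_grad X W i)

text \<open>The quantizer is controlled only for fixed arguments, so square integrability of the noise is obtained by freezing the
  state and integrating its conditional second moment.\<close>

lemma noise_square_integrable_aux:
  assumes i: "i \<in> {1..n}" and x: "square_integrable M (x k)" and w: "square_integrable M (w k i)"
  shows "square_integrable M (noise (k, i))"
proof -
  have "integrable M (\<lambda>\<xi>. (norm (draw_noise i (x k \<xi>) (w k i \<xi>) (dr (k, i) \<xi>)))\<^sup>2)"
  proof (rule fresh_draw_integrable[of "earlier k"])
    show "(\<lambda>\<zeta>. (norm (draw_noise i (x k (fst \<zeta>)) (w k i (fst \<zeta>)) (snd \<zeta>)))\<^sup>2)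
        \<in> borel_measurable (known (earlier k) \<Otimes>\<^sub>M draw_space S)"
      by (intro norm_square_measurable known_draw_noise i order_refl)
    show "integrable M (\<lambda>\<xi>. noise_bound \<omega> i (x k \<xi>) (w k i \<xi>))"
      by (rule integrable_noise_bound[OF x w i])
    show "(\<integral>y. \<bar>(norm (draw_noise i (x k \<xi>) (w k i \<xi>) y))\<^sup>2\<bar> \<partial>law) \<le> noise_bound \<omega> i (x k \<xi>) (w k i \<xi>)" for \<xi>
      using draw_noise_square(2)[OF i] by (simp add: noise_energy_def)
  qed (use i draw_noise_square(1)[OF i] in auto)
  then have "integrable M (\<lambda>\<xi>. (norm (noise (k, i) \<xi>))\<^sup>2)"
    by (rule Bochner_Integration.integrable_cong[OF refl, THEN iffD1, rotated])
       (simp only: noise_eq[OF i])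
  moreover have "noise (k, i) \<in> borel_measurable M"
    by (rule known_measurable[OF noise_known[OF i order_refl]]) (use i in auto)
  ultimately show ?thesis by (simp add: square_integrable_def)
qed

lemma g_square_integrable_aux:
  assumes i: "i \<in> {1..n}" and x: "square_integrable M (x k)" and w: "square_integrable M (w k i)"
  shows "square_integrable M (g k i)"
  by (subst g_eq_noise, rule square_integrable_add[OF noise_square_integrable_aux[OF assms] square_integrable_grad(2)[OF x i]])

lemma w_measurable: "i \<in> {1..n} \<Longrightarrow> w k i \<in> borel_measurable M"
  by (rule known_measurable[OF w_known[OF _ order_refl]]) auto

lemma state_square_integrable_aux:
  "\<forall>t\<le>k. square_integrable M (x t) \<and> (\<forall>i\<in>{1..n}. square_integrable M (w t i))"
proof (induction k)
  case 0
  have "square_integrable M (x 0)"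
    by (rule square_integrable_cong[OF square_integrable_const x_0])
  moreover have "square_integrable M (w 0 i)" if "i \<in> {1..n}" for i
    by (rule square_integrable_cong[OF square_integrable_const w_0[OF _ that]])
  ultimately show ?case by simp
next
  case (Suc k)
  have "square_integrable M (\<lambda>\<xi>. if \<tau> \<le> k then \<gamma> *\<^sub>R g (k - \<tau>) i \<xi> else 0)" if i: "i \<in> {1..n}" for i
  proof (cases "\<tau> \<le> k")
    case True
    have "square_integrable M (\<lambda>\<xi>. \<gamma> *\<^sub>R g (k - \<tau>) i \<xi>)"
      by (rule square_integrable_scaleR[OF g_square_integrable_aux[OF i]]) (use Suc.IH i in auto)
    then show ?thesis using True by (simp only: if_True)
  next
    case False
    then show ?thesis by (simp only: if_False square_integrable_const)
  qed
  from square_integrable_avg[OF this]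
  have "square_integrable M (\<lambda>\<xi>. x k \<xi> - avg n (\<lambda>i. if \<tau> \<le> k then \<gamma> *\<^sub>R g (k - \<tau>) i \<xi> else 0))"
    by (intro square_integrable_diff) (use Suc.IH in auto)
  then have "square_integrable M (x (Suc k))"
    by (rule square_integrable_cong) (rule x_Suc)
  moreover have "square_integrable M (w (Suc k) i)" if i: "i \<in> {1..n}" for i
    by (rule square_integrable_select[of _ "x k" "w k i"])
       (use Suc.IH i w_measurable w_Suc in auto)
  ultimately show ?case using Suc.IH by (auto simp: le_Suc_eq)
qed

lemma x_square_integrable: "square_integrable M (x k)"
  using state_square_integrable_aux[of k] by blast

lemma w_square_integrable: "i \<in> {1..n} \<Longrightarrow> square_integrable M (w k i)"
  using state_square_integrable_aux[of k] by blast

lemma noise_square_integrable: "q \<in> workers \<Longrightarrow> square_integrable M (noise q)"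
  using noise_square_integrable_aux x_square_integrable w_square_integrable by (cases q) auto

lemma g_square_integrable: "i \<in> {1..n} \<Longrightarrow> square_integrable M (g k i)"
  by (rule g_square_integrable_aux[OF _ x_square_integrable w_square_integrable])

lemma integrable_state_noise_bound:
  "i \<in> {1..n} \<Longrightarrow> integrable M (\<lambda>\<xi>. noise_bound \<omega> i (x k \<xi>) (w k i \<xi>))"
  by (rule integrable_noise_bound[OF x_square_integrable w_square_integrable])

text \<open>The noise is centred for each frozen state; \<open>J\<close> may contain draws made at step \<open>k\<close> by other workers.\<close>

lemma fresh_noise_orthogonal:
  assumes i: "i \<in> {1..n}" and X: "square_integrable M X" "X \<in> borel_measurable (known J)"
    and J: "J \<subseteq> workers" "earlier k \<subseteq> J" "(k, i) \<notin> J"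
  shows "(\<integral>\<xi>. X \<xi> \<bullet> noise (k, i) \<xi> \<partial>M) = 0"
proof -
  interpret law: prob_space law by (rule prob_space_draw_law[OF prob_S])
  let ?\<nu> = "\<lambda>\<xi>. draw_noise i (x k \<xi>) (w k i \<xi>)"
  have bound: "(\<integral>y. \<bar>X \<xi> \<bullet> ?\<nu> \<xi> y\<bar> \<partial>law) \<le> (norm (X \<xi>))\<^sup>2 + noise_bound \<omega> i (x k \<xi>) (w k i \<xi>)" for \<xi>
  proof -
    have "(\<integral>y. \<bar>X \<xi> \<bullet> ?\<nu> \<xi> y\<bar> \<partial>law) \<le> (\<integral>y. (norm (X \<xi>))\<^sup>2 + (norm (?\<nu> \<xi> y))\<^sup>2 \<partial>law)"
    proof (rule integral_mono)
      show "integrable law (\<lambda>y. \<bar>X \<xi> \<bullet> ?\<nu> \<xi> y\<bar>)"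
        by (intro integrable_abs draw_noise_mean i)
      show "integrable law (\<lambda>y. (norm (X \<xi>))\<^sup>2 + (norm (?\<nu> \<xi> y))\<^sup>2)"
        by (intro Bochner_Integration.integrable_add draw_noise_square i) simp
      show "\<bar>X \<xi> \<bullet> ?\<nu> \<xi> y\<bar> \<le> (norm (X \<xi>))\<^sup>2 + (norm (?\<nu> \<xi> y))\<^sup>2" for y
        by (rule abs_inner_le)
    qed
    also have "\<dots> = (norm (X \<xi>))\<^sup>2 + noise_energy i (x k \<xi>) (w k i \<xi>)"
      using draw_noise_square(1)[OF i] by (simp add: noise_energy_def law.prob_space)
    finally show ?thesis using draw_noise_square(2)[OF i, of "x k \<xi>" "w k i \<xi>"] by linarith
  qed
  have "(\<integral>\<xi>. X \<xi> \<bullet> ?\<nu> \<xi> (dr (k, i) \<xi>) \<partial>M) = (\<integral>\<xi>. \<integral>y. X \<xi> \<bullet> ?\<nu> \<xi> y \<partial>law \<partial>M)"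
  proof (rule fresh_draw_integral[OF J(1) _ J(3)])
    show "(\<lambda>\<zeta>. X (fst \<zeta>) \<bullet> ?\<nu> (fst \<zeta>) (snd \<zeta>)) \<in> borel_measurable (known J \<Otimes>\<^sub>M draw_space S)"
      by (intro borel_measurable_inner known_draw_noise i J measurable_compose[OF measurable_fst X(2)])
    show "integrable M (\<lambda>\<xi>. (norm (X \<xi>))\<^sup>2 + noise_bound \<omega> i (x k \<xi>) (w k i \<xi>))"
      by (intro Bochner_Integration.integrable_add square_integrableD X integrable_state_noise_bound i)
  qed (use i bound draw_noise_mean(1)[OF i] in auto)
  also have "\<dots> = 0" by (simp only: draw_noise_mean(2)[OF i]) simp
  finally have "(\<integral>\<xi>. X \<xi> \<bullet> ?\<nu> \<xi> (dr (k, i) \<xi>) \<partial>M) = 0" .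
  moreover have "(\<integral>\<xi>. X \<xi> \<bullet> noise (k, i) \<xi> \<partial>M) = (\<integral>\<xi>. X \<xi> \<bullet> ?\<nu> \<xi> (dr (k, i) \<xi>) \<partial>M)"
    by (rule Bochner_Integration.integral_cong[OF refl]) (simp only: noise_eq[OF i])
  ultimately show ?thesis by simp
qed

text \<open>The conditional second moment of the noise of worker \<open>i\<close> at step \<open>k\<close>.\<close>

definition energy :: "nat \<Rightarrow> nat \<Rightarrow> 'b \<Rightarrow> real" where
  "energy k i \<xi> = noise_energy i (x k \<xi>) (w k i \<xi>)"

lemma energy_known:
  assumes i: "i \<in> {1..n}"
  shows "energy k i \<in> borel_measurable (known (earlier k))"
proof -
  interpret law: prob_space law by (rule prob_space_draw_law[OF prob_S])
  have "(\<lambda>\<zeta>. (norm (draw_noise i (x k (fst \<zeta>)) (w k i (fst \<zeta>)) (snd \<zeta>)))\<^sup>2)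
      \<in> borel_measurable (known (earlier k) \<Otimes>\<^sub>M draw_space S)"
    by (intro norm_square_measurable known_draw_noise i order_refl)
  then have "(\<lambda>(\<xi>, y). (norm (draw_noise i (x k \<xi>) (w k i \<xi>) y))\<^sup>2)
      \<in> borel_measurable (known (earlier k) \<Otimes>\<^sub>M law)"
    unfolding case_prod_beta
    by (subst measurable_cong_sets[OF sets_pair_measure_cong[OF refl sets_draw_law] refl])
  from law.borel_measurable_lebesgue_integral[OF this]
  show ?thesis unfolding energy_def noise_energy_def .
qed

lemma energy_bounds:
  "0 \<le> energy k i \<xi>" "i \<in> {1..n} \<Longrightarrow> energy k i \<xi> \<le> noise_bound \<omega> i (x k \<xi>) (w k i \<xi>)"
  unfolding energy_def by (rule noise_energy_nonneg, rule draw_noise_square(2))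

lemma energy_integrable:
  assumes i: "i \<in> {1..n}"
  shows "integrable M (energy k i)"
proof (rule Bochner_Integration.integrable_bound[OF integrable_state_noise_bound[OF i]])
  show "energy k i \<in> borel_measurable M"
    by (rule known_measurable[OF energy_known[OF i]]) auto
  show "AE \<xi> in M. norm (energy k i \<xi>) \<le> norm (noise_bound \<omega> i (x k \<xi>) (w k i \<xi>))"
    using energy_bounds[OF ] order_trans[OF energy_bounds(2)[OF i] abs_ge_self] i by (intro AE_I2) simp
qed

lemma known_sets: "A \<in> sets (known J) \<Longrightarrow> J \<subseteq> workers \<Longrightarrow> A \<in> sets M"
  using subalgebra_known[of J] by (auto simp: subalgebra_def)

lemma integral_noise_energy:
  assumes i: "i \<in> {1..n}" and A: "A \<in> sets (known (earlier k))"
  shows "(\<integral>\<xi>. indicat_real A \<xi> * (norm (noise (k, i) \<xi>))\<^sup>2 \<partial>M) = (\<integral>\<xi>. indicat_real A \<xi> * energy k i \<xi> \<partial>M)"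
proof -
  let ?\<nu> = "\<lambda>\<xi>. draw_noise i (x k \<xi>) (w k i \<xi>)"
  have "(\<integral>\<xi>. indicat_real A \<xi> * (norm (?\<nu> \<xi> (dr (k, i) \<xi>)))\<^sup>2 \<partial>M)
      = (\<integral>\<xi>. \<integral>y. indicat_real A \<xi> * (norm (?\<nu> \<xi> y))\<^sup>2 \<partial>law \<partial>M)"
  proof (rule fresh_draw_integral[of "earlier k"])
    show "(\<lambda>\<zeta>. indicat_real A (fst \<zeta>) * (norm (?\<nu> (fst \<zeta>) (snd \<zeta>)))\<^sup>2)
        \<in> borel_measurable (known (earlier k) \<Otimes>\<^sub>M draw_space S)"
      by (intro borel_measurable_times norm_square_measurable known_draw_noise i order_refl
          measurable_compose[OF measurable_fst borel_measurable_indicator[OF A]])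
    show "integrable M (\<lambda>\<xi>. noise_bound \<omega> i (x k \<xi>) (w k i \<xi>))"
      by (rule integrable_state_noise_bound[OF i])
    show "(\<integral>y. \<bar>indicat_real A \<xi> * (norm (?\<nu> \<xi> y))\<^sup>2\<bar> \<partial>law) \<le> noise_bound \<omega> i (x k \<xi>) (w k i \<xi>)" for \<xi>
      using draw_noise_square(2)[OF i, of "x k \<xi>" "w k i \<xi>"]
        order_trans[OF noise_energy_nonneg draw_noise_square(2)[OF i], of "x k \<xi>" "w k i \<xi>"]
      by (simp add: noise_energy_def indicator_def)
  qed (use i draw_noise_square(1)[OF i] in auto)
  also have "\<dots> = (\<integral>\<xi>. indicat_real A \<xi> * energy k i \<xi> \<partial>M)"
    by (simp add: energy_def noise_energy_def)
  finally have "(\<integral>\<xi>. indicat_real A \<xi> * (norm (?\<nu> \<xi> (dr (k, i) \<xi>)))\<^sup>2 \<partial>M) = \<dots>" .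
  moreover have "(\<integral>\<xi>. indicat_real A \<xi> * (norm (noise (k, i) \<xi>))\<^sup>2 \<partial>M)
      = (\<integral>\<xi>. indicat_real A \<xi> * (norm (?\<nu> \<xi> (dr (k, i) \<xi>)))\<^sup>2 \<partial>M)"
    by (rule Bochner_Integration.integral_cong[OF refl]) (simp only: noise_eq[OF i])
  ultimately show ?thesis by simp
qed

text \<open>The later of two draws, or either of two draws at the same step, is fresh with respect to all other draws up to
  its step, and these determine the other noise and the event \<open>A\<close>.\<close>

lemma noise_cross_aux:
  assumes q: "(k, i) \<in> workers" "(k', i') \<in> workers" "(k, i) \<noteq> (k', i')" and le: "k' \<le> k"
    and A: "A \<in> sets (known (earlier k))"
  shows "(\<integral>\<xi>. indicat_real A \<xi> * (noise (k', i') \<xi> \<bullet> noise (k, i) \<xi>) \<partial>M) = 0"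
proof -
  define J where "J = earlier (Suc k) - {(k, i)}"
  have J: "J \<subseteq> workers" "earlier k \<subseteq> J" "(k, i) \<notin> J" "insert (k', i') (earlier k') \<subseteq> J"
    using q le by (auto simp: J_def)
  have A': "A \<in> sets (known J)" using A generated_mono[OF J(2)] by blast
  have "(\<integral>\<xi>. (indicat_real A \<xi> *\<^sub>R noise (k', i') \<xi>) \<bullet> noise (k, i) \<xi> \<partial>M) = 0"
  proof (rule fresh_noise_orthogonal[OF _ _ _ J(1-3)])
    show "square_integrable M (\<lambda>\<xi>. indicat_real A \<xi> *\<^sub>R noise (k', i') \<xi>)"
      by (rule square_integrable_indicator[OF noise_square_integrable[OF q(2)] known_sets[OF A' J(1)]])
    show "(\<lambda>\<xi>. indicat_real A \<xi> *\<^sub>R noise (k', i') \<xi>) \<in> borel_measurable (known J)"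
      by (rule borel_measurable_scaleR[OF borel_measurable_indicator[OF A'] noise_known[OF _ J(4)]])
         (use q in auto)
  qed (use q in auto)
  then show ?thesis by simp
qed

lemma noise_cross:
  assumes q: "q \<in> workers" "q' \<in> workers" "q \<noteq> q'" and k0: "k0 \<le> fst q" "k0 \<le> fst q'"
    and A: "A \<in> sets (known (earlier k0))"
  shows "(\<integral>\<xi>. indicat_real A \<xi> * (noise q \<xi> \<bullet> noise q' \<xi>) \<partial>M) = 0"
proof -
  obtain k i k' i' where eq: "q = (k, i)" "q' = (k', i')" by (metis surj_pair)
  have A': "A \<in> sets (known (earlier k))" if "k0 \<le> k" for k
  proof -
    have "earlier k0 \<subseteq> earlier k" using that by auto
    then show ?thesis using A generated_mono by blast
  qed
  show ?thesis
  proof (cases "k \<le> k'")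
    case True
    have "(k', i') \<in> workers" "(k, i) \<in> workers" "(k', i') \<noteq> (k, i)" "k0 \<le> k'"
      using q k0 unfolding eq by auto
    from noise_cross_aux[OF this(1-3) True A'[OF this(4)]] show ?thesis unfolding eq .
  next
    case False
    have "(k, i) \<in> workers" "(k', i') \<in> workers" "(k, i) \<noteq> (k', i')" "k0 \<le> k" "k' \<le> k"
      using q k0 False unfolding eq by auto
    from noise_cross_aux[OF this(1-3,5) A'[OF this(4)]] show ?thesis
      unfolding eq by (simp add: inner_commute)
  qed
qed

lemma noise_pythagoras:
  assumes J: "finite J" "J \<subseteq> workers" and k0: "\<And>q. q \<in> J \<Longrightarrow> k0 \<le> fst q"
    and A: "A \<in> sets (known (earlier k0))"
  shows "(\<integral>\<xi>. indicat_real A \<xi> * (norm (\<Sum>q\<in>J. noise q \<xi>))\<^sup>2 \<partial>M)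
      = (\<Sum>q\<in>J. \<integral>\<xi>. indicat_real A \<xi> * (norm (noise q \<xi>))\<^sup>2 \<partial>M)"
proof -
  have AM: "A \<in> sets M" by (rule known_sets[OF A]) auto
  have int: "integrable M (\<lambda>\<xi>. indicat_real A \<xi> * (noise q \<xi> \<bullet> noise q' \<xi>))" if "q \<in> J" "q' \<in> J" for q q'
    using integrable_mult_indicator[OF AM square_integrable_inner[OF noise_square_integrable noise_square_integrable], of q q']
      that J(2) by auto
  have "(\<integral>\<xi>. indicat_real A \<xi> * (norm (\<Sum>q\<in>J. noise q \<xi>))\<^sup>2 \<partial>M)
      = (\<integral>\<xi>. (\<Sum>q\<in>J. \<Sum>q'\<in>J. indicat_real A \<xi> * (noise q \<xi> \<bullet> noise q' \<xi>)) \<partial>M)"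
    unfolding power2_norm_eq_inner inner_sum_left inner_sum_right sum_distrib_left
    by (subst sum.swap) (rule refl)
  also have "\<dots> = (\<Sum>q\<in>J. \<Sum>q'\<in>J. \<integral>\<xi>. indicat_real A \<xi> * (noise q \<xi> \<bullet> noise q' \<xi>) \<partial>M)"
    using int by (simp add: Bochner_Integration.integral_sum)
  also have "\<dots> = (\<Sum>q\<in>J. \<Sum>q'\<in>J. if q' = q then \<integral>\<xi>. indicat_real A \<xi> * (norm (noise q \<xi>))\<^sup>2 \<partial>M else 0)"
  proof (intro sum.cong refl)
    fix q q' assume q: "q \<in> J" "q' \<in> J"
    show "(\<integral>\<xi>. indicat_real A \<xi> * (noise q \<xi> \<bullet> noise q' \<xi>) \<partial>M)
        = (if q' = q then \<integral>\<xi>. indicat_real A \<xi> * (norm (noise q \<xi>))\<^sup>2 \<partial>M else 0)"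
    proof (cases "q' = q")
      case True
      then show ?thesis by (simp add: power2_norm_eq_inner)
    next
      case False
      have "(\<integral>\<xi>. indicat_real A \<xi> * (noise q \<xi> \<bullet> noise q' \<xi>) \<partial>M) = 0"
        by (rule noise_cross[OF _ _ _ k0 k0 A]) (use q False J(2) in blast)+
      then show ?thesis using False by simp
    qed
  qed
  also have "\<dots> = (\<Sum>q\<in>J. \<integral>\<xi>. indicat_real A \<xi> * (norm (noise q \<xi>))\<^sup>2 \<partial>M)"
    using J(1) by simp
  finally show ?thesis .
qed

section \<open>Conditional expectations\<close>

abbreviation history :: "nat \<Rightarrow> 'b measure" where
  "history k \<equiv> past M S n idx seed coin x k"

lemma
  shows space_history: "space (history k) = space M"
    and sets_history: "sets (history k) = sets (known (earlier k))"
proof -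
  let ?X = "sets (vimage_algebra (space M) (x k) borel)"
  let ?D = "\<Union>q\<in>earlier k. sets (vimage_algebra (space M) (dr q) (draw_space S))"
  have eq: "(\<Union>t\<in>{..<k}. \<Union>i\<in>{1..n}. sets (vimage_algebra (space M) (draw idx seed coin t i) (draw_space S))) = ?D"
    by auto
  have X: "?X \<subseteq> sets (known (earlier k))"
    using measurable_sets[OF x_known[OF order_refl, of k]]
    by (subst sets_vimage_algebra2) auto
  have D: "?D \<subseteq> sets (known (earlier k))"
    unfolding sets_generated by (rule sigma_sets_superset_generator)
  have XD: "?X \<union> ?D \<subseteq> Pow (space M)"
    using order_trans[OF X sets.space_closed] order_trans[OF D sets.space_closed]
    unfolding space_generated by (rule Un_least)
  show "space (history k) = space M"
    unfolding past_def eq by (rule space_measure_of[OF XD])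
  have "sets (history k) = sigma_sets (space M) (?X \<union> ?D)"
    unfolding past_def eq by (rule sets_measure_of[OF XD])
  also have "\<dots> = sets (known (earlier k))"
  proof (rule subset_antisym)
    show "sigma_sets (space M) (?X \<union> ?D) \<subseteq> sets (known (earlier k))"
      using sets.sigma_sets_subset[of "?X \<union> ?D" "known (earlier k)"] X D by simp
    show "sets (known (earlier k)) \<subseteq> sigma_sets (space M) (?X \<union> ?D)"
      unfolding sets_generated by (rule sigma_sets_mono') auto
  qed
  finally show "sets (history k) = sets (known (earlier k))" .
qed

lemma subalgebra_history: "subalgebra M (history k)"
  using subalgebra_known[of "earlier k"] by (auto simp: subalgebra_def space_history sets_history)

text \<open>Conditional expectations are identified by integrals over past events, so every conditional statement below is
  obtained from an unconditional one with an indicator.\<close>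

lemma cond_exp_historyI:
  assumes T: "integrable M T" and U: "integrable M U" "U \<in> borel_measurable (known (earlier k))"
    and eq: "\<And>A. A \<in> sets (known (earlier k)) \<Longrightarrow>
      (\<integral>\<xi>. indicat_real A \<xi> * T \<xi> \<partial>M) = (\<integral>\<xi>. indicat_real A \<xi> * U \<xi> \<partial>M)"
  shows "AE \<xi> in M. real_cond_exp M (history k) T \<xi> = U \<xi>"
proof -
  interpret H: finite_measure_subalgebra M "history k"
    by standard (rule subalgebra_history)
  have meas: "U \<in> borel_measurable (history k)"
    using U(2) by (subst measurable_cong_sets[OF sets_history refl])
  show ?thesis
    by (rule H.real_cond_exp_charact[OF _ T U(1) meas])
       (use eq in \<open>simp add: set_lebesgue_integral_def sets_history\<close>)
qed

definition gbar :: "nat \<Rightarrow> 'b \<Rightarrow> 'a" where "gbar k \<xi> = avg n (\<lambda>i. g k i \<xi>)"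
definition nbar :: "nat \<Rightarrow> 'b \<Rightarrow> 'a" where "nbar k \<xi> = avg n (\<lambda>i. noise (k, i) \<xi>)"
definition ebar :: "nat \<Rightarrow> 'b \<Rightarrow> 'a" where "ebar k \<xi> = avg n (\<lambda>i. e k i \<xi>)"
definition total_energy :: "nat \<Rightarrow> 'b \<Rightarrow> real" where
  "total_energy k \<xi> = 1 / real n * avg n (\<lambda>i. energy k i \<xi>)"
definition spread :: "nat \<Rightarrow> 'b \<Rightarrow> real" where
  "spread k \<xi> = sigma_sq n m fs xs (\<lambda>i. w k i \<xi>)"

lemma gbar_eq: "gbar k \<xi> = grad f (x k \<xi>) + nbar k \<xi>"
  by (simp add: gbar_def nbar_def noise_def avg_diff grad_global)

lemma nbar_eq_sum: "nbar k \<xi> = (1 / real n) *\<^sub>R (\<Sum>q\<in>{k} \<times> {1..n}. noise q \<xi>)"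
  unfolding nbar_def avg_def sum_singleton_times ..

lemma nbar_square_integrable: "square_integrable M (nbar k)"
  unfolding nbar_def by (rule square_integrable_avg[OF noise_square_integrable]) auto

lemma gbar_square_integrable: "square_integrable M (gbar k)"
  unfolding gbar_def by (rule square_integrable_avg[OF g_square_integrable])

lemma gbar_known: "earlier (Suc k) \<subseteq> J \<Longrightarrow> gbar k \<in> borel_measurable (known J)"
  unfolding gbar_def by (rule measurable_avg[OF g_known]) auto

lemma nbar_orthogonal:
  assumes "square_integrable M X" "X \<in> borel_measurable (known (earlier k))"
  shows "(\<integral>\<xi>. X \<xi> \<bullet> nbar k \<xi> \<partial>M) = 0"
proof -
  have "(\<integral>\<xi>. X \<xi> \<bullet> nbar k \<xi> \<partial>M) = (\<integral>\<xi>. avg n (\<lambda>i. X \<xi> \<bullet> noise (k, i) \<xi>) \<partial>M)"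
    unfolding nbar_def avg_inner_right ..
  also have "\<dots> = avg n (\<lambda>i. \<integral>\<xi>. X \<xi> \<bullet> noise (k, i) \<xi> \<partial>M)"
    by (rule integrable_avg(2)) (rule square_integrable_inner[OF assms(1) noise_square_integrable], simp)
  also have "\<dots> = avg n (\<lambda>i. 0)"
    by (rule avg_cong, rule fresh_noise_orthogonal[OF _ assms]) auto
  finally show ?thesis by (simp add: avg_const[OF n])
qed

lemma total_energy_known: "total_energy k \<in> borel_measurable (known (earlier k))"
  unfolding total_energy_def
  by (rule borel_measurable_times[OF borel_measurable_const measurable_avg[OF energy_known]])

lemma total_energy_integrable: "integrable M (total_energy k)"
  unfolding total_energy_def by (intro integrable_mult_right integrable_avg energy_integrable)

lemma nbar_energy:
  assumes A: "A \<in> sets (known (earlier k))"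
  shows "(\<integral>\<xi>. indicat_real A \<xi> * (norm (nbar k \<xi>))\<^sup>2 \<partial>M) = (\<integral>\<xi>. indicat_real A \<xi> * total_energy k \<xi> \<partial>M)"
proof -
  have AM: "A \<in> sets M" by (rule known_sets[OF A]) auto
  have int: "integrable M (\<lambda>\<xi>. indicat_real A \<xi> * energy k i \<xi>)" if "i \<in> {1..n}" for i
    using integrable_mult_indicator[OF AM energy_integrable[OF that, of k]] by simp
  have "(\<integral>\<xi>. indicat_real A \<xi> * (norm (nbar k \<xi>))\<^sup>2 \<partial>M)
      = (\<integral>\<xi>. (1 / real n)\<^sup>2 * (indicat_real A \<xi> * (norm (\<Sum>q\<in>{k} \<times> {1..n}. noise q \<xi>))\<^sup>2) \<partial>M)"
    unfolding nbar_eq_sum by (simp add: power_divide mult_ac)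
  also have "\<dots> = (1 / real n)\<^sup>2 * (\<Sum>q\<in>{k} \<times> {1..n}. \<integral>\<xi>. indicat_real A \<xi> * (norm (noise q \<xi>))\<^sup>2 \<partial>M)"
    unfolding integral_mult_right_zero
    by (subst noise_pythagoras[OF _ _ _ A]) auto
  also have "\<dots> = (1 / real n)\<^sup>2 * (\<Sum>i=1..n. \<integral>\<xi>. indicat_real A \<xi> * energy k i \<xi> \<partial>M)"
    unfolding sum_singleton_times by (simp add: integral_noise_energy[OF _ A])
  also have "\<dots> = (\<integral>\<xi>. (1 / real n)\<^sup>2 * (\<Sum>i=1..n. indicat_real A \<xi> * energy k i \<xi>) \<partial>M)"
    unfolding integral_mult_right_zero by (subst Bochner_Integration.integral_sum[OF int]) auto
  also have "\<dots> = (\<integral>\<xi>. indicat_real A \<xi> * total_energy k \<xi> \<partial>M)"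
    unfolding total_energy_def avg_def sum_distrib_left[symmetric] by (simp add: power2_eq_square mult_ac)
  finally show ?thesis .
qed

lemma indicator_grad:
  assumes A: "A \<in> sets (known (earlier k))"
  shows "square_integrable M (\<lambda>\<xi>. indicat_real A \<xi> *\<^sub>R grad f (x k \<xi>))"
    and "(\<lambda>\<xi>. indicat_real A \<xi> *\<^sub>R grad f (x k \<xi>)) \<in> borel_measurable (known (earlier k))"
proof -
  have AM: "A \<in> sets M" by (rule known_sets[OF A]) auto
  show "square_integrable M (\<lambda>\<xi>. indicat_real A \<xi> *\<^sub>R grad f (x k \<xi>))"
    by (rule square_integrable_indicator[OF square_integrable_grad(3)[OF x_square_integrable] AM])
  show "(\<lambda>\<xi>. indicat_real A \<xi> *\<^sub>R grad f (x k \<xi>)) \<in> borel_measurable (known (earlier k))"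
    by (rule borel_measurable_scaleR[OF borel_measurable_indicator[OF A]
          measurable_compose[OF x_known[OF order_refl] grad_measurable(3)]])
qed

lemma gbar_second_moment:
  assumes A: "A \<in> sets (known (earlier k))"
  shows "(\<integral>\<xi>. indicat_real A \<xi> * (norm (gbar k \<xi>))\<^sup>2 \<partial>M)
      = (\<integral>\<xi>. indicat_real A \<xi> * ((norm (grad f (x k \<xi>)))\<^sup>2 + total_energy k \<xi>) \<partial>M)"
proof -
  have AM: "A \<in> sets M" by (rule known_sets[OF A]) auto
  let ?G = "\<lambda>\<xi>. indicat_real A \<xi> * (norm (grad f (x k \<xi>)))\<^sup>2"
  let ?N = "\<lambda>\<xi>. indicat_real A \<xi> * (norm (nbar k \<xi>))\<^sup>2"
  let ?C = "\<lambda>\<xi>. (indicat_real A \<xi> *\<^sub>R grad f (x k \<xi>)) \<bullet> nbar k \<xi>"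
  have G: "integrable M ?G"
    using integrable_mult_indicator[OF AM square_integrableD[OF square_integrable_grad(3)[OF x_square_integrable]]]
    by simp
  have N: "integrable M ?N"
    using integrable_mult_indicator[OF AM square_integrableD[OF nbar_square_integrable]] by simp
  have C: "integrable M ?C"
    by (rule square_integrable_inner[OF indicator_grad(1)[OF A] nbar_square_integrable])
  have E: "integrable M (\<lambda>\<xi>. indicat_real A \<xi> * total_energy k \<xi>)"
    using integrable_mult_indicator[OF AM total_energy_integrable] by simp
  have "(\<integral>\<xi>. indicat_real A \<xi> * (norm (gbar k \<xi>))\<^sup>2 \<partial>M) = (\<integral>\<xi>. ?G \<xi> + 2 * ?C \<xi> + ?N \<xi> \<partial>M)"
    unfolding gbar_eq power2_norm_eq_inner
    by (simp add: inner_add_left inner_add_right inner_commute algebra_simps)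
  also have "\<dots> = (\<integral>\<xi>. ?G \<xi> \<partial>M) + 2 * (\<integral>\<xi>. ?C \<xi> \<partial>M) + (\<integral>\<xi>. ?N \<xi> \<partial>M)"
    using G N C by simp
  also have "\<dots> = (\<integral>\<xi>. ?G \<xi> \<partial>M) + (\<integral>\<xi>. indicat_real A \<xi> * total_energy k \<xi> \<partial>M)"
    unfolding nbar_orthogonal[OF indicator_grad[OF A]] nbar_energy[OF A] by simp
  also have "\<dots> = (\<integral>\<xi>. indicat_real A \<xi> * ((norm (grad f (x k \<xi>)))\<^sup>2 + total_energy k \<xi>) \<partial>M)"
    unfolding distrib_left by (rule Bochner_Integration.integral_add[OF G E, symmetric])
  finally show ?thesis .
qed

lemma f_measurable: "f \<in> borel_measurable borel"
proof -
  have "continuous (at z) f" for z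
    using GDERIV_global[of z] unfolding gderiv_def by (rule has_derivative_continuous)
  then have "continuous_on UNIV f" by (simp add: continuous_at_imp_continuous_on)
  then show ?thesis by (rule borel_measurable_continuous_onI)
qed

lemma gap_integrable_comp:
  assumes X: "square_integrable M X"
  shows "integrable M (\<lambda>\<xi>. gap (X \<xi>))" "integrable M (\<lambda>\<xi>. f (X \<xi>))"
proof -
  have meas: "(\<lambda>\<xi>. f (X \<xi>)) \<in> borel_measurable M"
    using X f_measurable unfolding square_integrable_def by (blast intro: measurable_compose)
  have "integrable M (\<lambda>\<xi>. L / 2 * (norm (X \<xi> - xs))\<^sup>2)"
    by (intro integrable_mult_right square_integrableD square_integrable_diff X square_integrable_const)
  then show 1: "integrable M (\<lambda>\<xi>. gap (X \<xi>))"
  proof (rule Bochner_Integration.integrable_bound)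
    show "(\<lambda>\<xi>. gap (X \<xi>)) \<in> borel_measurable M"
      unfolding gap_def by (rule borel_measurable_diff[OF meas borel_measurable_const])
    show "AE \<xi> in M. norm (gap (X \<xi>)) \<le> norm (L / 2 * (norm (X \<xi> - xs))\<^sup>2)"
      using gap_quadratic_bound gap_nonneg L by (intro AE_I2) simp
  qed
  have "integrable M (\<lambda>\<xi>. gap (X \<xi>) + f xs)" using 1 by simp
  then show "integrable M (\<lambda>\<xi>. f (X \<xi>))" by (simp add: gap_def)
qed

lemma gap_integrable: "integrable M (\<lambda>\<xi>. gap (x k \<xi>))"
  by (rule gap_integrable_comp[OF x_square_integrable])

lemma sigma_sq_integrable:
  assumes "\<And>i. i \<in> {1..n} \<Longrightarrow> square_integrable M (W i)"
  shows "integrable M (\<lambda>\<xi>. sigma_sq n m fs xs (\<lambda>i. W i \<xi>))"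
  unfolding sigma_sq_eq_avg
  by (intro integrable_avg square_integrableD square_integrable_diff square_integrable_grad
      square_integrable_const assms)

lemma spread_integrable: "integrable M (spread k)"
  unfolding spread_def by (rule sigma_sq_integrable[OF w_square_integrable])

lemma total_energy_bounds:
  defines "c \<equiv> 1 + 2 * \<omega> / real n"
  shows "total_energy k \<xi> + (norm (grad f (x k \<xi>)))\<^sup>2
      \<le> 4 * L * c * gap (x k \<xi>) + 2 * c * spread k \<xi> + 2 * \<omega> / real n * heterogeneity"
    and "total_energy k \<xi>
      \<le> 6 * L * c * gap (x k \<xi>) + 2 * c * spread k \<xi> + 6 / 5 * \<omega> / real n * heterogeneity"
proof -
  have "total_energy k \<xi> \<le> 1 / real n * avg n (\<lambda>i. noise_bound \<omega> i (x k \<xi>) (w k i \<xi>))"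
    unfolding total_energy_def by (intro mult_left_mono avg_mono energy_bounds) simp_all
  then show "total_energy k \<xi> + (norm (grad f (x k \<xi>)))\<^sup>2
      \<le> 4 * L * c * gap (x k \<xi>) + 2 * c * spread k \<xi> + 2 * \<omega> / real n * heterogeneity"
    "total_energy k \<xi>
      \<le> 6 * L * c * gap (x k \<xi>) + 2 * c * spread k \<xi> + 6 / 5 * \<omega> / real n * heterogeneity"
    using total_noise_bounds[of \<omega> "x k \<xi>" "\<lambda>i. w k i \<xi>"] \<omega>
    unfolding spread_def c_def by linarith+
qed

text \<open>The coin of a worker is part of its draw and hence independent of the past; the index and the seed integrate out.\<close>

lemma coin_flip:
  fixes \<phi> :: "'a \<Rightarrow> real"
  assumes i: "i \<in> {1..n}" and A: "A \<in> sets (known (earlier k))"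
    and \<phi>: "\<phi> \<in> borel_measurable borel" "\<And>z. 0 \<le> \<phi> z"
    and int: "integrable M (\<lambda>\<xi>. \<phi> (x k \<xi>))" "integrable M (\<lambda>\<xi>. \<phi> (w k i \<xi>))"
  shows "(\<integral>\<xi>. indicat_real A \<xi> * \<phi> (w (Suc k) i \<xi>) \<partial>M)
      = (\<integral>\<xi>. indicat_real A \<xi> * (p * \<phi> (x k \<xi>) + (1 - p) * \<phi> (w k i \<xi>)) \<partial>M)"
proof -
  interpret S: prob_space S by (rule prob_S)
  have p': "0 \<le> p" "p \<le> 1" using p by auto
  let ?h = "\<lambda>\<xi> (y :: nat \<times> 's \<times> bool). indicat_real A \<xi> * (if snd (snd y) then \<phi> (x k \<xi>) else \<phi> (w k i \<xi>))"
  have coin: "(\<lambda>y. snd (snd y)) \<in> measurable (draw_space S) (count_space UNIV)"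
    unfolding draw_space_def by measurable
  have const: "(\<lambda>y. if snd (snd y) then a else b) \<in> borel_measurable (draw_space S)" for a b :: real
    by (rule measurable_If[OF borel_measurable_const borel_measurable_const])
       (use coin in \<open>simp only: pred_def\<close>)
  have law: "(\<integral>y. c * (if snd (snd y) then a else b) \<partial>law) = c * (p * a + (1 - p) * b)"
    "integrable law (\<lambda>y. c * (if snd (snd y) then a else b))" for a b c :: real
  proof -
    have meas: "(\<lambda>y. c * (if snd (snd y) then a else b)) \<in> borel_measurable (draw_space S)"
      by (rule borel_measurable_times[OF borel_measurable_const const])
    show "integrable law (\<lambda>y. c * (if snd (snd y) then a else b))"
      by (rule integrable_draw_law[OF prob_S m p' meas]) simp
    show "(\<integral>y. c * (if snd (snd y) then a else b) \<partial>law) = c * (p * a + (1 - p) * b)"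
      by (subst integral_draw_law[OF prob_S m p' meas])
         (simp_all add: avg_const[OF m] S.prob_space algebra_simps)
  qed
  have "(\<integral>\<xi>. ?h \<xi> (dr (k, i) \<xi>) \<partial>M) = (\<integral>\<xi>. \<integral>y. ?h \<xi> y \<partial>law \<partial>M)"
  proof (rule fresh_draw_integral[of "earlier k"])
    have "(\<lambda>\<zeta>. snd (snd (snd \<zeta>))) \<in> measurable (known (earlier k) \<Otimes>\<^sub>M draw_space S) (count_space UNIV)"
      by (rule measurable_compose[OF measurable_snd coin])
    then have "{\<zeta> \<in> space (known (earlier k) \<Otimes>\<^sub>M draw_space S). snd (snd (snd \<zeta>))}
        \<in> sets (known (earlier k) \<Otimes>\<^sub>M draw_space S)"
      unfolding pred_def .
    then have "(\<lambda>\<zeta>. if snd (snd (snd \<zeta>)) then \<phi> (x k (fst \<zeta>)) else \<phi> (w k i (fst \<zeta>)))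
        \<in> borel_measurable (known (earlier k) \<Otimes>\<^sub>M draw_space S)"
      by (rule measurable_If[OF
            measurable_compose[OF measurable_compose[OF measurable_fst x_known[OF order_refl]] \<phi>(1)]
            measurable_compose[OF measurable_compose[OF measurable_fst w_known[OF i order_refl]] \<phi>(1)]])
    then show "(\<lambda>\<zeta>. ?h (fst \<zeta>) (snd \<zeta>)) \<in> borel_measurable (known (earlier k) \<Otimes>\<^sub>M draw_space S)"
      by (rule borel_measurable_times[OF measurable_compose[OF measurable_fst borel_measurable_indicator[OF A]]])
    show "integrable law (?h \<xi>)" for \<xi> by (rule law(2))
    show "integrable M (\<lambda>\<xi>. \<phi> (x k \<xi>) + \<phi> (w k i \<xi>))"
      using int by (rule Bochner_Integration.integrable_add)
    have "(\<integral>y. \<bar>?h \<xi> y\<bar> \<partial>law) = (\<integral>y. ?h \<xi> y \<partial>law)" for \<xi>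
      using \<phi>(2) by (intro Bochner_Integration.integral_cong refl) (simp add: indicator_def)
    also have "\<dots> \<xi> \<le> \<phi> (x k \<xi>) + \<phi> (w k i \<xi>)" for \<xi>
      unfolding law(1) using \<phi>(2)[of "x k \<xi>"] \<phi>(2)[of "w k i \<xi>"] p'
        mult_left_le_one_le[of "\<phi> (x k \<xi>)" p] mult_left_le_one_le[of "\<phi> (w k i \<xi>)" "1 - p"]
      by (auto simp: indicator_def)
    finally show "(\<integral>y. \<bar>?h \<xi> y\<bar> \<partial>law) \<le> \<phi> (x k \<xi>) + \<phi> (w k i \<xi>)" for \<xi> .
  qed (use i in auto)
  also have "\<dots> = (\<integral>\<xi>. indicat_real A \<xi> * (p * \<phi> (x k \<xi>) + (1 - p) * \<phi> (w k i \<xi>)) \<partial>M)"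
    unfolding law(1) ..
  finally show ?thesis
    using i by (subst (asm) Bochner_Integration.integral_cong[OF refl,
          of M _ "\<lambda>\<xi>. indicat_real A \<xi> * \<phi> (w (Suc k) i \<xi>)"]) (auto simp: w_Suc draw_def)
qed

text \<open>The conditional expectation of the next \<open>spread\<close>: each reference point moves to the current iterate with
  probability \<open>p\<close>.\<close>

definition next_spread :: "nat \<Rightarrow> 'b \<Rightarrow> real" where
  "next_spread k \<xi> = p * sigma_sq n m fs xs (\<lambda>_. x k \<xi>) + (1 - p) * spread k \<xi>"

lemma next_spread_le: "next_spread k \<xi> \<le> (1 - p) * spread k \<xi> + 2 * (L * p) * gap (x k \<xi>)"
  using mult_left_mono[OF sigma_sq_constant_le[of "x k \<xi>"], of p] p unfolding next_spread_def by simp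

lemma next_spread_integrable: "integrable M (next_spread k)"
  unfolding next_spread_def
  by (intro Bochner_Integration.integrable_add integrable_mult_right spread_integrable
      sigma_sq_integrable x_square_integrable)

lemma spread_step:
  assumes A: "A \<in> sets (known (earlier k))"
  shows "(\<integral>\<xi>. indicat_real A \<xi> * spread (Suc k) \<xi> \<partial>M) = (\<integral>\<xi>. indicat_real A \<xi> * next_spread k \<xi> \<partial>M)"
proof -
  have AM: "A \<in> sets M" by (rule known_sets[OF A]) auto
  define \<phi> where "\<phi> i j z = (norm (grad (fs i j) z - grad (fs i j) xs))\<^sup>2" for i j z
  have \<phi>_int: "integrable M (\<lambda>\<xi>. \<phi> i j (X \<xi>))" if "i \<in> {1..n}" "j \<in> {1..m}" "square_integrable M X" for i j X
    unfolding \<phi>_def by (intro square_integrableD square_integrable_diff square_integrable_grad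
      square_integrable_const that)
  have int1: "integrable M (\<lambda>\<xi>. indicat_real A \<xi> * \<phi> i j (X \<xi>))"
    if "i \<in> {1..n}" "j \<in> {1..m}" "square_integrable M X" for i j X
    using integrable_mult_indicator[OF AM \<phi>_int[OF that]] by simp
  have int2: "integrable M (\<lambda>\<xi>. indicat_real A \<xi> * (p * \<phi> i j (x k \<xi>) + (1 - p) * \<phi> i j (w k i \<xi>)))"
    if "i \<in> {1..n}" "j \<in> {1..m}" for i j
    using integrable_mult_indicator[OF AM Bochner_Integration.integrable_add[OF
        integrable_mult_right[of p, OF \<phi>_int[OF that x_square_integrable]]
        integrable_mult_right[of "1 - p", OF \<phi>_int[OF that w_square_integrable[OF that(1)]]]]] by simp
  have "(\<integral>\<xi>. indicat_real A \<xi> * spread (Suc k) \<xi> \<partial>M)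
      = (\<integral>\<xi>. avg n (\<lambda>i. avg m (\<lambda>j. indicat_real A \<xi> * \<phi> i j (w (Suc k) i \<xi>))) \<partial>M)"
    unfolding spread_def sigma_sq_eq_avg avg_mult \<phi>_def ..
  also have "\<dots> = avg n (\<lambda>i. avg m (\<lambda>j. \<integral>\<xi>. indicat_real A \<xi> * \<phi> i j (w (Suc k) i \<xi>) \<partial>M))"
    by (subst integrable_avg(2), intro integrable_avg int1 w_square_integrable, assumption+)
       (intro avg_cong integrable_avg(2) int1 w_square_integrable)
  also have "\<dots> = avg n (\<lambda>i. avg m (\<lambda>j. \<integral>\<xi>. indicat_real A \<xi> * (p * \<phi> i j (x k \<xi>) + (1 - p) * \<phi> i j (w k i \<xi>)) \<partial>M))"
  proof (intro avg_cong)
    fix i j assume ij: "i \<in> {1..n}" "j \<in> {1..m}"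
    have "\<phi> i j \<in> borel_measurable borel"
      unfolding \<phi>_def
      by (intro norm_square_measurable borel_measurable_diff grad_measurable ij borel_measurable_const)
    then show "(\<integral>\<xi>. indicat_real A \<xi> * \<phi> i j (w (Suc k) i \<xi>) \<partial>M)
       = (\<integral>\<xi>. indicat_real A \<xi> * (p * \<phi> i j (x k \<xi>) + (1 - p) * \<phi> i j (w k i \<xi>)) \<partial>M)"
      by (rule coin_flip[OF ij(1) A _ _ \<phi>_int[OF ij x_square_integrable] \<phi>_int[OF ij w_square_integrable[OF ij(1)]]])
         (simp add: \<phi>_def)
  qed
  also have "\<dots> = (\<integral>\<xi>. avg n (\<lambda>i. avg m (\<lambda>j. indicat_real A \<xi> * (p * \<phi> i j (x k \<xi>) + (1 - p) * \<phi> i j (w k i \<xi>)))) \<partial>M)"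
    by (subst integrable_avg(2), intro integrable_avg int2, assumption+)
       (intro avg_cong integrable_avg(2)[symmetric] int2)
  also have "\<dots> = (\<integral>\<xi>. indicat_real A \<xi> * next_spread k \<xi> \<partial>M)"
    unfolding next_spread_def spread_def sigma_sq_eq_avg avg_mult avg_add \<phi>_def ..
  finally show ?thesis .
qed

lemma spread_known: "spread k \<in> borel_measurable (known (earlier k))"
  unfolding spread_def sigma_sq_eq_avg
  by (intro measurable_avg norm_square_measurable borel_measurable_diff borel_measurable_const
      measurable_compose[OF w_known[OF _ order_refl] grad_measurable(1)])

lemma next_spread_known: "next_spread k \<in> borel_measurable (known (earlier k))"
  unfolding next_spread_def sigma_sq_eq_avg
  by (intro borel_measurable_add borel_measurable_times borel_measurable_const spread_known
      measurable_avg norm_square_measurable borel_measurable_diff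
      measurable_compose[OF x_known[OF order_refl] grad_measurable(1)])

lemma cond_exp_gbar: "AE \<xi> in M. vec_cond_exp M (history k) (gbar k) \<xi> = grad f (x k \<xi>)"
proof -
  have "AE \<xi> in M. real_cond_exp M (history k) (\<lambda>\<zeta>. gbar k \<zeta> \<bullet> b) \<xi> = grad f (x k \<xi>) \<bullet> b" for b
  proof (rule cond_exp_historyI)
    have b: "square_integrable M (\<lambda>_. b)" by (rule square_integrable_const)
    show int: "integrable M (\<lambda>\<zeta>. gbar k \<zeta> \<bullet> b)"
      by (rule square_integrable_inner[OF gbar_square_integrable b])
    show int': "integrable M (\<lambda>\<xi>. grad f (x k \<xi>) \<bullet> b)"
      by (rule square_integrable_inner[OF square_integrable_grad(3)[OF x_square_integrable] b])
    show "(\<lambda>\<xi>. grad f (x k \<xi>) \<bullet> b) \<in> borel_measurable (known (earlier k))"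
      by (intro borel_measurable_inner borel_measurable_const
          measurable_compose[OF x_known[OF order_refl] grad_measurable(3)])
    fix A assume A: "A \<in> sets (known (earlier k))"
    have AM: "A \<in> sets M" by (rule known_sets[OF A]) auto
    have Ab: "square_integrable M (\<lambda>\<xi>. indicat_real A \<xi> *\<^sub>R b)"
      by (rule square_integrable_indicator[OF b AM])
    have "(\<integral>\<xi>. (indicat_real A \<xi> *\<^sub>R b) \<bullet> nbar k \<xi> \<partial>M) = 0"
      by (rule nbar_orthogonal[OF Ab])
         (intro borel_measurable_scaleR borel_measurable_indicator A borel_measurable_const)
    moreover have "integrable M (\<lambda>\<xi>. indicat_real A \<xi> * (grad f (x k \<xi>) \<bullet> b))"
      using integrable_mult_indicator[OF AM int'] by simp
    moreover have "integrable M (\<lambda>\<xi>. (indicat_real A \<xi> *\<^sub>R b) \<bullet> nbar k \<xi>)"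
      by (rule square_integrable_inner[OF Ab nbar_square_integrable])
    moreover have "indicat_real A \<xi> * (gbar k \<xi> \<bullet> b)
        = indicat_real A \<xi> * (grad f (x k \<xi>) \<bullet> b) + (indicat_real A \<xi> *\<^sub>R b) \<bullet> nbar k \<xi>" for \<xi>
      unfolding gbar_eq by (simp add: inner_add_left inner_commute algebra_simps)
    ultimately show "(\<integral>\<xi>. indicat_real A \<xi> * (gbar k \<xi> \<bullet> b) \<partial>M)
        = (\<integral>\<xi>. indicat_real A \<xi> * (grad f (x k \<xi>) \<bullet> b) \<partial>M)" by simp
  qed
  then have "AE \<xi> in M. \<forall>b\<in>Basis. real_cond_exp M (history k) (\<lambda>\<zeta>. gbar k \<zeta> \<bullet> b) \<xi> = grad f (x k \<xi>) \<bullet> b"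
    by (intro AE_finite_allI) auto
  then show ?thesis
  proof (rule AE_mp, intro AE_I2 impI)
    fix \<xi> assume "\<forall>b\<in>Basis. real_cond_exp M (history k) (\<lambda>\<zeta>. gbar k \<zeta> \<bullet> b) \<xi> = grad f (x k \<xi>) \<bullet> b"
    then have "vec_cond_exp M (history k) (gbar k) \<xi> = (\<Sum>b\<in>Basis. (grad f (x k \<xi>) \<bullet> b) *\<^sub>R b)"
      unfolding vec_cond_exp_def by (intro sum.cong) auto
    then show "vec_cond_exp M (history k) (gbar k) \<xi> = grad f (x k \<xi>)"
      by (simp add: euclidean_representation)
  qed
qed

lemma cond_exp_gbar_square:
  "AE \<xi> in M. real_cond_exp M (history k) (\<lambda>\<zeta>. (norm (gbar k \<zeta>))\<^sup>2) \<xi>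
     = (norm (grad f (x k \<xi>)))\<^sup>2 + total_energy k \<xi>"
proof (rule cond_exp_historyI)
  show "integrable M (\<lambda>\<zeta>. (norm (gbar k \<zeta>))\<^sup>2)"
    by (rule square_integrableD[OF gbar_square_integrable])
  show "integrable M (\<lambda>\<xi>. (norm (grad f (x k \<xi>)))\<^sup>2 + total_energy k \<xi>)"
    by (intro Bochner_Integration.integrable_add total_energy_integrable square_integrableD
        square_integrable_grad(3) x_square_integrable)
  show "(\<lambda>\<xi>. (norm (grad f (x k \<xi>)))\<^sup>2 + total_energy k \<xi>) \<in> borel_measurable (known (earlier k))"
    by (intro borel_measurable_add norm_square_measurable total_energy_known
        measurable_compose[OF x_known[OF order_refl] grad_measurable(3)])
qed (rule gbar_second_moment)

lemma cond_exp_spread: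
  "AE \<xi> in M. real_cond_exp M (history k) (spread (Suc k)) \<xi> = next_spread k \<xi>"
  by (rule cond_exp_historyI[OF spread_integrable next_spread_integrable next_spread_known spread_step])

section \<open>Accumulated delay error\<close>

lemma e_eq:
  assumes "\<xi> \<in> space M" and i: "i \<in> {1..n}"
  shows "e k i \<xi> = \<gamma> *\<^sub>R (\<Sum>t\<in>{k - \<tau>..<k}. g t i \<xi>)"
proof (induction k)
  case 0
  then show ?case using framework assms by (simp add: delayed_framework_def)
next
  case (Suc k)
  have step: "e (Suc k) i \<xi> = e k i \<xi> + \<gamma> *\<^sub>R g k i \<xi> - (if \<tau> \<le> k then \<gamma> *\<^sub>R g (k - \<tau>) i \<xi> else 0)"
    using framework assms by (simp add: delayed_framework_def)
  have last: "(\<Sum>t\<in>{k - \<tau>..<Suc k}. g t i \<xi>) = (\<Sum>t\<in>{k - \<tau>..<k}. g t i \<xi>) + g k i \<xi>"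
    by (rule sum.atLeastLessThan_Suc) simp
  show ?case
  proof (cases "\<tau> \<le> k")
    case True
    then have "(\<Sum>t\<in>{k - \<tau>..<Suc k}. g t i \<xi>) = g (k - \<tau>) i \<xi> + (\<Sum>t\<in>{Suc k - \<tau>..<Suc k}. g t i \<xi>)"
      by (subst sum.atLeast_Suc_lessThan) (auto simp: Suc_diff_le)
    with last have "(\<Sum>t\<in>{Suc k - \<tau>..<Suc k}. g t i \<xi>)
        = (\<Sum>t\<in>{k - \<tau>..<k}. g t i \<xi>) + g k i \<xi> - g (k - \<tau>) i \<xi>"
      by (simp add: algebra_simps)
    then show ?thesis using True by (simp only: step Suc.IH if_True) (simp add: algebra_simps)
  next
    case False
    then have "{Suc k - \<tau>..<Suc k} = {k - \<tau>..<Suc k}" by auto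
    then show ?thesis using False last by (simp only: step Suc.IH if_False) (simp add: algebra_simps)
  qed
qed

lemma ebar_eq:
  assumes "\<xi> \<in> space M"
  shows "ebar k \<xi> = \<gamma> *\<^sub>R (\<Sum>t\<in>{k - \<tau>..<k}. gbar t \<xi>)"
proof -
  have "ebar k \<xi> = avg n (\<lambda>i. \<gamma> *\<^sub>R (\<Sum>t\<in>{k - \<tau>..<k}. g t i \<xi>))"
    unfolding ebar_def by (rule avg_cong) (rule e_eq[OF assms])
  also have "\<dots> = \<gamma> *\<^sub>R (\<Sum>t\<in>{k - \<tau>..<k}. gbar t \<xi>)"
    unfolding gbar_def avg_def by (simp only: scaleR_sum_right[symmetric]) (subst sum.swap, simp add: mult.commute)
  finally show ?thesis .
qed

lemma ebar_square_integrable: "square_integrable M (ebar k)"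
  by (rule square_integrable_cong[OF _ ebar_eq])
     (intro square_integrable_scaleR square_integrable_sum gbar_square_integrable)

lemma ebar_known: "ebar k \<in> borel_measurable (known (earlier k))"
proof (rule known_cong[OF _ ebar_eq])
  show "(\<lambda>\<xi>. \<gamma> *\<^sub>R (\<Sum>t\<in>{k - \<tau>..<k}. gbar t \<xi>)) \<in> borel_measurable (known (earlier k))"
    by (intro borel_measurable_scaleR borel_measurable_const borel_measurable_sum gbar_known) auto
qed

lemma expected_noise:
  "i \<in> {1..n} \<Longrightarrow> (\<integral>\<xi>. (norm (noise (k, i) \<xi>))\<^sup>2 \<partial>M) = (\<integral>\<xi>. energy k i \<xi> \<partial>M)"
  using integral_noise_energy[of i "space M" k] sets.top[of "known (earlier k)"]
  by (simp cong: Bochner_Integration.integral_cong)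

lemma expected_noise_window:
  assumes "finite W"
  shows "(\<integral>\<xi>. (norm (\<Sum>t\<in>W. nbar t \<xi>))\<^sup>2 \<partial>M) = (\<Sum>t\<in>W. \<integral>\<xi>. total_energy t \<xi> \<partial>M)"
proof -
  have "(\<Sum>t\<in>W. nbar t \<xi>) = (1 / real n) *\<^sub>R (\<Sum>q\<in>W \<times> {1..n}. noise q \<xi>)" for \<xi>
    unfolding nbar_def avg_def scaleR_sum_right[symmetric] by (simp add: sum.cartesian_product)
  then have "(\<integral>\<xi>. (norm (\<Sum>t\<in>W. nbar t \<xi>))\<^sup>2 \<partial>M)
      = (\<integral>\<xi>. (1 / real n)\<^sup>2 * (norm (\<Sum>q\<in>W \<times> {1..n}. noise q \<xi>))\<^sup>2 \<partial>M)"
    by (simp add: power_divide)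
  also have "\<dots> = (1 / real n)\<^sup>2 * (\<integral>\<xi>. indicat_real (space M) \<xi> * (norm (\<Sum>q\<in>W \<times> {1..n}. noise q \<xi>))\<^sup>2 \<partial>M)"
    unfolding integral_mult_right_zero by (simp cong: Bochner_Integration.integral_cong)
  also have "\<dots> = (1 / real n)\<^sup>2 * (\<Sum>q\<in>W \<times> {1..n}. \<integral>\<xi>. indicat_real (space M) \<xi> * (norm (noise q \<xi>))\<^sup>2 \<partial>M)"
    using assms sets.top[of "known (earlier 0)"] by (subst noise_pythagoras[of _ 0]) auto
  also have "\<dots> = (1 / real n)\<^sup>2 * (\<Sum>t\<in>W. \<Sum>i=1..n. \<integral>\<xi>. (norm (noise (t, i) \<xi>))\<^sup>2 \<partial>M)"
    unfolding sum.cartesian_product by (simp add: case_prod_beta cong: Bochner_Integration.integral_cong)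
  also have "\<dots> = (\<Sum>t\<in>W. 1 / real n * avg n (\<lambda>i. \<integral>\<xi>. energy t i \<xi> \<partial>M))"
  proof -
    have "(\<Sum>i=1..n. \<integral>\<xi>. (norm (noise (t, i) \<xi>))\<^sup>2 \<partial>M) = (\<Sum>i=1..n. \<integral>\<xi>. energy t i \<xi> \<partial>M)" for t
      by (intro sum.cong refl expected_noise)
    then show ?thesis by (simp add: avg_def sum_distrib_left power2_eq_square)
  qed
  also have "\<dots> = (\<Sum>t\<in>W. \<integral>\<xi>. total_energy t \<xi> \<partial>M)"
    unfolding total_energy_def integral_mult_right_zero
    by (simp only: integrable_avg(2)[OF energy_integrable])
  finally show ?thesis .
qed

definition mean_gap :: "nat \<Rightarrow> real" where "mean_gap k = (\<integral>\<xi>. gap (x k \<xi>) \<partial>M)"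
definition mean_spread :: "nat \<Rightarrow> real" where "mean_spread k = (\<integral>\<xi>. spread k \<xi> \<partial>M)"
definition mean_error :: "nat \<Rightarrow> real" where "mean_error k = (\<integral>\<xi>. (norm (ebar k \<xi>))\<^sup>2 \<partial>M)"
definition virtual_dist :: "nat \<Rightarrow> real" where
  "virtual_dist k = (\<integral>\<xi>. (norm (x k \<xi> - ebar k \<xi> - xs))\<^sup>2 \<partial>M)"

abbreviation "c \<equiv> 1 + 2 * \<omega> / real n"
abbreviation "D1 \<equiv> 2 * \<omega> / real n * heterogeneity"

lemma mean_nonneg: "0 \<le> mean_gap k" "0 \<le> mean_spread k" "0 \<le> virtual_dist k"
  unfolding mean_gap_def mean_spread_def virtual_dist_def spread_def
  by (rule Bochner_Integration.integral_nonneg, simp add: gap_nonneg sigma_sq_nonneg)+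

lemma heterogeneity_nonneg: "0 \<le> heterogeneity"
  unfolding heterogeneity_def by (rule avg_nonneg) simp

lemma expected_total_energy:
  "(\<integral>\<xi>. total_energy k \<xi> \<partial>M) \<le> 6 * L * c * mean_gap k + 2 * c * mean_spread k + 3 / 5 * D1"
proof -
  have "(\<integral>\<xi>. total_energy k \<xi> \<partial>M)
      \<le> (\<integral>\<xi>. 6 * L * c * gap (x k \<xi>) + 2 * c * spread k \<xi> + 6 / 5 * \<omega> / real n * heterogeneity \<partial>M)"
    using total_energy_bounds(2)
    by (intro integral_mono total_energy_integrable Bochner_Integration.integrable_add
        integrable_mult_right gap_integrable spread_integrable) simp_all
  also have "\<dots> = 6 * L * c * mean_gap k + 2 * c * mean_spread k + 3 / 5 * D1"
    unfolding mean_gap_def mean_spread_def using gap_integrable[of k] spread_integrable[of k]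
    by (simp add: prob_space)
  finally show ?thesis .
qed

text \<open>Young's inequality with parameter \<open>2 / 3\<close> separates noise from gradients. The noise contributes a sum of
  variances by orthogonality, without a factor \<open>\<tau>\<close>; the gradients contribute a factor \<open>\<tau>\<close> by Cauchy-Schwarz. The factor
  \<open>5 / 3\<close> meets \<open>3 / 5\<close> from \<open>expected_total_energy\<close>, so \<open>D1\<close> enters with coefficient one.\<close>

lemma mean_error_le:
  "mean_error k \<le> \<gamma>\<^sup>2 * ((\<Sum>t\<in>{k - \<tau>..<k}. 5 * L * real \<tau> * mean_gap t + 10 * L * c * mean_gap t
      + 10 / 3 * c * mean_spread t) + real \<tau> * D1)"
proof -
  define W where "W = {k - \<tau>..<k}"
  have W: "finite W" "card W \<le> \<tau>" by (auto simp: W_def)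
  have D1: "0 \<le> D1" using \<omega> heterogeneity_nonneg by simp
  have nW: "integrable M (\<lambda>\<xi>. (norm (\<Sum>t\<in>W. nbar t \<xi>))\<^sup>2)"
    by (intro square_integrableD square_integrable_sum nbar_square_integrable)
  have gW: "integrable M (\<lambda>\<xi>. \<Sum>t\<in>W. 2 * L * gap (x t \<xi>))"
    by (intro Bochner_Integration.integrable_sum integrable_mult_right gap_integrable)
  have "(norm (ebar k \<xi>))\<^sup>2
      \<le> \<gamma>\<^sup>2 * (5 / 3 * (norm (\<Sum>t\<in>W. nbar t \<xi>))\<^sup>2 + 5 / 2 * (real \<tau> * (\<Sum>t\<in>W. 2 * L * gap (x t \<xi>))))"
    if \<xi>: "\<xi> \<in> space M" for \<xi>
  proof -
    have "(norm (\<Sum>t\<in>W. grad f (x t \<xi>)))\<^sup>2 \<le> real (card W) * (\<Sum>t\<in>W. (norm (grad f (x t \<xi>)))\<^sup>2)"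
      by (rule norm_sum_squared_le)
    also have "\<dots> \<le> real \<tau> * (\<Sum>t\<in>W. 2 * L * gap (x t \<xi>))"
      using W(2) by (intro mult_mono sum_mono norm_grad_global sum_nonneg) auto
    finally have grads: "(norm (\<Sum>t\<in>W. grad f (x t \<xi>)))\<^sup>2 \<le> real \<tau> * (\<Sum>t\<in>W. 2 * L * gap (x t \<xi>))" .
    have "(norm (ebar k \<xi>))\<^sup>2 = \<gamma>\<^sup>2 * (norm ((\<Sum>t\<in>W. nbar t \<xi>) + (\<Sum>t\<in>W. grad f (x t \<xi>))))\<^sup>2"
      unfolding ebar_eq[OF \<xi>] W_def[symmetric] gbar_eq sum.distrib
      by (simp add: power_mult_distrib add.commute)
    also have "\<dots> \<le> \<gamma>\<^sup>2 * (5 / 3 * (norm (\<Sum>t\<in>W. nbar t \<xi>))\<^sup>2 + 5 / 2 * (norm (\<Sum>t\<in>W. grad f (x t \<xi>)))\<^sup>2)"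
      using young_norm_square[of "2/3" "\<Sum>t\<in>W. nbar t \<xi>" "\<Sum>t\<in>W. grad f (x t \<xi>)"]
      by (intro mult_left_mono) simp_all
    also have "\<dots> \<le> \<gamma>\<^sup>2 * (5 / 3 * (norm (\<Sum>t\<in>W. nbar t \<xi>))\<^sup>2 + 5 / 2 * (real \<tau> * (\<Sum>t\<in>W. 2 * L * gap (x t \<xi>))))"
      using grads by (intro mult_left_mono add_left_mono) auto
    finally show ?thesis .
  qed
  then have "mean_error k \<le> (\<integral>\<xi>. \<gamma>\<^sup>2 * (5 / 3 * (norm (\<Sum>t\<in>W. nbar t \<xi>))\<^sup>2
      + 5 / 2 * (real \<tau> * (\<Sum>t\<in>W. 2 * L * gap (x t \<xi>)))) \<partial>M)"
    unfolding mean_error_def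
    by (intro integral_mono square_integrableD ebar_square_integrable integrable_mult_right
        Bochner_Integration.integrable_add nW gW)
  also have "\<dots> = \<gamma>\<^sup>2 * (5 / 3 * (\<integral>\<xi>. (norm (\<Sum>t\<in>W. nbar t \<xi>))\<^sup>2 \<partial>M)
      + 5 / 2 * (real \<tau> * (\<integral>\<xi>. (\<Sum>t\<in>W. 2 * L * gap (x t \<xi>)) \<partial>M)))"
    using nW gW by simp
  also have "(\<integral>\<xi>. (\<Sum>t\<in>W. 2 * L * gap (x t \<xi>)) \<partial>M) = (\<Sum>t\<in>W. 2 * L * mean_gap t)"
    unfolding mean_gap_def
    by (subst Bochner_Integration.integral_sum) (intro integrable_mult_right gap_integrable, simp)
  also have "(\<integral>\<xi>. (norm (\<Sum>t\<in>W. nbar t \<xi>))\<^sup>2 \<partial>M) = (\<Sum>t\<in>W. \<integral>\<xi>. total_energy t \<xi> \<partial>M)"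
    by (rule expected_noise_window[OF W(1)])
  also have "\<gamma>\<^sup>2 * (5 / 3 * (\<Sum>t\<in>W. \<integral>\<xi>. total_energy t \<xi> \<partial>M) + 5 / 2 * (real \<tau> * (\<Sum>t\<in>W. 2 * L * mean_gap t)))
     \<le> \<gamma>\<^sup>2 * (5 / 3 * (\<Sum>t\<in>W. 6 * L * c * mean_gap t + 2 * c * mean_spread t + 3 / 5 * D1)
        + 5 / 2 * (real \<tau> * (\<Sum>t\<in>W. 2 * L * mean_gap t)))"
    by (intro mult_left_mono add_right_mono sum_mono expected_total_energy) auto
  also have "\<dots> = \<gamma>\<^sup>2 * ((\<Sum>t\<in>W. 5 * L * real \<tau> * mean_gap t + 10 * L * c * mean_gap t
      + 10 / 3 * c * mean_spread t) + real (card W) * D1)"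
  proof -
    have "5 / 3 * (\<Sum>t\<in>W. 6 * L * c * mean_gap t + 2 * c * mean_spread t + 3 / 5 * D1)
        + 5 / 2 * (real \<tau> * (\<Sum>t\<in>W. 2 * L * mean_gap t))
      = (\<Sum>t\<in>W. 5 / 3 * (6 * L * c * mean_gap t + 2 * c * mean_spread t + 3 / 5 * D1)
        + 5 / 2 * (real \<tau> * (2 * L * mean_gap t)))"
      unfolding sum_distrib_left by (rule sum.distrib[symmetric])
    also have "\<dots> = (\<Sum>t\<in>W. (5 * L * real \<tau> * mean_gap t + 10 * L * c * mean_gap t
      + 10 / 3 * c * mean_spread t) + D1)"
      by (intro sum.cong refl) (simp add: field_simps)
    also have "\<dots> = (\<Sum>t\<in>W. 5 * L * real \<tau> * mean_gap t + 10 * L * c * mean_gap t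
      + 10 / 3 * c * mean_spread t) + real (card W) * D1"
      unfolding sum.distrib[of _ "\<lambda>_. D1"] sum_constant ..
    finally show ?thesis by simp
  qed
  also have "\<dots> \<le> \<gamma>\<^sup>2 * ((\<Sum>t\<in>W. 5 * L * real \<tau> * mean_gap t + 10 * L * c * mean_gap t
      + 10 / 3 * c * mean_spread t) + real \<tau> * D1)"
    using W(2) D1 by (intro mult_left_mono add_left_mono mult_right_mono) auto
  finally show ?thesis unfolding W_def .
qed

lemma mean_spread_step: "mean_spread (Suc k) \<le> (1 - p) * mean_spread k + 2 * L * p * mean_gap k"
proof -
  have "mean_spread (Suc k) = (\<integral>\<xi>. next_spread k \<xi> \<partial>M)"
    using spread_step[of "space M" k] sets.top[of "known (earlier k)"] unfolding mean_spread_def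
    by (simp cong: Bochner_Integration.integral_cong)
  also have "\<dots> \<le> (\<integral>\<xi>. (1 - p) * spread k \<xi> + 2 * (L * p) * gap (x k \<xi>) \<partial>M)"
    by (intro integral_mono next_spread_integrable Bochner_Integration.integrable_add
        integrable_mult_right gap_integrable spread_integrable next_spread_le)
  also have "\<dots> = (1 - p) * mean_spread k + 2 * L * p * mean_gap k"
    unfolding mean_gap_def mean_spread_def using gap_integrable[of k] spread_integrable[of k] by simp
  finally show ?thesis .
qed

section \<open>Virtual iterates\<close>

text \<open>The delayed step \<open>v\<close> is subtracted from the iterate and from the error alike, so it cancels in their difference.\<close>

lemma virtual_step:
  assumes \<xi>: "\<xi> \<in> space M"
  shows "x (Suc k) \<xi> - ebar (Suc k) \<xi> = x k \<xi> - ebar k \<xi> - \<gamma> *\<^sub>R gbar k \<xi>"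
proof -
  have "x (Suc k) \<xi> = x k \<xi> - avg n (\<lambda>i. v k i \<xi>)"
    using framework \<xi> by (simp add: delayed_framework_def)
  moreover have "ebar (Suc k) \<xi> = avg n (\<lambda>i. e k i \<xi> + \<gamma> *\<^sub>R g k i \<xi> - v k i \<xi>)"
    unfolding ebar_def using framework \<xi> by (intro avg_cong) (simp add: delayed_framework_def)
  moreover have "avg n (\<lambda>i. \<gamma> *\<^sub>R g k i \<xi>) = \<gamma> *\<^sub>R gbar k \<xi>"
    unfolding avg_def gbar_def by (simp add: scaleR_sum_right[symmetric] mult.commute)
  ultimately show ?thesis by (simp add: avg_diff avg_add ebar_def)
qed

text \<open>The inner product is split as \<open>(z - xs) - u\<close>. Quasi strong convexity handles the first part; for the second, Young's
  inequality spends half of the gap. Passing from \<open>z - xs\<close> to \<open>z - u - xs\<close> costs another multiple \<open>\<mu> \<le> L\<close> of the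
  square of \<open>u\<close>.\<close>

lemma descent_direction:
  assumes \<gamma>: "\<gamma> \<ge> 0"
  shows "- 2 * \<gamma> * ((z - u - xs) \<bullet> grad f z)
     \<le> 3 * \<gamma> * L * (norm u)\<^sup>2 - \<gamma> * gap z - \<gamma> * \<mu> / 2 * (norm (z - u - xs))\<^sup>2"
proof -
  have "(z - u - xs) \<bullet> grad f z = grad f z \<bullet> (z - xs) - u \<bullet> grad f z"
    by (simp add: inner_diff_left inner_diff_right inner_commute)
  moreover have "2 * (u \<bullet> grad f z) \<le> 2 * L * (norm u)\<^sup>2 + gap z"
  proof -
    have "0 \<le> (norm (grad f z - (2 * L) *\<^sub>R u))\<^sup>2" by simp
    also have "\<dots> = 4 * L\<^sup>2 * (norm u)\<^sup>2 - 4 * L * (u \<bullet> grad f z) + (norm (grad f z))\<^sup>2"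
      unfolding norm_diff_scaleR_squared by (simp add: inner_commute power2_eq_square)
    also have "\<dots> \<le> 4 * L\<^sup>2 * (norm u)\<^sup>2 - 4 * L * (u \<bullet> grad f z) + 2 * L * gap z"
      using norm_grad_global(2) by simp
    finally have "2 * L * (2 * (u \<bullet> grad f z)) \<le> 2 * L * (2 * L * (norm u)\<^sup>2 + gap z)"
      by (simp add: power2_eq_square algebra_simps)
    then show ?thesis using L by (simp only: mult_le_cancel_left_pos mult_pos_pos zero_less_numeral)
  qed
  moreover have "\<mu> / 2 * (norm (z - u - xs))\<^sup>2 \<le> \<mu> * (norm (z - xs))\<^sup>2 + L * (norm u)\<^sup>2"
  proof -
    have "\<mu> / 2 * (norm (z - u - xs))\<^sup>2 = \<mu> / 2 * (norm ((z - xs) - u))\<^sup>2"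
      by (simp add: algebra_simps)
    also have "\<dots> \<le> \<mu> / 2 * (2 * (norm (z - xs))\<^sup>2 + 2 * (norm u)\<^sup>2)"
      using \<mu> by (intro mult_left_mono norm_diff_squared_le) simp
    also have "\<dots> \<le> \<mu> * (norm (z - xs))\<^sup>2 + L * (norm u)\<^sup>2"
      using mult_right_mono[OF \<mu>_le_L, of "(norm u)\<^sup>2"] by (simp add: algebra_simps)
    finally show ?thesis .
  qed
  ultimately have "- 2 * ((z - u - xs) \<bullet> grad f z)
      \<le> 3 * L * (norm u)\<^sup>2 - gap z - \<mu> / 2 * (norm (z - u - xs))\<^sup>2"
    using qsc_gap[of z] by linarith
  from mult_left_mono[OF this \<gamma>] show ?thesis by (simp add: algebra_simps)
qed

text \<open>The virtual iterate is determined by the past, so its inner product with the fresh noise has mean zero.\<close>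

lemma virtual_dist_step:
  assumes \<gamma>: "\<gamma> \<ge> 0"
  shows "virtual_dist (Suc k) \<le> (1 - \<gamma> * \<mu> / 2) * virtual_dist k - \<gamma> * mean_gap k
     + 3 * \<gamma> * L * mean_error k + \<gamma>\<^sup>2 * (4 * L * c * mean_gap k + 2 * c * mean_spread k + D1)"
proof -
  define y where "y \<xi> = x k \<xi> - ebar k \<xi> - xs" for \<xi>
  have y: "square_integrable M y"
    unfolding y_def by (intro square_integrable_diff x_square_integrable ebar_square_integrable square_integrable_const)
  have yk: "y \<in> borel_measurable (known (earlier k))"
    unfolding y_def by (intro borel_measurable_diff x_known ebar_known borel_measurable_const order_refl)
  have G: "square_integrable M (\<lambda>\<xi>. grad f (x k \<xi>))"
    by (rule square_integrable_grad(3)[OF x_square_integrable])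
  note int = square_integrableD[OF y] square_integrable_inner[OF y G]
    square_integrable_inner[OF y nbar_square_integrable[of k]] square_integrableD[OF gbar_square_integrable[of k]]
    square_integrableD[OF ebar_square_integrable[of k]] gap_integrable[of k] spread_integrable[of k]
    total_energy_integrable[of k] square_integrableD[OF G]
  have expand: "(norm (x (Suc k) \<xi> - ebar (Suc k) \<xi> - xs))\<^sup>2
      = (norm (y \<xi>))\<^sup>2 - 2 * \<gamma> * (y \<xi> \<bullet> grad f (x k \<xi>)) - 2 * \<gamma> * (y \<xi> \<bullet> nbar k \<xi>) + \<gamma>\<^sup>2 * (norm (gbar k \<xi>))\<^sup>2"
    if \<xi>: "\<xi> \<in> space M" for \<xi>
  proof -
    have "x (Suc k) \<xi> - ebar (Suc k) \<xi> - xs = y \<xi> - \<gamma> *\<^sub>R gbar k \<xi>"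
      using virtual_step[OF \<xi>, of k] by (simp add: y_def)
    then have "(norm (x (Suc k) \<xi> - ebar (Suc k) \<xi> - xs))\<^sup>2
        = (norm (y \<xi>))\<^sup>2 - 2 * \<gamma> * (y \<xi> \<bullet> gbar k \<xi>) + \<gamma>\<^sup>2 * (norm (gbar k \<xi>))\<^sup>2"
      by (simp only: norm_diff_scaleR_squared)
    also have "y \<xi> \<bullet> gbar k \<xi> = y \<xi> \<bullet> grad f (x k \<xi>) + y \<xi> \<bullet> nbar k \<xi>"
      unfolding gbar_eq by (rule inner_add_right)
    finally show ?thesis by (simp add: algebra_simps)
  qed
  have "virtual_dist (Suc k) = (\<integral>\<xi>. (norm (y \<xi>))\<^sup>2 - 2 * \<gamma> * (y \<xi> \<bullet> grad f (x k \<xi>))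
      - 2 * \<gamma> * (y \<xi> \<bullet> nbar k \<xi>) + \<gamma>\<^sup>2 * (norm (gbar k \<xi>))\<^sup>2 \<partial>M)"
    unfolding virtual_dist_def by (rule Bochner_Integration.integral_cong[OF refl expand])
  also have "\<dots> = (\<integral>\<xi>. (norm (y \<xi>))\<^sup>2 - 2 * \<gamma> * (y \<xi> \<bullet> grad f (x k \<xi>)) \<partial>M) + \<gamma>\<^sup>2 * (\<integral>\<xi>. (norm (gbar k \<xi>))\<^sup>2 \<partial>M)"
    using int nbar_orthogonal[OF y yk] by simp
  also have "(\<integral>\<xi>. (norm (y \<xi>))\<^sup>2 - 2 * \<gamma> * (y \<xi> \<bullet> grad f (x k \<xi>)) \<partial>M)
      \<le> (\<integral>\<xi>. (1 - \<gamma> * \<mu> / 2) * (norm (y \<xi>))\<^sup>2 - \<gamma> * gap (x k \<xi>) + 3 * \<gamma> * L * (norm (ebar k \<xi>))\<^sup>2 \<partial>M)"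
  proof (rule integral_mono)
    show "(norm (y \<xi>))\<^sup>2 - 2 * \<gamma> * (y \<xi> \<bullet> grad f (x k \<xi>))
        \<le> (1 - \<gamma> * \<mu> / 2) * (norm (y \<xi>))\<^sup>2 - \<gamma> * gap (x k \<xi>) + 3 * \<gamma> * L * (norm (ebar k \<xi>))\<^sup>2" for \<xi>
      using descent_direction[OF \<gamma>, of "x k \<xi>" "ebar k \<xi>"] unfolding y_def by (simp add: algebra_simps)
  qed (use int in simp_all)
  also have "\<dots> = (1 - \<gamma> * \<mu> / 2) * virtual_dist k - \<gamma> * mean_gap k + 3 * \<gamma> * L * mean_error k"
    using int by (simp add: virtual_dist_def mean_gap_def mean_error_def y_def)
  also have "(\<integral>\<xi>. (norm (gbar k \<xi>))\<^sup>2 \<partial>M) = (\<integral>\<xi>. (norm (grad f (x k \<xi>)))\<^sup>2 + total_energy k \<xi> \<partial>M)"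
    using gbar_second_moment[of "space M" k] sets.top[of "known (earlier k)"]
    by (simp cong: Bochner_Integration.integral_cong)
  also have "\<dots> \<le> (\<integral>\<xi>. 4 * L * c * gap (x k \<xi>) + 2 * c * spread k \<xi> + D1 \<partial>M)"
    using total_energy_bounds(1)[of k] int
    by (intro integral_mono Bochner_Integration.integrable_add integrable_mult_right) (simp_all add: add.commute)
  also have "\<dots> = 4 * L * c * mean_gap k + 2 * c * mean_spread k + D1"
    using int by (simp add: mean_gap_def mean_spread_def prob_space)
  finally show ?thesis by (simp add: mult_left_mono)
qed

end

section \<open>The parametric assumption and the rates\<close>

locale delayed_qlsvrg_small_step = delayed_qlsvrg +
  assumes \<gamma>_pos: "0 < \<gamma>"
    and \<gamma>_le: "\<gamma> \<le> min (3 / (56 * L * (1 + 2 * \<omega> / real n)))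
      (1 / (8 * L * sqrt (real \<tau> * (real \<tau> + 2 * (1 + 2 * \<omega> / real n) * (1 + 2 / (1 - p))))))"
begin

lemma c_ge_1: "c \<ge> 1"
  using \<omega> by simp

lemma \<gamma>_variance: "\<gamma> * (56 * L * c) \<le> 3"
proof -
  have "0 < 56 * L * c" using L c_ge_1 by (intro mult_pos_pos) auto
  then show ?thesis using \<gamma>_le by (simp add: pos_le_divide_eq)
qed

text \<open>Only \<open>1 + 2 / (1 - p) \<ge> 3\<close> is extracted from the step-size bound.\<close>

lemma \<gamma>_delay: "64 * L\<^sup>2 * \<gamma>\<^sup>2 * real \<tau> * (real \<tau> + 6 * c) \<le> 1"
proof -
  define B where "B = real \<tau> * (real \<tau> + 2 * c * (1 + 2 / (1 - p)))"
  have "2 / (1 - p) \<ge> 2" using p by (simp add: pos_le_divide_eq)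
  then have "2 * c * 3 \<le> 2 * c * (1 + 2 / (1 - p))" using c_ge_1 by (intro mult_left_mono) auto
  then have B: "real \<tau> * (real \<tau> + 6 * c) \<le> B" unfolding B_def by (intro mult_left_mono) auto
  have "0 < real \<tau> * (real \<tau> + 6 * c)" using \<tau> c_ge_1 by (intro mult_pos_pos) auto
  then have B0: "0 < B" using B by linarith
  have "\<gamma> \<le> 1 / (8 * L * sqrt B)" using \<gamma>_le by (simp add: B_def)
  then have "\<gamma> * (8 * L * sqrt B) \<le> 1" using B0 L by (subst (asm) pos_le_divide_eq) auto
  then have "(\<gamma> * (8 * L * sqrt B))\<^sup>2 \<le> 1\<^sup>2"
    using \<gamma>_pos L B0 by (intro power_mono) auto
  then have "64 * L\<^sup>2 * \<gamma>\<^sup>2 * B \<le> 1" using B0 by (simp add: power_mult_distrib mult_ac)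
  moreover have "64 * L\<^sup>2 * \<gamma>\<^sup>2 * (real \<tau> * (real \<tau> + 6 * c)) \<le> 64 * L\<^sup>2 * \<gamma>\<^sup>2 * B"
    using B by (intro mult_left_mono) auto
  ultimately show ?thesis by (simp only: mult.assoc)
qed

abbreviation "\<eta> \<equiv> min (\<gamma> * \<mu> / 2) (p / 4)"

lemma \<eta>_bounds: "0 \<le> \<eta>" "\<eta> \<le> p / 4" "\<eta> \<le> \<gamma> * \<mu> / 2" "\<eta> < 1" "real \<tau> * \<eta> \<le> 1 / 16"
proof -
  show "0 \<le> \<eta>" "\<eta> \<le> p / 4" "\<eta> \<le> \<gamma> * \<mu> / 2" "\<eta> < 1" using \<gamma>_pos \<mu> p by auto
  have "(8 * L * \<gamma> * real \<tau>)\<^sup>2 = 64 * L\<^sup>2 * \<gamma>\<^sup>2 * real \<tau> * real \<tau>"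
    by (simp add: power_mult_distrib power2_eq_square)
  also have "\<dots> \<le> 64 * L\<^sup>2 * \<gamma>\<^sup>2 * real \<tau> * (real \<tau> + 6 * c)"
    using c_ge_1 by (intro mult_left_mono) auto
  also have "\<dots> \<le> 1\<^sup>2" using \<gamma>_delay by simp
  finally have "8 * L * \<gamma> * real \<tau> \<le> 1" by (rule power2_le_imp_le) simp
  moreover have "real \<tau> * \<eta> \<le> real \<tau> * (\<gamma> * L / 2)"
    using \<gamma>_pos mult_left_mono[OF \<mu>_le_L, of \<gamma>] by (intro mult_left_mono min.coboundedI1) auto
  ultimately show "real \<tau> * \<eta> \<le> 1 / 16" by (simp add: mult_ac)
qed

abbreviation "D3 \<equiv> 3 * \<gamma> * real \<tau> * L * D1"
abbreviation "F2 \<equiv> 12 * \<gamma>\<^sup>2 * L * real \<tau> * c * (2 + p) / p"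

lemma D1_nonneg: "0 \<le> D1"
  using \<omega> heterogeneity_nonneg by simp

lemma weighted_mean_error:
  "3 * L * (\<Sum>k\<le>K. weight \<eta> k * mean_error k)
     \<le> 1 / 4 * (\<Sum>k\<le>K. weight \<eta> k * mean_gap k) + F2 * mean_spread 0 + \<gamma> * D3 * weight_sum \<eta> K"
  by (rule weighted_delay_error[where r=mean_gap and s=mean_spread and er=mean_error,
        OF mean_error_le mean_spread_step mean_nonneg(1,2) p \<eta>_bounds(1,2,5) L c_ge_1 \<gamma>_pos D1_nonneg \<gamma>_delay])

lemma weighted_mean_gap:
  "(\<Sum>k\<le>K. weight \<eta> k * mean_gap k)
     \<le> 4 * (virtual_dist 0 + 8 * c / (3 * p) * \<gamma>\<^sup>2 * mean_spread 0 + \<gamma> * F2 * mean_spread 0) / \<gamma>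
       + 4 * \<gamma> * (D1 + D3) * weight_sum \<eta> K"
  by (rule weighted_suboptimality[where r=mean_gap and s=mean_spread and er=mean_error and X=virtual_dist,
        OF virtual_dist_step mean_spread_step weighted_mean_error mean_nonneg(3,1,2) p \<eta>_bounds(3,2)
          L c_ge_1 \<gamma>_pos \<gamma>_variance])
     (use \<gamma>_pos in simp)

abbreviation "\<sigma>0 \<equiv> sigma_sq n m fs xs w0"

lemma spread_0: "\<xi> \<in> space M \<Longrightarrow> spread 0 \<xi> = \<sigma>0"
  unfolding spread_def sigma_sq_eq_avg by (intro avg_cong) (simp add: w_0)

lemma mean_spread_0: "mean_spread 0 = \<sigma>0"
proof -
  have "mean_spread 0 = (\<integral>\<xi>. \<sigma>0 \<partial>M)"
    unfolding mean_spread_def by (rule Bochner_Integration.integral_cong[OF refl spread_0])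
  then show ?thesis by (simp add: prob_space)
qed

lemma virtual_dist_0: "virtual_dist 0 = (norm (x0 - xs))\<^sup>2"
proof -
  have "virtual_dist 0 = (\<integral>\<xi>. (norm (x0 - xs))\<^sup>2 \<partial>M)"
    unfolding virtual_dist_def by (rule Bochner_Integration.integral_cong[OF refl]) (simp add: x_0 ebar_eq)
  then show ?thesis by (simp add: prob_space)
qed

lemma parametric_assumption_holds:
  fixes params :: parametric_constants
  assumes params: "par_A params = 2 * L * c" "par_B1 params = 0" "par_B2 params = 2 * c"
      "par_D1 params = D1" "par_rho1 params = 1" "par_rho2 params = p" "par_C1 params = 0"
      "par_C2 params = L * p" "par_D2 params = 0" "par_G params = 0" "par_F1 params = 0"
      "par_F2 params = F2" "par_D3 params = D3"
    and eta: "par_eta \<gamma> \<mu> params = \<eta>"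
  shows "parametric_assumption M history f xs L \<gamma> \<mu> x gbar ebar (\<lambda>k \<xi>. 0) spread params"
  unfolding parametric_assumption_def params eta
proof (intro conjI allI)
  fix k K
  show "subalgebra M (history k)" by (rule subalgebra_history)
  show "integrable M (gbar k)"
    by (rule square_integrable_imp_integrable[OF gbar_square_integrable])
  show "integrable M (\<lambda>\<xi>. (norm (gbar k \<xi>))\<^sup>2)" "integrable M (\<lambda>\<xi>. (norm (ebar k \<xi>))\<^sup>2)"
    by (rule square_integrableD[OF gbar_square_integrable], rule square_integrableD[OF ebar_square_integrable])
  show "integrable M (\<lambda>\<xi>. f (x k \<xi>))" by (rule gap_integrable_comp[OF x_square_integrable])
  show "integrable M (\<lambda>\<xi>. 0 :: real)" by simp
  show "integrable M (spread k)" by (rule spread_integrable)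
  show "AE \<xi> in M. vec_cond_exp M (history k) (gbar k) \<xi> = grad f (x k \<xi>)" by (rule cond_exp_gbar)
  show "AE \<xi> in M. real_cond_exp M (history k) (\<lambda>\<zeta>. (norm (gbar k \<zeta>))\<^sup>2) \<xi>
      \<le> 2 * (2 * L * c) * (f (x k \<xi>) - f xs) + 0 * 0 + 2 * c * spread k \<xi> + D1"
    using cond_exp_gbar_square[of k]
  proof (rule AE_mp, intro AE_I2 impI)
    fix \<xi> assume "real_cond_exp M (history k) (\<lambda>\<zeta>. (norm (gbar k \<zeta>))\<^sup>2) \<xi>
      = (norm (grad f (x k \<xi>)))\<^sup>2 + total_energy k \<xi>"
    then show "real_cond_exp M (history k) (\<lambda>\<zeta>. (norm (gbar k \<zeta>))\<^sup>2) \<xi>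
      \<le> 2 * (2 * L * c) * (f (x k \<xi>) - f xs) + 0 * 0 + 2 * c * spread k \<xi> + D1"
      using total_energy_bounds(1)[of k \<xi>] by (simp add: gap_def)
  qed
  have zero: "AE \<xi> in M. real_cond_exp M (history k) (\<lambda>\<xi>. 0) \<xi> = 0"
    by (rule cond_exp_historyI) (simp_all only: integrable_zero borel_measurable_const)
  show "AE \<xi> in M. real_cond_exp M (history k) (\<lambda>\<xi>. 0) \<xi>
      \<le> (1 - 1) * 0 + 2 * 0 * (f (x k \<xi>) - f xs) + 0 * 1 * spread k \<xi> + 0"
    using zero by (rule AE_mp) (intro AE_I2 impI, simp)
  show "AE \<xi> in M. real_cond_exp M (history k) (spread (Suc k)) \<xi>
      \<le> (1 - p) * spread k \<xi> + 2 * (L * p) * (f (x k \<xi>) - f xs)"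
    using cond_exp_spread[of k]
    by (rule AE_mp) (intro AE_I2 impI, use next_spread_le[of k] in \<open>simp only: gap_def\<close>)
  show "AE \<xi> in M. 3 * L * (\<Sum>k\<le>K. weight \<eta> k * (\<integral>\<zeta>. (norm (ebar k \<zeta>))\<^sup>2 \<partial>M))
      \<le> 1 / 4 * (\<Sum>k\<le>K. weight \<eta> k * (\<integral>\<zeta>. f (x k \<zeta>) - f xs \<partial>M))
        + 0 * 0 + F2 * spread 0 \<xi> + \<gamma> * D3 * weight_sum \<eta> K"
  proof (intro AE_I2)
    fix \<xi> assume "\<xi> \<in> space M"
    then show "3 * L * (\<Sum>k\<le>K. weight \<eta> k * (\<integral>\<zeta>. (norm (ebar k \<zeta>))\<^sup>2 \<partial>M))
      \<le> 1 / 4 * (\<Sum>k\<le>K. weight \<eta> k * (\<integral>\<zeta>. f (x k \<zeta>) - f xs \<partial>M))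
        + 0 * 0 + F2 * spread 0 \<xi> + \<gamma> * D3 * weight_sum \<eta> K"
      using weighted_mean_error[of K] unfolding mean_error_def mean_gap_def gap_def mean_spread_0
      by (simp only: spread_0 mult_zero_left add_0_right)
  qed
qed

abbreviation xbar :: "nat \<Rightarrow> 'b \<Rightarrow> 'a" where
  "xbar K \<xi> \<equiv> weighted_avg \<eta> (\<lambda>k. x k \<xi>) K"

abbreviation "T0 \<equiv> (norm (x0 - xs))\<^sup>2 + 8 * c / (3 * p) * \<gamma>\<^sup>2 * \<sigma>0"

lemma weight_sum_ge: "weight \<eta> K \<le> weight_sum \<eta> K"
  unfolding weight_sum_def using weight_pos[OF \<eta>_bounds(4)]
  by (intro member_le_sum) (auto simp: less_imp_le)

lemma weight_sum_pos: "0 < weight_sum \<eta> K"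
  using weight_sum_ge[of K] weight_pos[OF \<eta>_bounds(4), of K] by linarith

lemma xbar_square_integrable: "square_integrable M (xbar K)"
  unfolding weighted_avg_def
  by (intro square_integrable_scaleR square_integrable_sum x_square_integrable)

lemma gap_xbar: "gap (xbar K \<xi>) \<le> (\<Sum>k\<le>K. weight \<eta> k * gap (x k \<xi>)) / weight_sum \<eta> K"
proof -
  let ?a = "\<lambda>k. weight \<eta> k / weight_sum \<eta> K"
  have sum1: "(\<Sum>k\<le>K. ?a k) = 1"
    using weight_sum_pos[of K] by (simp add: sum_divide_distrib[symmetric] weight_sum_def)
  have "f (\<Sum>k\<le>K. ?a k *\<^sub>R x k \<xi>) \<le> (\<Sum>k\<le>K. ?a k * f (x k \<xi>))"
    using weight_pos[OF \<eta>_bounds(4)] weight_sum_pos[of K]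
    by (intro convex_on_sum[OF _ _ convex_global sum1]) (auto simp: less_imp_le)
  moreover have "xbar K \<xi> = (\<Sum>k\<le>K. ?a k *\<^sub>R x k \<xi>)"
    unfolding weighted_avg_def scaleR_sum_right by simp
  moreover have "(\<Sum>k\<le>K. ?a k * gap (x k \<xi>)) = (\<Sum>k\<le>K. ?a k * f (x k \<xi>)) - f xs"
    unfolding gap_def right_diff_distrib sum_subtractf sum_distrib_right[symmetric] sum1 by simp
  ultimately show ?thesis by (simp add: gap_def sum_divide_distrib)
qed

lemma expected_gap_xbar:
  "(\<integral>\<xi>. f (xbar K \<xi>) - f xs \<partial>M)
     \<le> 4 * (T0 + \<gamma> * F2 * \<sigma>0) / \<gamma> / weight_sum \<eta> K + 4 * \<gamma> * (D1 + D3)"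
proof -
  have int: "integrable M (\<lambda>\<xi>. weight \<eta> k * gap (x k \<xi>))" for k
    by (intro integrable_mult_right gap_integrable)
  have "(\<integral>\<xi>. f (xbar K \<xi>) - f xs \<partial>M) = (\<integral>\<xi>. gap (xbar K \<xi>) \<partial>M)"
    by (simp only: gap_def)
  also have "\<dots> \<le> (\<integral>\<xi>. (\<Sum>k\<le>K. weight \<eta> k * gap (x k \<xi>)) / weight_sum \<eta> K \<partial>M)"
    by (intro integral_mono gap_integrable_comp(1) xbar_square_integrable gap_xbar
        integrable_divide Bochner_Integration.integrable_sum int)
  also have "\<dots> = (\<Sum>k\<le>K. weight \<eta> k * mean_gap k) / weight_sum \<eta> K"
    using int by (simp add: mean_gap_def Bochner_Integration.integral_sum)
  also have "\<dots> \<le> (4 * (T0 + \<gamma> * F2 * \<sigma>0) / \<gamma> + 4 * \<gamma> * (D1 + D3) * weight_sum \<eta> K) / weight_sum \<eta> K"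
    using weighted_mean_gap[of K] weight_sum_pos[of K]
    unfolding virtual_dist_0 mean_spread_0 by (intro divide_right_mono) auto
  also have "\<dots> = 4 * (T0 + \<gamma> * F2 * \<sigma>0) / \<gamma> / weight_sum \<eta> K + 4 * \<gamma> * (D1 + D3)"
    using weight_sum_pos[of K] by (simp add: add_divide_distrib)
  finally show ?thesis .
qed

lemma initial_nonneg: "0 \<le> 4 * (T0 + \<gamma> * F2 * \<sigma>0) / \<gamma>"
proof -
  have "0 \<le> F2" using L c_ge_1 p by (intro divide_nonneg_nonneg mult_nonneg_nonneg) auto
  then have F: "0 \<le> \<gamma> * F2 * \<sigma>0"
    using \<gamma>_pos by (intro mult_nonneg_nonneg[OF mult_nonneg_nonneg sigma_sq_nonneg]) auto
  have "0 \<le> 8 * c / (3 * p) * \<gamma>\<^sup>2 * \<sigma>0"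
    using c_ge_1 p sigma_sq_nonneg[of w0] by (intro mult_nonneg_nonneg divide_nonneg_nonneg) auto
  from add_nonneg_nonneg[OF add_nonneg_nonneg[OF zero_le_power2 this] F]
  have "0 \<le> T0 + \<gamma> * F2 * \<sigma>0" .
  then show ?thesis using \<gamma>_pos by simp
qed

lemma linear_rate:
  "(\<integral>\<xi>. f (xbar K \<xi>) - f xs \<partial>M)
     \<le> (1 - \<eta>) ^ K * (4 * (T0 + \<gamma> * F2 * \<sigma>0) / \<gamma>) + 4 * \<gamma> * (D1 + D3)"
proof -
  let ?C = "4 * (T0 + \<gamma> * F2 * \<sigma>0) / \<gamma>"
  have "1 / weight_sum \<eta> K \<le> 1 / weight \<eta> K"
    using weight_sum_ge weight_pos[OF \<eta>_bounds(4)] by (intro divide_left_mono) (auto intro: mult_pos_pos weight_sum_pos)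
  also have "\<dots> = (1 - \<eta>) ^ Suc K" by (simp add: weight_def inverse_eq_divide)
  also have "\<dots> \<le> (1 - \<eta>) ^ K" using \<eta>_bounds(1,4) by (intro power_decreasing) auto
  finally have "?C * (1 / weight_sum \<eta> K) \<le> ?C * (1 - \<eta>) ^ K"
    by (rule mult_left_mono[OF _ initial_nonneg])
  then show ?thesis using expected_gap_xbar[of K] by (simp add: mult.commute)
qed

lemma sublinear_rate:
  assumes "\<mu> = 0" "K \<ge> 1"
  shows "(\<integral>\<xi>. f (xbar K \<xi>) - f xs \<partial>M)
     \<le> 4 * (T0 + \<gamma> * F2 * \<sigma>0) / (\<gamma> * real K) + 4 * \<gamma> * (D1 + D3)"
proof -
  let ?C = "4 * (T0 + \<gamma> * F2 * \<sigma>0) / \<gamma>"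
  have "\<eta> = 0" using assms(1) p by simp
  then have "weight_sum \<eta> K = real K + 1" by (simp only: weight_sum_def weight_def) simp
  then have "?C / weight_sum \<eta> K \<le> ?C / real K"
    using assms(2) by (intro divide_left_mono[OF _ initial_nonneg]) auto
  then show ?thesis using expected_gap_xbar[of K] by (simp add: divide_divide_eq_left)
qed

end

theorem theoremK7:
  fixes M :: "'b measure" and S :: "'s measure"
    and fs :: "nat \<Rightarrow> nat \<Rightarrow> 'a::euclidean_space \<Rightarrow> real"
    and Q :: "'a \<Rightarrow> 's \<Rightarrow> 'a"
    and idx :: "nat \<Rightarrow> nat \<Rightarrow> 'b \<Rightarrow> nat"
    and seed :: "nat \<Rightarrow> nat \<Rightarrow> 'b \<Rightarrow> 's"
    and coin :: "nat \<Rightarrow> nat \<Rightarrow> 'b \<Rightarrow> bool"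
    and x :: "nat \<Rightarrow> 'b \<Rightarrow> 'a"
    and w g v e :: "nat \<Rightarrow> nat \<Rightarrow> 'b \<Rightarrow> 'a"
    and x0 xs :: 'a and w0 :: "nat \<Rightarrow> 'a"
    and n m \<tau> :: nat and L \<mu> \<gamma> p \<omega> :: real
  assumes "prob_space M"
    and "n \<ge> 1" and "m \<ge> 1" and "\<tau> \<ge> 1"
    and "L > 0" and "\<mu> \<ge> 0" and "\<omega> > 0" and "0 < p" and "p < 1"
    and "\<And>i j. i \<in> {1..n} \<Longrightarrow> j \<in> {1..m} \<Longrightarrow> convex_on UNIV (fs i j)"
    and "\<And>i j. i \<in> {1..n} \<Longrightarrow> j \<in> {1..m} \<Longrightarrow> L_smooth L (fs i j)"
    and "quasi_strongly_convex \<mu> (global_loss n m fs) xs"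
    and "quantizer S Q \<omega>"
    and "fresh_randomness M S n m p idx seed coin"
    and "delayed_framework M n \<tau> \<gamma> x0 x g v e"
    and "qlsvrg_oracle M n m fs Q idx seed coin w0 x w g"
    and "0 < \<gamma>"
    and "\<gamma> \<le> min (3 / (56 * L * (1 + 2 * \<omega> / real n)))
                 (1 / (8 * L * sqrt (real \<tau> * (real \<tau> + 2 * (1 + 2 * \<omega> / real n) * (1 + 2 / (1 - p))))))"
  shows
    "let f = global_loss n m fs;
         c = 1 + 2 * \<omega> / real n;
         G2 = (\<Sum>i=1..n. (norm (grad (local_loss m fs i) xs))\<^sup>2);
         D1 = 2 * \<omega> / (real n)\<^sup>2 * G2;
         D3 = 6 * \<gamma> * real \<tau> * L * \<omega> / (real n)\<^sup>2 * G2;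
         F2 = 12 * \<gamma>\<^sup>2 * L * real \<tau> * c * (2 + p) / p;
         params = \<lparr> par_A = 2 * L * c, par_B1 = 0, par_B2 = 2 * c, par_D1 = D1,
                    par_rho1 = 1, par_rho2 = p, par_C1 = 0, par_C2 = L * p, par_D2 = 0,
                    par_G = 0, par_F1 = 0, par_F2 = F2, par_D3 = D3 \<rparr>;
         \<sigma>0 = sigma_sq n m fs xs w0;
         M2 = 8 * c / (3 * p);
         T0 = (norm (x0 - xs))\<^sup>2 + M2 * \<gamma>\<^sup>2 * \<sigma>0;
         xbar = (\<lambda>K \<xi>. weighted_avg (par_eta \<gamma> \<mu> params) (\<lambda>k. x k \<xi>) K)
     in parametric_assumption M (past M S n idx seed coin x) f xs L \<gamma> \<mu> x
          (\<lambda>k \<xi>. avg n (\<lambda>i. g k i \<xi>)) (\<lambda>k \<xi>. avg n (\<lambda>i. e k i \<xi>))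
          (\<lambda>k \<xi>. 0) (\<lambda>k \<xi>. sigma_sq n m fs xs (\<lambda>i. w k i \<xi>)) params
      \<and> (\<forall>K. integrable M (\<lambda>\<xi>. f (xbar K \<xi>)))
      \<and> (\<mu> > 0 \<longrightarrow> (\<forall>K. (\<integral>\<xi>. f (xbar K \<xi>) - f xs \<partial>M)
            \<le> (1 - min (\<gamma> * \<mu> / 2) (p / 4)) ^ K * (4 * (T0 + \<gamma> * F2 * \<sigma>0) / \<gamma>)
               + 4 * \<gamma> * (D1 + D3)))
      \<and> (\<mu> = 0 \<longrightarrow> (\<forall>K\<ge>1. (\<integral>\<xi>. f (xbar K \<xi>) - f xs \<partial>M)
            \<le> 4 * (T0 + \<gamma> * F2 * \<sigma>0) / (\<gamma> * real K) + 4 * \<gamma> * (D1 + D3)))"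
proof -
  interpret delayed_qlsvrg_small_step n m L \<mu> fs xs M S Q idx seed coin x w g v e x0 w0 \<tau> \<gamma> p \<omega>
    using assms
    by (intro delayed_qlsvrg_small_step.intro delayed_qlsvrg.intro finite_sum_problem.intro
        delayed_qlsvrg_axioms.intro delayed_qlsvrg_small_step_axioms.intro)
  let ?G2 = "\<Sum>i=1..n. (norm (grad (local_loss m fs i) xs))\<^sup>2"
  have D1: "2 * \<omega> / (real n)\<^sup>2 * ?G2 = D1"
    by (simp add: heterogeneity_def avg_def power2_eq_square)
  have D3: "6 * \<gamma> * real \<tau> * L * \<omega> / (real n)\<^sup>2 * ?G2 = D3"
    unfolding D1[symmetric] by simp
  let ?params = "\<lparr> par_A = 2 * L * c, par_B1 = 0, par_B2 = 2 * c, par_D1 = D1,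
      par_rho1 = 1, par_rho2 = p, par_C1 = 0, par_C2 = L * p, par_D2 = 0,
      par_G = 0, par_F1 = 0, par_F2 = F2, par_D3 = D3 \<rparr>"
  have eta: "par_eta \<gamma> \<mu> ?params = \<eta>"
    using p by (simp add: par_eta_def)
  have bars: "(\<lambda>k \<xi>. avg n (\<lambda>i. g k i \<xi>)) = gbar" "(\<lambda>k \<xi>. avg n (\<lambda>i. e k i \<xi>)) = ebar"
    "(\<lambda>k \<xi>. sigma_sq n m fs xs (\<lambda>i. w k i \<xi>)) = spread"
    by (simp_all add: fun_eq_iff gbar_def ebar_def spread_def)
  show ?thesis
    unfolding Let_def D1 D3 eta bars
    by (intro conjI allI impI parametric_assumption_holds gap_integrable_comp(2) xbar_square_integrable
        linear_rate sublinear_rate eta)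
       simp_all
qed

end
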